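(* Let $H$ be a Hopf algebra over a field $k$ with invertible antipode. (i) The category ${}_H\mathsf{PMod}$ of partial $H$-modules is enriched over the monoidal category ${}_H\mathsf{Mod}$ if the Hom-object between partial modules $M$ and $N$ is taken to be $[M,N]=\mathrm{Hom}_{{}_H\mathsf{PMod}}(H\otimes M,N)$. (ii) Let ${}_H\mathsf{Mod}^{\mathrm{rev}}$ be the monoidal category of $H$-modules with reversed tensor product. Then ${}_H\mathsf{PMod}$ is enriched over ${}_H\mathsf{Mod}^{\mathrm{rev}}$ if the Hom-object between partial modules $M$ and $N$ is taken to be $\{M,N\}=\mathrm{Hom}_{{}_H\mathsf{PMod}}(M\otimes H,N)$.
   Context: Notation: $H$ has antipode $S$ and comultiplication $\Delta(h)=h_{(1)}\otimes h_{(2)}$ (Sweedler notation). A (global) $H$-module is a left $H$-module, action written $h\triangleright x$; ${}_H\mathsf{Mod}$ is their category, monoidal for $\otimes=\otimes_k$ with diagonal action; ${}_H\mathsf{Mod}^{\mathrm{rev}}$ has tensor product $X\otimes^{\mathrm{rev}}Y=Y\otimes X$. A partial representation of $H$ in a $k$-algebra $B$ is a $k$-linear map $\pi:H\to B$ such that $\pi(1_H)=1_B$; $\pi(h)\pi(l_{(1)})\pi(S(l_{(2)}))=\pi(hl_{(1)})\pi(S(l_{(2)}))$; and $\pi(h_{(1)})\pi(S(h_{(2)}))\pi(l)=\pi(h_{(1)})\pi(S(h_{(2)})l)$ for all $h,l\in H$. A partial $H$-module is a $k$-vector space $M$ with a partial representation $\pi:H\to\mathrm{End}_k(M)$; one writes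 $h\bullet m=\pi(h)(m)$. Morphisms are $k$-linear maps $f$ with $f(h\bullet m)=h\bullet f(m)$. The category is ${}_H\mathsf{PMod}$. For a partial $H$-module $M$, the spaces $H\otimes M$ and $M\otimes H$ are partial $H$-modules by $h\bullet(l\otimes m)=h_{(1)}l\otimes h_{(2)}\bullet m$ and $h\bullet(m\otimes l)=h_{(1)}\bullet m\otimes h_{(2)}l$. The left $H$-module structures on $[M,N]$ and $\{M,N\}$ are $(h'\rightharpoonup f)(h\otimes m)=f(hh'\otimes m)$ and $(h'\rightharpoonup f)(m\otimes h)=f(m\otimes hh')$. Saying that a category $\mathcal M$ is enriched over a monoidal category $\mathcal V$ with given Hom-objects means that there are composition and unit morphisms in $\mathcal V$ turning the objects of $\mathcal M$ with these Hom-objects into a $\mathcal V$-category whose underlying ordinary category is $\mathcal M$. *)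

theory Defs
  imports "HOL-Algebra.Module"
begin

section \<open>Linear algebra over a field\<close>

text \<open>Vector spaces are the library's \<^locale>\<open>module\<close>s over a \<^locale>\<open>field\<close>. Its record has
  multiplicative fields as well; they are meaningful for algebras only and are never looked at for
  mere vector spaces.\<close>

definition linear_maps ::
  "('k, 'r) ring_scheme \<Rightarrow> ('k, 'a, 'x) module_scheme \<Rightarrow> ('k, 'b, 'y) module_scheme \<Rightarrow> ('a \<Rightarrow> 'b) set"
  where "linear_maps R V W =
    {f \<in> carrier V \<rightarrow> carrier W.
      (\<forall>x\<in>carrier V. \<forall>y\<in>carrier V. f (x \<oplus>\<^bsub>V\<^esub> y) = f x \<oplus>\<^bsub>W\<^esub> f y) \<and>
      (\<forall>c\<in>carrier R. \<forall>x\<in>carrier V. f (c \<odot>\<^bsub>V\<^esub> x) = c \<odot>\<^bsub>W\<^esub> f x)}"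

text \<open>Normalised outside the carrier, so that equality of linear maps is equality of functions.\<close>

definition Lin ::
  "('k, 'r) ring_scheme \<Rightarrow> ('k, 'a, 'x) module_scheme \<Rightarrow> ('k, 'b, 'y) module_scheme \<Rightarrow> ('a \<Rightarrow> 'b) set"
  where "Lin R V W = linear_maps R V W \<inter> extensional (carrier V)"

definition self_module :: "('k, 'r) ring_scheme \<Rightarrow> ('k, 'k) module"
  where "self_module R =
    \<lparr>carrier = carrier R, mult = mult R, one = one R, zero = zero R, add = add R, smult = mult R\<rparr>"

definition k_algebra :: "('k, 'r) ring_scheme \<Rightarrow> ('k, 'a, 'x) module_scheme \<Rightarrow> bool"
  where "k_algebra R A \<longleftrightarrow> module R A \<and> ring A \<and>
    (\<forall>c\<in>carrier R. \<forall>x\<in>carrier A. \<forall>y\<in>carrier A.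
      (c \<odot>\<^bsub>A\<^esub> x) \<otimes>\<^bsub>A\<^esub> y = c \<odot>\<^bsub>A\<^esub> (x \<otimes>\<^bsub>A\<^esub> y) \<and>
      x \<otimes>\<^bsub>A\<^esub> (c \<odot>\<^bsub>A\<^esub> y) = c \<odot>\<^bsub>A\<^esub> (x \<otimes>\<^bsub>A\<^esub> y))"

text \<open>A set of functions on \<open>V\<close> with values in \<open>W\<close>, with pointwise operations.\<close>

definition map_space ::
  "('k, 'a, 'x) module_scheme \<Rightarrow> ('k, 'b, 'y) module_scheme \<Rightarrow> ('a \<Rightarrow> 'b) set \<Rightarrow> ('k, 'a \<Rightarrow> 'b) module"
  where "map_space V W F =
    \<lparr>carrier = F, mult = undefined, one = undefined,
     zero = (\<lambda>x\<in>carrier V. \<zero>\<^bsub>W\<^esub>),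
     add = (\<lambda>f g. \<lambda>x\<in>carrier V. f x \<oplus>\<^bsub>W\<^esub> g x),
     smult = (\<lambda>c f. \<lambda>x\<in>carrier V. c \<odot>\<^bsub>W\<^esub> f x)\<rparr>"

definition End_algebra ::
  "('k, 'r) ring_scheme \<Rightarrow> ('k, 'a, 'x) module_scheme \<Rightarrow> ('k, 'a \<Rightarrow> 'a) module"
  where "End_algebra R V = (map_space V V (Lin R V V))
    \<lparr>mult := compose (carrier V), one := (\<lambda>x\<in>carrier V. x)\<rparr>"

definition lsum :: "('b, 'y) ring_scheme \<Rightarrow> ('a \<Rightarrow> 'b) \<Rightarrow> 'a list \<Rightarrow> 'b"
  where "lsum W f xs = foldr (\<lambda>p s. f p \<oplus>\<^bsub>W\<^esub> s) xs \<zero>\<^bsub>W\<^esub>"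


section \<open>Tensor products\<close>

text \<open>The list \<open>[(v\<^sub>1, w\<^sub>1), \<dots>, (v\<^sub>n, w\<^sub>n)]\<close> stands for the formal sum of the \<open>v\<^sub>i \<otimes> w\<^sub>i\<close>. The
  tensor product is the free commutative monoid on pairs modulo the bilinearity relations
  (the relations \<open>0 \<otimes> w = 0\<close> and \<open>v \<otimes> 0 = 0\<close> make the quotient a group, with
  \<open>-(v \<otimes> w) = (-v) \<otimes> w\<close>).\<close>

inductive tensor_eq ::
  "('k, 'r) ring_scheme \<Rightarrow> ('k, 'a, 'x) module_scheme \<Rightarrow> ('k, 'b, 'y) module_scheme \<Rightarrow>
   ('a \<times> 'b) list \<Rightarrow> ('a \<times> 'b) list \<Rightarrow> bool"
  for R V W where
  refl: "set xs \<subseteq> carrier V \<times> carrier W \<Longrightarrow> tensor_eq R V W xs xs"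
| sym: "tensor_eq R V W xs ys \<Longrightarrow> tensor_eq R V W ys xs"
| trans: "tensor_eq R V W xs ys \<Longrightarrow> tensor_eq R V W ys zs \<Longrightarrow> tensor_eq R V W xs zs"
| append: "tensor_eq R V W xs xs' \<Longrightarrow> tensor_eq R V W ys ys' \<Longrightarrow> tensor_eq R V W (xs @ ys) (xs' @ ys')"
| comm: "set xs \<subseteq> carrier V \<times> carrier W \<Longrightarrow> set ys \<subseteq> carrier V \<times> carrier W \<Longrightarrow>
    tensor_eq R V W (xs @ ys) (ys @ xs)"
| zero_left: "w \<in> carrier W \<Longrightarrow> tensor_eq R V W [(\<zero>\<^bsub>V\<^esub>, w)] []"
| zero_right: "v \<in> carrier V \<Longrightarrow> tensor_eq R V W [(v, \<zero>\<^bsub>W\<^esub>)] []"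
| add_left: "v \<in> carrier V \<Longrightarrow> v' \<in> carrier V \<Longrightarrow> w \<in> carrier W \<Longrightarrow>
    tensor_eq R V W [(v \<oplus>\<^bsub>V\<^esub> v', w)] [(v, w), (v', w)]"
| add_right: "v \<in> carrier V \<Longrightarrow> w \<in> carrier W \<Longrightarrow> w' \<in> carrier W \<Longrightarrow>
    tensor_eq R V W [(v, w \<oplus>\<^bsub>W\<^esub> w')] [(v, w), (v, w')]"
| balanced: "c \<in> carrier R \<Longrightarrow> v \<in> carrier V \<Longrightarrow> w \<in> carrier W \<Longrightarrow>
    tensor_eq R V W [(c \<odot>\<^bsub>V\<^esub> v, w)] [(v, c \<odot>\<^bsub>W\<^esub> w)]"

text \<open>An element of the tensor product is represented by a chosen formal sum in its equivalence
  class. Hence an element \<open>t\<close> of a tensor product is itself a list that writes it as a sum of pure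
  tensors, and the linear map induced by a bilinear \<open>f\<close> is \<open>t \<mapsto> lsum _ (\<lambda>(v, w). f v w) t\<close>.\<close>

definition tensor_nf ::
  "('k, 'r) ring_scheme \<Rightarrow> ('k, 'a, 'x) module_scheme \<Rightarrow> ('k, 'b, 'y) module_scheme \<Rightarrow>
   ('a \<times> 'b) list \<Rightarrow> ('a \<times> 'b) list"
  where "tensor_nf R V W xs = (SOME ys. tensor_eq R V W xs ys)"

text \<open>The multiplicative fields are those of the tensor product of algebras.\<close>

definition tensor ::
  "('k, 'r) ring_scheme \<Rightarrow> ('k, 'a, 'x) module_scheme \<Rightarrow> ('k, 'b, 'y) module_scheme \<Rightarrow>
   ('k, ('a \<times> 'b) list) module"
  where "tensor R V W =
    \<lparr>carrier = {tensor_nf R V W xs |xs. set xs \<subseteq> carrier V \<times> carrier W},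
     mult = (\<lambda>s t. tensor_nf R V W [(v \<otimes>\<^bsub>V\<^esub> v', w \<otimes>\<^bsub>W\<^esub> w'). (v, w) \<leftarrow> s, (v', w') \<leftarrow> t]),
     one = tensor_nf R V W [(\<one>\<^bsub>V\<^esub>, \<one>\<^bsub>W\<^esub>)],
     zero = tensor_nf R V W [],
     add = (\<lambda>s t. tensor_nf R V W (s @ t)),
     smult = (\<lambda>c t. tensor_nf R V W [(c \<odot>\<^bsub>V\<^esub> v, w). (v, w) \<leftarrow> t])\<rparr>"

definition pure_tensor ::
  "('k, 'r) ring_scheme \<Rightarrow> ('k, 'a, 'x) module_scheme \<Rightarrow> ('k, 'b, 'y) module_scheme \<Rightarrow>
   'a \<Rightarrow> 'b \<Rightarrow> ('a \<times> 'b) list"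
  where "pure_tensor R V W v w = tensor_nf R V W [(v, w)]"


section \<open>Hopf algebras\<close>

text \<open>\<open>comult H h\<close> is an element of \<open>tensor R H H\<close>, so summing over the list \<open>comult H h\<close> is
  Sweedler's notation.\<close>

record ('k, 'h) hopf = "('k, 'h) module" +
  comult :: "'h \<Rightarrow> ('h \<times> 'h) list"
  counit :: "'h \<Rightarrow> 'k"
  antipode :: "'h \<Rightarrow> 'h"

locale hopf_algebra =
  fixes R :: "('k, 'r) ring_scheme" (structure) and H :: "('k, 'h, 'z) hopf_scheme" (structure)
  assumes field: "field R"
    and algebra: "k_algebra R H"
    and comult_linear: "comult H \<in> linear_maps R H (tensor R H H)"
    and comult_ring_hom: "comult H \<in> ring_hom H (tensor R H H)"
    and counit_linear: "counit H \<in> linear_maps R H (self_module R)"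
    and counit_ring_hom: "counit H \<in> ring_hom H R"
    and antipode_linear: "antipode H \<in> linear_maps R H H"
    and coassociative: "h \<in> carrier H \<Longrightarrow>
      lsum (tensor R H (tensor R H H))
        (\<lambda>(a, b). lsum (tensor R H (tensor R H H))
          (\<lambda>(a', a''). pure_tensor R H (tensor R H H) a' (pure_tensor R H H a'' b)) (comult H a))
        (comult H h) =
      lsum (tensor R H (tensor R H H))
        (\<lambda>(a, b). pure_tensor R H (tensor R H H) a (comult H b)) (comult H h)"
    and counit_left: "h \<in> carrier H \<Longrightarrow> lsum H (\<lambda>(a, b). counit H a \<odot>\<^bsub>H\<^esub> b) (comult H h) = h"
    and counit_right: "h \<in> carrier H \<Longrightarrow> lsum H (\<lambda>(a, b). counit H b \<odot>\<^bsub>H\<^esub> a) (comult H h) = h"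
    and antipode_left: "h \<in> carrier H \<Longrightarrow>
      lsum H (\<lambda>(a, b). antipode H a \<otimes>\<^bsub>H\<^esub> b) (comult H h) = counit H h \<odot>\<^bsub>H\<^esub> \<one>\<^bsub>H\<^esub>"
    and antipode_right: "h \<in> carrier H \<Longrightarrow>
      lsum H (\<lambda>(a, b). a \<otimes>\<^bsub>H\<^esub> antipode H b) (comult H h) = counit H h \<odot>\<^bsub>H\<^esub> \<one>\<^bsub>H\<^esub>"


section \<open>Global and partial modules\<close>

record ('k, 'h, 'm) hmod = "('k, 'm) module" +
  act :: "'h \<Rightarrow> 'm \<Rightarrow> 'm"

definition with_action :: "('k, 'm, 'x) module_scheme \<Rightarrow> ('h \<Rightarrow> 'm \<Rightarrow> 'm) \<Rightarrow> ('k, 'h, 'm) hmod"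
  where "with_action M \<pi> =
    \<lparr>carrier = carrier M, mult = mult M, one = one M, zero = zero M, add = add M, smult = smult M,
     act = \<pi>\<rparr>"

definition global_module ::
  "('k, 'r) ring_scheme \<Rightarrow> ('k, 'h, 'z) hopf_scheme \<Rightarrow> ('k, 'h, 'm) hmod \<Rightarrow> bool"
  where "global_module R H M \<longleftrightarrow> module R M \<and>
    act M \<in> linear_maps R H (End_algebra R M) \<inter> ring_hom H (End_algebra R M)"

definition partial_representation ::
  "('k, 'r) ring_scheme \<Rightarrow> ('k, 'h, 'z) hopf_scheme \<Rightarrow> ('k, 'b, 'x) module_scheme \<Rightarrow> ('h \<Rightarrow> 'b) \<Rightarrow> bool"
  where "partial_representation R H B \<pi> \<longleftrightarrow>
    \<pi> \<in> linear_maps R H B \<and> \<pi> \<one>\<^bsub>H\<^esub> = \<one>\<^bsub>B\<^esub> \<and>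
    (\<forall>h\<in>carrier H. \<forall>l\<in>carrier H.
      lsum B (\<lambda>(a, b). \<pi> h \<otimes>\<^bsub>B\<^esub> \<pi> a \<otimes>\<^bsub>B\<^esub> \<pi> (antipode H b)) (comult H l) =
      lsum B (\<lambda>(a, b). \<pi> (h \<otimes>\<^bsub>H\<^esub> a) \<otimes>\<^bsub>B\<^esub> \<pi> (antipode H b)) (comult H l)) \<and>
    (\<forall>h\<in>carrier H. \<forall>l\<in>carrier H.
      lsum B (\<lambda>(a, b). \<pi> a \<otimes>\<^bsub>B\<^esub> \<pi> (antipode H b) \<otimes>\<^bsub>B\<^esub> \<pi> l) (comult H h) =
      lsum B (\<lambda>(a, b). \<pi> a \<otimes>\<^bsub>B\<^esub> \<pi> (antipode H b \<otimes>\<^bsub>H\<^esub> l)) (comult H h))"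

definition partial_module ::
  "('k, 'r) ring_scheme \<Rightarrow> ('k, 'h, 'z) hopf_scheme \<Rightarrow> ('k, 'h, 'm) hmod \<Rightarrow> bool"
  where "partial_module R H M \<longleftrightarrow> module R M \<and>
    partial_representation R H (End_algebra R M) (act M)"

text \<open>Morphisms of global modules and morphisms of partial modules are given by the same condition.\<close>

definition module_maps ::
  "('k, 'r) ring_scheme \<Rightarrow> ('k, 'h, 'z) hopf_scheme \<Rightarrow> ('k, 'h, 'm) hmod \<Rightarrow> ('k, 'h, 'n) hmod \<Rightarrow>
   ('m \<Rightarrow> 'n) set"
  where "module_maps R H M N =
    {f \<in> Lin R M N. \<forall>h\<in>carrier H. \<forall>x\<in>carrier M. f (act M h x) = act N h (f x)}"

text \<open>The partial modules \<open>H \<otimes> M\<close> and \<open>M \<otimes> H\<close> of a partial module \<open>M\<close>.\<close>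

definition left_tensor ::
  "('k, 'r) ring_scheme \<Rightarrow> ('k, 'h, 'z) hopf_scheme \<Rightarrow> ('k, 'h, 'm) hmod \<Rightarrow>
   ('k, 'h, ('h \<times> 'm) list) hmod"
  where "left_tensor R H M = (let T = tensor R H M in
    with_action T (\<lambda>h. \<lambda>t\<in>carrier T.
      lsum T (\<lambda>(l, m). lsum T (\<lambda>(a, b). pure_tensor R H M (a \<otimes>\<^bsub>H\<^esub> l) (act M b m)) (comult H h)) t))"

definition right_tensor ::
  "('k, 'r) ring_scheme \<Rightarrow> ('k, 'h, 'z) hopf_scheme \<Rightarrow> ('k, 'h, 'm) hmod \<Rightarrow>
   ('k, 'h, ('m \<times> 'h) list) hmod"
  where "right_tensor R H M = (let T = tensor R M H in
    with_action T (\<lambda>h. \<lambda>t\<in>carrier T.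
      lsum T (\<lambda>(m, l). lsum T (\<lambda>(a, b). pure_tensor R M H (act M a m) (b \<otimes>\<^bsub>H\<^esub> l)) (comult H h)) t))"


section \<open>Monoidal and enriched categories\<close>

record ('o, 'f) cat =
  objects :: "'o set"
  arrows :: "'o \<Rightarrow> 'o \<Rightarrow> 'f set"
  identity :: "'o \<Rightarrow> 'f"
  composition :: "'o \<Rightarrow> 'o \<Rightarrow> 'o \<Rightarrow> 'f \<Rightarrow> 'f \<Rightarrow> 'f"

text \<open>\<open>composition C X Y Z g f\<close> is \<open>g \<circ> f\<close> for \<open>f : X \<rightarrow> Y\<close> and \<open>g : Y \<rightarrow> Z\<close>. Hom-sets need not be
  disjoint, so the objects are arguments.\<close>

locale category =
  fixes C :: "('o, 'f, 'z) cat_scheme"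
  assumes identity_arrow: "X \<in> objects C \<Longrightarrow> identity C X \<in> arrows C X X"
    and composition_arrow:
      "\<lbrakk>X \<in> objects C; Y \<in> objects C; Z \<in> objects C; f \<in> arrows C X Y; g \<in> arrows C Y Z\<rbrakk> \<Longrightarrow>
       composition C X Y Z g f \<in> arrows C X Z"
    and identity_left:
      "\<lbrakk>X \<in> objects C; Y \<in> objects C; f \<in> arrows C X Y\<rbrakk> \<Longrightarrow>
       composition C X Y Y (identity C Y) f = f"
    and identity_right:
      "\<lbrakk>X \<in> objects C; Y \<in> objects C; f \<in> arrows C X Y\<rbrakk> \<Longrightarrow>
       composition C X X Y f (identity C X) = f"
    and composition_assoc:
      "\<lbrakk>W \<in> objects C; X \<in> objects C; Y \<in> objects C; Z \<in> objects C;
        f \<in> arrows C W X; g \<in> arrows C X Y; h \<in> arrows C Y Z\<rbrakk> \<Longrightarrow>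
       composition C W X Z (composition C X Y Z h g) f =
       composition C W Y Z h (composition C W X Y g f)"

definition inverse_arrows :: "('o, 'f, 'z) cat_scheme \<Rightarrow> 'o \<Rightarrow> 'o \<Rightarrow> 'f \<Rightarrow> 'f \<Rightarrow> bool"
  where "inverse_arrows C X Y f g \<longleftrightarrow> f \<in> arrows C X Y \<and> g \<in> arrows C Y X \<and>
    composition C X Y X g f = identity C X \<and> composition C Y X Y f g = identity C Y"

definition iso_arrow :: "('o, 'f, 'z) cat_scheme \<Rightarrow> 'o \<Rightarrow> 'o \<Rightarrow> 'f \<Rightarrow> bool"
  where "iso_arrow C X Y f \<longleftrightarrow> (\<exists>g. inverse_arrows C X Y f g)"

definition inverse_arrow :: "('o, 'f, 'z) cat_scheme \<Rightarrow> 'o \<Rightarrow> 'o \<Rightarrow> 'f \<Rightarrow> 'f"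
  where "inverse_arrow C X Y f = (THE g. inverse_arrows C X Y f g)"

text \<open>\<open>tensor_ar V X X' Y Y' f g : X \<otimes> Y \<rightarrow> X' \<otimes> Y'\<close> for \<open>f : X \<rightarrow> X'\<close> and \<open>g : Y \<rightarrow> Y'\<close>;
  \<open>associator V X Y Z : (X \<otimes> Y) \<otimes> Z \<rightarrow> X \<otimes> (Y \<otimes> Z)\<close>.\<close>

record ('o, 'f) moncat = "('o, 'f) cat" +
  tensor_ob :: "'o \<Rightarrow> 'o \<Rightarrow> 'o"
  tensor_ar :: "'o \<Rightarrow> 'o \<Rightarrow> 'o \<Rightarrow> 'o \<Rightarrow> 'f \<Rightarrow> 'f \<Rightarrow> 'f"
  unit_ob :: 'o
  associator :: "'o \<Rightarrow> 'o \<Rightarrow> 'o \<Rightarrow> 'f"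
  left_unitor :: "'o \<Rightarrow> 'f"
  right_unitor :: "'o \<Rightarrow> 'f"

locale moncat_data =
  fixes V :: "('o, 'f, 'z) moncat_scheme"
begin

abbreviation tensor_ob_infix (infixr \<open>\<boxtimes>\<close> 70) where "X \<boxtimes> Y \<equiv> tensor_ob V X Y"
abbreviation "obs \<equiv> objects V"
abbreviation "hm \<equiv> arrows V"
abbreviation "idn \<equiv> identity V"
abbreviation "cmp \<equiv> composition V"
abbreviation "ten \<equiv> tensor_ar V"
abbreviation "iob \<equiv> unit_ob V"
abbreviation "asc \<equiv> associator V"
abbreviation "lun \<equiv> left_unitor V"
abbreviation "run \<equiv> right_unitor V"

end

locale monoidal_category = moncat_data V + category V for V :: "('o, 'f, 'z) moncat_scheme" +
  assumes unit_object: "iob \<in> obs"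
    and tensor_object: "\<lbrakk>X \<in> obs; Y \<in> obs\<rbrakk> \<Longrightarrow> X \<boxtimes> Y \<in> obs"
    and tensor_arrow:
      "\<lbrakk>X \<in> obs; X' \<in> obs; Y \<in> obs; Y' \<in> obs; f \<in> hm X X'; g \<in> hm Y Y'\<rbrakk> \<Longrightarrow>
       ten X X' Y Y' f g \<in> hm (X \<boxtimes> Y) (X' \<boxtimes> Y')"
    and tensor_identity:
      "\<lbrakk>X \<in> obs; Y \<in> obs\<rbrakk> \<Longrightarrow> ten X X Y Y (idn X) (idn Y) = idn (X \<boxtimes> Y)"
    and tensor_composition:
      "\<lbrakk>X \<in> obs; X' \<in> obs; X'' \<in> obs; Y \<in> obs; Y' \<in> obs; Y'' \<in> obs;
        f \<in> hm X X'; f' \<in> hm X' X''; g \<in> hm Y Y'; g' \<in> hm Y' Y''\<rbrakk> \<Longrightarrow>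
       ten X X'' Y Y'' (cmp X X' X'' f' f) (cmp Y Y' Y'' g' g) =
       cmp (X \<boxtimes> Y) (X' \<boxtimes> Y') (X'' \<boxtimes> Y'') (ten X' X'' Y' Y'' f' g') (ten X X' Y Y' f g)"
    and associator_iso:
      "\<lbrakk>X \<in> obs; Y \<in> obs; Z \<in> obs\<rbrakk> \<Longrightarrow>
       iso_arrow V ((X \<boxtimes> Y) \<boxtimes> Z) (X \<boxtimes> (Y \<boxtimes> Z)) (asc X Y Z)"
    and associator_natural:
      "\<lbrakk>X \<in> obs; X' \<in> obs; Y \<in> obs; Y' \<in> obs; Z \<in> obs; Z' \<in> obs;
        f \<in> hm X X'; g \<in> hm Y Y'; h \<in> hm Z Z'\<rbrakk> \<Longrightarrow>
       cmp ((X \<boxtimes> Y) \<boxtimes> Z) ((X' \<boxtimes> Y') \<boxtimes> Z') (X' \<boxtimes> (Y' \<boxtimes> Z'))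
         (asc X' Y' Z') (ten (X \<boxtimes> Y) (X' \<boxtimes> Y') Z Z' (ten X X' Y Y' f g) h) =
       cmp ((X \<boxtimes> Y) \<boxtimes> Z) (X \<boxtimes> (Y \<boxtimes> Z)) (X' \<boxtimes> (Y' \<boxtimes> Z'))
         (ten X X' (Y \<boxtimes> Z) (Y' \<boxtimes> Z') f (ten Y Y' Z Z' g h)) (asc X Y Z)"
    and left_unitor_iso: "X \<in> obs \<Longrightarrow> iso_arrow V (iob \<boxtimes> X) X (lun X)"
    and left_unitor_natural:
      "\<lbrakk>X \<in> obs; Y \<in> obs; f \<in> hm X Y\<rbrakk> \<Longrightarrow>
       cmp (iob \<boxtimes> X) (iob \<boxtimes> Y) Y (lun Y) (ten iob iob X Y (idn iob) f) = cmp (iob \<boxtimes> X) X Y f (lun X)"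
    and right_unitor_iso: "X \<in> obs \<Longrightarrow> iso_arrow V (X \<boxtimes> iob) X (run X)"
    and right_unitor_natural:
      "\<lbrakk>X \<in> obs; Y \<in> obs; f \<in> hm X Y\<rbrakk> \<Longrightarrow>
       cmp (X \<boxtimes> iob) (Y \<boxtimes> iob) Y (run Y) (ten X Y iob iob f (idn iob)) = cmp (X \<boxtimes> iob) X Y f (run X)"
    and pentagon:
      "\<lbrakk>W \<in> obs; X \<in> obs; Y \<in> obs; Z \<in> obs\<rbrakk> \<Longrightarrow>
       cmp (((W \<boxtimes> X) \<boxtimes> Y) \<boxtimes> Z) ((W \<boxtimes> X) \<boxtimes> (Y \<boxtimes> Z)) (W \<boxtimes> (X \<boxtimes> (Y \<boxtimes> Z)))
         (asc W X (Y \<boxtimes> Z)) (asc (W \<boxtimes> X) Y Z) =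
       cmp (((W \<boxtimes> X) \<boxtimes> Y) \<boxtimes> Z) (W \<boxtimes> ((X \<boxtimes> Y) \<boxtimes> Z)) (W \<boxtimes> (X \<boxtimes> (Y \<boxtimes> Z)))
         (ten W W ((X \<boxtimes> Y) \<boxtimes> Z) (X \<boxtimes> (Y \<boxtimes> Z)) (idn W) (asc X Y Z))
         (cmp (((W \<boxtimes> X) \<boxtimes> Y) \<boxtimes> Z) ((W \<boxtimes> (X \<boxtimes> Y)) \<boxtimes> Z) (W \<boxtimes> ((X \<boxtimes> Y) \<boxtimes> Z))
           (asc W (X \<boxtimes> Y) Z)
           (ten ((W \<boxtimes> X) \<boxtimes> Y) (W \<boxtimes> (X \<boxtimes> Y)) Z Z (asc W X Y) (idn Z)))"
    and triangle:
      "\<lbrakk>X \<in> obs; Y \<in> obs\<rbrakk> \<Longrightarrow>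
       cmp ((X \<boxtimes> iob) \<boxtimes> Y) (X \<boxtimes> (iob \<boxtimes> Y)) (X \<boxtimes> Y)
         (ten X X (iob \<boxtimes> Y) Y (idn X) (lun Y)) (asc X iob Y) =
       ten (X \<boxtimes> iob) X Y Y (run X) (idn Y)"

definition reverse_moncat :: "('o, 'f) moncat \<Rightarrow> ('o, 'f) moncat"
  where "reverse_moncat V = V
    \<lparr>tensor_ob := (\<lambda>X Y. tensor_ob V Y X),
     tensor_ar := (\<lambda>X X' Y Y' f g. tensor_ar V Y Y' X X' g f),
     associator := (\<lambda>X Y Z. inverse_arrow V
       (tensor_ob V (tensor_ob V Z Y) X) (tensor_ob V Z (tensor_ob V Y X)) (associator V Z Y X)),
     left_unitor := right_unitor V,
     right_unitor := left_unitor V\<rparr>"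

record ('b, 'o, 'f) vcat =
  vobjects :: "'b set"
  vhom :: "'b \<Rightarrow> 'b \<Rightarrow> 'o"
  vcomposition :: "'b \<Rightarrow> 'b \<Rightarrow> 'b \<Rightarrow> 'f"
  videntity :: "'b \<Rightarrow> 'f"

locale enriched_category = monoidal_category V for V :: "('o, 'f, 'z) moncat_scheme" +
  fixes E :: "('b, 'o, 'f) vcat"
  assumes vhom_object: "\<lbrakk>X \<in> vobjects E; Y \<in> vobjects E\<rbrakk> \<Longrightarrow> vhom E X Y \<in> obs"
    and vcomposition_arrow:
      "\<lbrakk>X \<in> vobjects E; Y \<in> vobjects E; Z \<in> vobjects E\<rbrakk> \<Longrightarrow>
       vcomposition E X Y Z \<in> hm (vhom E Y Z \<boxtimes> vhom E X Y) (vhom E X Z)"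
    and videntity_arrow: "X \<in> vobjects E \<Longrightarrow> videntity E X \<in> hm iob (vhom E X X)"
    and vcomposition_assoc:
      "\<lbrakk>W \<in> vobjects E; X \<in> vobjects E; Y \<in> vobjects E; Z \<in> vobjects E\<rbrakk> \<Longrightarrow>
       cmp ((vhom E Y Z \<boxtimes> vhom E X Y) \<boxtimes> vhom E W X) (vhom E X Z \<boxtimes> vhom E W X) (vhom E W Z)
         (vcomposition E W X Z)
         (ten (vhom E Y Z \<boxtimes> vhom E X Y) (vhom E X Z) (vhom E W X) (vhom E W X)
           (vcomposition E X Y Z) (idn (vhom E W X))) =
       cmp ((vhom E Y Z \<boxtimes> vhom E X Y) \<boxtimes> vhom E W X)
         (vhom E Y Z \<boxtimes> (vhom E X Y \<boxtimes> vhom E W X)) (vhom E W Z)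
         (cmp (vhom E Y Z \<boxtimes> (vhom E X Y \<boxtimes> vhom E W X)) (vhom E Y Z \<boxtimes> vhom E W Y) (vhom E W Z)
           (vcomposition E W Y Z)
           (ten (vhom E Y Z) (vhom E Y Z) (vhom E X Y \<boxtimes> vhom E W X) (vhom E W Y)
             (idn (vhom E Y Z)) (vcomposition E W X Y)))
         (asc (vhom E Y Z) (vhom E X Y) (vhom E W X))"
    and videntity_left:
      "\<lbrakk>X \<in> vobjects E; Y \<in> vobjects E\<rbrakk> \<Longrightarrow>
       cmp (iob \<boxtimes> vhom E X Y) (vhom E Y Y \<boxtimes> vhom E X Y) (vhom E X Y)
         (vcomposition E X Y Y)
         (ten iob (vhom E Y Y) (vhom E X Y) (vhom E X Y) (videntity E Y) (idn (vhom E X Y))) =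
       lun (vhom E X Y)"
    and videntity_right:
      "\<lbrakk>X \<in> vobjects E; Y \<in> vobjects E\<rbrakk> \<Longrightarrow>
       cmp (vhom E X Y \<boxtimes> iob) (vhom E X Y \<boxtimes> vhom E X X) (vhom E X Y)
         (vcomposition E X X Y)
         (ten (vhom E X Y) (vhom E X Y) iob (vhom E X X) (idn (vhom E X Y)) (videntity E X)) =
       run (vhom E X Y)"

text \<open>The underlying ordinary category has the arrows \<open>I \<rightarrow> E(X, Y)\<close> as arrows \<open>X \<rightarrow> Y\<close>, composed via
  \<open>I \<cong> I \<otimes> I \<rightarrow> E(Y, Z) \<otimes> E(X, Y) \<rightarrow> E(X, Z)\<close>.\<close>

definition underlying_cat :: "('o, 'f, 'z) moncat_scheme \<Rightarrow> ('b, 'o, 'f) vcat \<Rightarrow> ('b, 'f) cat"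
  where "underlying_cat V E = (let I = unit_ob V; II = tensor_ob V I I in
    \<lparr>objects = vobjects E,
     arrows = (\<lambda>X Y. arrows V I (vhom E X Y)),
     identity = videntity E,
     composition = (\<lambda>X Y Z g f.
       composition V I (tensor_ob V (vhom E Y Z) (vhom E X Y)) (vhom E X Z)
         (vcomposition E X Y Z)
         (composition V I II (tensor_ob V (vhom E Y Z) (vhom E X Y))
           (tensor_ar V I (vhom E Y Z) I (vhom E X Y) g f)
           (inverse_arrow V II I (left_unitor V I))))\<rparr>)"

text \<open>Isomorphism of categories by a functor that is the identity on objects.\<close>

definition same_category :: "('b, 'f, 'y) cat_scheme \<Rightarrow> ('b, 'g, 'z) cat_scheme \<Rightarrow> bool"
  where "same_category C D \<longleftrightarrow> objects C = objects D \<and>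
    (\<exists>F. (\<forall>X\<in>objects C. \<forall>Y\<in>objects C. bij_betw (F X Y) (arrows C X Y) (arrows D X Y)) \<and>
      (\<forall>X\<in>objects C. F X X (identity C X) = identity D X) \<and>
      (\<forall>X\<in>objects C. \<forall>Y\<in>objects C. \<forall>Z\<in>objects C. \<forall>f\<in>arrows C X Y. \<forall>g\<in>arrows C Y Z.
        F X Z (composition C X Y Z g f) = composition D X Y Z (F Y Z g) (F X Y f)))"

definition enriched_over ::
  "('b, 'g, 'y) cat_scheme \<Rightarrow> ('o, 'f, 'z) moncat_scheme \<Rightarrow> ('b \<Rightarrow> 'b \<Rightarrow> 'o) \<Rightarrow> bool"
  where "enriched_over C V hom_ob \<longleftrightarrow> category C \<and>
    (\<exists>E. enriched_category V E \<and> vobjects E = objects C \<and>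
      (\<forall>X\<in>objects C. \<forall>Y\<in>objects C. vhom E X Y = hom_ob X Y) \<and>
      same_category (underlying_cat V E) C)"


section \<open>The categories of partial and of global modules\<close>

text \<open>Categories consist of modules whose carriers are subsets of a given type. For partial modules
  the type \<open>'m\<close> is arbitrary; \<open>H \<otimes> M\<close> is a partial module over another type, which is harmless since
  \<^const>\<open>module_maps\<close> relates modules over different types.\<close>

definition PMod ::
  "('k, 'r) ring_scheme \<Rightarrow> ('k, 'h, 'z) hopf_scheme \<Rightarrow> (('k, 'h, 'm) hmod, 'm \<Rightarrow> 'm) cat"
  where "PMod R H =
    \<lparr>objects = {M. partial_module R H M},
     arrows = module_maps R H,
     identity = (\<lambda>M. \<lambda>x\<in>carrier M. x),
     composition = (\<lambda>M N P g f. compose (carrier M) g f)\<rparr>"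

text \<open>For global modules, the type must be closed under tensor products and contain the ground field.
  \<open>('k, 'a) univ\<close> is such a type generated by \<open>'k\<close> and the type \<open>'a\<close>.\<close>

datatype ('k, 'a) univ =
    Scalar (unscalar: 'k)
  | Atom (unatom: 'a)
  | Formal (unformal: "(('k, 'a) univ \<times> ('k, 'a) univ) list")

text \<open>Transport of structure along an injection \<open>c\<close> with left inverse \<open>d\<close>.\<close>

definition relabel :: "('a \<Rightarrow> 'b) \<Rightarrow> ('b \<Rightarrow> 'a) \<Rightarrow> ('k, 'a, 'x) module_scheme \<Rightarrow> ('k, 'b) module"
  where "relabel c d M =
    \<lparr>carrier = c ` carrier M,
     mult = (\<lambda>x y. c (d x \<otimes>\<^bsub>M\<^esub> d y)), one = c \<one>\<^bsub>M\<^esub>,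
     zero = c \<zero>\<^bsub>M\<^esub>, add = (\<lambda>x y. c (d x \<oplus>\<^bsub>M\<^esub> d y)),
     smult = (\<lambda>a x. c (a \<odot>\<^bsub>M\<^esub> d x))\<rparr>"

type_synonym ('k, 'h, 'a) umod = "('k, 'h, ('k, 'a) univ) hmod"

definition upure ::
  "('k, 'r) ring_scheme \<Rightarrow> ('k, 'h, 'a) umod \<Rightarrow> ('k, 'h, 'a) umod \<Rightarrow>
   ('k, 'a) univ \<Rightarrow> ('k, 'a) univ \<Rightarrow> ('k, 'a) univ"
  where "upure R X Y x y = Formal (pure_tensor R X Y x y)"

definition global_tensor ::
  "('k, 'r) ring_scheme \<Rightarrow> ('k, 'h, 'z) hopf_scheme \<Rightarrow> ('k, 'h, 'a) umod \<Rightarrow> ('k, 'h, 'a) umod \<Rightarrow>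
   ('k, 'h, 'a) umod"
  where "global_tensor R H X Y = (let T = relabel Formal unformal (tensor R X Y) in
    with_action T (\<lambda>h. \<lambda>t\<in>carrier T.
      lsum T (\<lambda>(x, y). lsum T (\<lambda>(a, b). upure R X Y (act X a x) (act Y b y)) (comult H h))
        (unformal t)))"

definition global_unit ::
  "('k, 'r) ring_scheme \<Rightarrow> ('k, 'h, 'z) hopf_scheme \<Rightarrow> ('k, 'h, 'a) umod"
  where "global_unit R H = (let K = relabel Scalar unscalar (self_module R) in
    with_action K (\<lambda>h. \<lambda>x\<in>carrier K. counit H h \<odot>\<^bsub>K\<^esub> x))"

definition HMod ::
  "('k, 'r) ring_scheme \<Rightarrow> ('k, 'h, 'z) hopf_scheme \<Rightarrow>
   (('k, 'h, 'a) umod, ('k, 'a) univ \<Rightarrow> ('k, 'a) univ) moncat"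
  where "HMod R H =
    \<lparr>objects = {X. global_module R H X},
     arrows = module_maps R H,
     identity = (\<lambda>X. \<lambda>x\<in>carrier X. x),
     composition = (\<lambda>X Y Z g f. compose (carrier X) g f),
     tensor_ob = global_tensor R H,
     tensor_ar = (\<lambda>X X' Y Y' f g. \<lambda>t\<in>carrier (global_tensor R H X Y).
       lsum (global_tensor R H X' Y') (\<lambda>(x, y). upure R X' Y' (f x) (g y)) (unformal t)),
     unit_ob = global_unit R H,
     associator = (\<lambda>X Y Z. \<lambda>t\<in>carrier (global_tensor R H (global_tensor R H X Y) Z).
       (let YZ = global_tensor R H Y Z; T = global_tensor R H X YZ in
         lsum T (\<lambda>(p, z). lsum T (\<lambda>(x, y). upure R X YZ x (upure R Y Z y z)) (unformal p))
           (unformal t))),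
     left_unitor = (\<lambda>X. \<lambda>t\<in>carrier (global_tensor R H (global_unit R H) X).
       lsum X (\<lambda>(c, x). unscalar c \<odot>\<^bsub>X\<^esub> x) (unformal t)),
     right_unitor = (\<lambda>X. \<lambda>t\<in>carrier (global_tensor R H X (global_unit R H)).
       lsum X (\<lambda>(x, c). unscalar c \<odot>\<^bsub>X\<^esub> x) (unformal t))\<rparr>"

text \<open>The Hom-objects \<open>[M, N]\<close> and \<open>{M, N}\<close>.\<close>

definition left_hom ::
  "('k, 'r) ring_scheme \<Rightarrow> ('k, 'h, 'z) hopf_scheme \<Rightarrow> ('k, 'h, 'm) hmod \<Rightarrow> ('k, 'h, 'n) hmod \<Rightarrow>
   ('k, 'h, ('h \<times> 'm) list \<Rightarrow> 'n) umod"
  where "left_hom R H M N =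
    (let T = left_tensor R H M; F = module_maps R H T N in
      with_action (relabel Atom unatom (map_space T N F))
        (\<lambda>h'. \<lambda>u\<in>Atom ` F. Atom (\<lambda>t\<in>carrier T.
          unatom u (lsum T (\<lambda>(h, m). pure_tensor R H M (h \<otimes>\<^bsub>H\<^esub> h') m) t))))"

definition right_hom ::
  "('k, 'r) ring_scheme \<Rightarrow> ('k, 'h, 'z) hopf_scheme \<Rightarrow> ('k, 'h, 'm) hmod \<Rightarrow> ('k, 'h, 'n) hmod \<Rightarrow>
   ('k, 'h, ('m \<times> 'h) list \<Rightarrow> 'n) umod"
  where "right_hom R H M N =
    (let T = right_tensor R H M; F = module_maps R H T N in
      with_action (relabel Atom unatom (map_space T N F))
        (\<lambda>h'. \<lambda>u\<in>Atom ` F. Atom (\<lambda>t\<in>carrier T.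
          unatom u (lsum T (\<lambda>(m, h). pure_tensor R M H m (h \<otimes>\<^bsub>H\<^esub> h')) t))))"

end

theory Submission
  imports Defs
begin

text \<open>The composite of \<open>f \<in> [M, N]\<close> and \<open>g \<in> [N, P]\<close> is \<open>h \<otimes> m \<mapsto> g (h\<^sub>1 \<otimes> f (h\<^sub>2 \<otimes> m))\<close>, and the unit of \<open>[M, M]\<close>
  is \<open>h \<otimes> m \<mapsto> \<epsilon>(h) m\<close>; that these are well defined, \<open>H\<close>-linear, associative and unital is a calculation with
  coassociativity and the counit. The arrows \<open>k \<rightarrow> [M, N]\<close> are the \<open>f\<close> with \<open>f (h \<otimes> m) = \<epsilon>(h) f (1 \<otimes> m)\<close>, and such
  an \<open>f\<close> amounts to the map \<open>m \<mapsto> f (1 \<otimes> m)\<close> of partial modules. Part (ii) is the same calculation for the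
  co-opposite bialgebra; since its composition lives on \<open>{M, N} \<otimes> {N, P}\<close>, it yields the opposite of the category to be
  enriched as a category over \<open>H\<close>-modules, and hence the category itself over the reversed monoidal category.\<close>

section \<open>Finite sums and linear maps\<close>

text \<open>The composition formula has its origin in an adjunction: maps
  \<open>X \<otimes> M \<rightarrow> N\<close> of partial modules should correspond to
  \<open>H\<close>-linear maps \<open>X \<rightarrow> [M, N]\<close>, with evaluation
  \<open>f \<otimes> m \<mapsto> f (1 \<otimes> m)\<close>. Composition is the transpose of the
  double evaluation: acting by \<open>h\<close> on \<open>g \<otimes> f\<close> before evaluating
  gives \<open>h\<^sub>1\<close> to \<open>g\<close> and \<open>h\<^sub>2\<close> to
  \<open>f\<close>. In part (ii) the Hom-object stands to the right of \<open>M\<close>, so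
  \<open>f\<close> is met before \<open>g\<close> and receives \<open>h\<^sub>1\<close>; hence the
  co-opposite comultiplication. The obstacle is the encoding: an element of a tensor product is an
  arbitrarily chosen list. It is hidden behind the universal property: linear maps are obtained by
  lifting bilinear ones, and equality is tested on pure tensors. In the same way an element of a
  Hom-object is handled through the two-argument function \<open>ev\<close>, which turns equations
  between such elements into equations between Sweedler sums.\<close>

definition tsum :: "('b, 'y) ring_scheme \<Rightarrow> ('v \<Rightarrow> 'w \<Rightarrow> 'b) \<Rightarrow> ('v \<times> 'w) list \<Rightarrow> 'b"
  where "tsum W f t = lsum W (case_prod f) t"

lemma tsum_Nil [simp]: "tsum W f [] = \<zero>\<^bsub>W\<^esub>"
  by (simp add: tsum_def lsum_def)

lemma tsum_Cons [simp]: "tsum W f ((v, w) # t) = f v w \<oplus>\<^bsub>W\<^esub> tsum W f t"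
  by (simp add: tsum_def lsum_def)

lemma tsum_cong:
  assumes "\<And>v w. (v, w) \<in> set t \<Longrightarrow> f v w = g v w"
  shows "tsum W f t = tsum W g t"
  using assms by (induction t) auto

lemma tsum_map: "tsum W f [(g v w, h v w). (v, w) \<leftarrow> t] = tsum W (\<lambda>v w. f (g v w) (h v w)) t"
  by (induction t) auto

context abelian_monoid
begin

lemma tsum_closed:
  assumes "\<And>v w. (v, w) \<in> set t \<Longrightarrow> f v w \<in> carrier G"
  shows "tsum G f t \<in> carrier G"
  using assms by (induction t) auto

lemma tsum_append:
  assumes "\<And>v w. (v, w) \<in> set (s @ t) \<Longrightarrow> f v w \<in> carrier G"
  shows "tsum G f (s @ t) = tsum G f s \<oplus> tsum G f t"
  using assms
proof (induction s)
  case Nil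
  then show ?case by (simp add: tsum_closed)
next
  case (Cons p s)
  then show ?case by (cases p) (simp add: tsum_closed a_assoc)
qed

lemma tsum_zero: "tsum G (\<lambda>v w. \<zero>) t = \<zero>"
  by (induction t) auto

lemma tsum_add:
  assumes "\<And>v w. (v, w) \<in> set t \<Longrightarrow> f v w \<in> carrier G" "\<And>v w. (v, w) \<in> set t \<Longrightarrow> g v w \<in> carrier G"
  shows "tsum G (\<lambda>v w. f v w \<oplus> g v w) t = tsum G f t \<oplus> tsum G g t"
  using assms
proof (induction t)
  case (Cons p t)
  then show ?case by (cases p) (simp add: tsum_closed a_ac)
qed auto

lemma tsum_swap:
  assumes "\<And>v w v' w'. (v, w) \<in> set s \<Longrightarrow> (v', w') \<in> set t \<Longrightarrow> f v w v' w' \<in> carrier G"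
  shows "tsum G (\<lambda>v w. tsum G (f v w) t) s = tsum G (\<lambda>v' w'. tsum G (\<lambda>v w. f v w v' w') s) t"
  using assms
proof (induction s)
  case Nil
  then show ?case by (simp add: tsum_zero)
next
  case (Cons p s)
  then show ?case by (cases p) (simp add: tsum_closed tsum_add)
qed

text \<open>The list has the shape of a product in a tensor product of algebras; this is how the
  multiplicativity of the comultiplication becomes a statement about sums.\<close>

lemma tsum_concat:
  assumes "\<And>v w v' w'. (v, w) \<in> set s \<Longrightarrow> (v', w') \<in> set t \<Longrightarrow> f (g v v') (h w w') \<in> carrier G"
  shows "tsum G f [(g v v', h w w'). (v, w) \<leftarrow> s, (v', w') \<leftarrow> t] =
    tsum G (\<lambda>v w. tsum G (\<lambda>v' w'. f (g v v') (h w w')) t) s"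
  using assms
proof (induction s)
  case (Cons p s)
  then show ?case by (cases p) (auto simp: tsum_map intro!: HOL.trans[OF tsum_append])
qed auto

end

lemma module_abelian_group: "module R V \<Longrightarrow> abelian_group V"
  by (simp add: module_def)

lemma module_abelian_monoid: "module R V \<Longrightarrow> abelian_monoid V"
  by (simp add: module_def abelian_group_def)

text \<open>The module structures are part of the predicate, so that most rules about linear maps
  need a single premise. Unlike \<open>Lin\<close>, it ignores values outside the carrier: maps are
  composed freely and normalised only at the end, by \<open>lin_restrict\<close>.\<close>

definition lin ::
  "('k, 'r) ring_scheme \<Rightarrow> ('k, 'a, 'x) module_scheme \<Rightarrow> ('k, 'b, 'y) module_scheme \<Rightarrow> ('a \<Rightarrow> 'b) \<Rightarrow> bool"
  where "lin R V W f \<longleftrightarrow> module R V \<and> module R W \<and> f \<in> linear_maps R V W"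

lemma lin_modules: "lin R V W f \<Longrightarrow> module R V" "lin R V W f \<Longrightarrow> module R W"
  by (simp_all add: lin_def)

lemma linI:
  assumes "module R V" "module R W" "\<And>x. x \<in> carrier V \<Longrightarrow> f x \<in> carrier W"
    "\<And>x y. x \<in> carrier V \<Longrightarrow> y \<in> carrier V \<Longrightarrow> f (x \<oplus>\<^bsub>V\<^esub> y) = f x \<oplus>\<^bsub>W\<^esub> f y"
    "\<And>c x. c \<in> carrier R \<Longrightarrow> x \<in> carrier V \<Longrightarrow> f (c \<odot>\<^bsub>V\<^esub> x) = c \<odot>\<^bsub>W\<^esub> f x"
  shows "lin R V W f"
  using assms by (auto simp: lin_def linear_maps_def)

lemma lin_closed: "lin R V W f \<Longrightarrow> x \<in> carrier V \<Longrightarrow> f x \<in> carrier W"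
  by (auto simp: lin_def linear_maps_def)

lemma lin_add:
  "lin R V W f \<Longrightarrow> x \<in> carrier V \<Longrightarrow> y \<in> carrier V \<Longrightarrow> f (x \<oplus>\<^bsub>V\<^esub> y) = f x \<oplus>\<^bsub>W\<^esub> f y"
  by (auto simp: lin_def linear_maps_def)

lemma lin_smult: "lin R V W f \<Longrightarrow> c \<in> carrier R \<Longrightarrow> x \<in> carrier V \<Longrightarrow> f (c \<odot>\<^bsub>V\<^esub> x) = c \<odot>\<^bsub>W\<^esub> f x"
  by (auto simp: lin_def linear_maps_def)

lemma lin_zero:
  assumes "lin R V W f" shows "f \<zero>\<^bsub>V\<^esub> = \<zero>\<^bsub>W\<^esub>"
proof -
  interpret V: module R V using assms by (rule lin_modules)
  interpret W: module R W using assms by (rule lin_modules)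
  have "f (\<zero>\<^bsub>R\<^esub> \<odot>\<^bsub>V\<^esub> \<zero>\<^bsub>V\<^esub>) = \<zero>\<^bsub>R\<^esub> \<odot>\<^bsub>W\<^esub> f \<zero>\<^bsub>V\<^esub>" by (rule lin_smult[OF assms]) auto
  then show ?thesis using lin_closed[OF assms] by simp
qed

lemma lin_cong:
  assumes "lin R V W f" "\<And>x. x \<in> carrier V \<Longrightarrow> f x = g x" shows "lin R V W g"
proof -
  interpret V: module R V using assms(1) by (rule lin_modules)
  show ?thesis using assms unfolding lin_def linear_maps_def Pi_def by auto
qed

lemma lin_restrict: "lin R V W f \<Longrightarrow> lin R V W (\<lambda>x\<in>carrier V. f x)"
  by (erule lin_cong) simp

lemma lin_id: "module R V \<Longrightarrow> lin R V V (\<lambda>x. x)"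
  by (auto intro!: linI)

lemma lin_comp: "lin R W U g \<Longrightarrow> lin R V W f \<Longrightarrow> lin R V U (\<lambda>x. g (f x))"
  by (auto simp: lin_def linear_maps_def Pi_iff)

lemma tsum_smult:
  assumes "module R V" "c \<in> carrier R" "\<And>v w. (v, w) \<in> set t \<Longrightarrow> f v w \<in> carrier V"
  shows "tsum V (\<lambda>v w. c \<odot>\<^bsub>V\<^esub> f v w) t = c \<odot>\<^bsub>V\<^esub> tsum V f t"
proof -
  interpret module R V by (rule assms)
  show ?thesis using assms(2,3)
  proof (induction t)
    case (Cons p t)
    then show ?case by (cases p) (simp add: tsum_closed smult_r_distr)
  qed auto
qed

lemma lin_tsum:
  assumes "lin R V W \<phi>" "\<And>v w. (v, w) \<in> set t \<Longrightarrow> f v w \<in> carrier V"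
  shows "\<phi> (tsum V f t) = tsum W (\<lambda>v w. \<phi> (f v w)) t"
proof -
  interpret V: module R V using assms(1) by (rule lin_modules)
  show ?thesis using assms(2)
  proof (induction t)
    case Nil
    then show ?case by (simp add: lin_zero[OF assms(1)])
  next
    case (Cons p t)
    then show ?case by (cases p) (simp add: V.tsum_closed lin_add[OF assms(1)])
  qed
qed

text \<open>Here the list is fixed and the summand varies linearly; the converse situation, a fixed
  bilinear summand and a varying tensor, is \<open>lift_lin\<close>.\<close>

lemma lin_tsumI:
  assumes "module R V" "module R W" "\<And>v w. (v, w) \<in> set t \<Longrightarrow> lin R V W (\<lambda>x. f x v w)"
  shows "lin R V W (\<lambda>x. tsum W (f x) t)"
proof -
  interpret W: module R W by (rule assms)
  note l = assms(3)
  show ?thesis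
  proof (rule linI[OF assms(1,2)])
    fix x y assume "x \<in> carrier V" "y \<in> carrier V"
    then show "tsum W (f (x \<oplus>\<^bsub>V\<^esub> y)) t = tsum W (f x) t \<oplus>\<^bsub>W\<^esub> tsum W (f y) t"
      by (subst W.tsum_add[symmetric]) (auto intro!: tsum_cong lin_add[OF l] lin_closed[OF l])
  next
    fix c x assume "c \<in> carrier R" "x \<in> carrier V"
    then show "tsum W (f (c \<odot>\<^bsub>V\<^esub> x)) t = c \<odot>\<^bsub>W\<^esub> tsum W (f x) t"
      by (subst tsum_smult[symmetric]) (auto intro!: assms(2) tsum_cong lin_smult[OF l] lin_closed[OF l])
  qed (auto intro!: W.tsum_closed lin_closed[OF l])
qed

lemma smult_commute:
  assumes "module R V" "c \<in> carrier R" "d \<in> carrier R" "x \<in> carrier V"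
  shows "c \<odot>\<^bsub>V\<^esub> (d \<odot>\<^bsub>V\<^esub> x) = d \<odot>\<^bsub>V\<^esub> (c \<odot>\<^bsub>V\<^esub> x)"
proof -
  interpret module R V by (rule assms)
  show ?thesis using assms smult_assoc1[of c d x] smult_assoc1[of d c x] R.m_comm[of c d] by simp
qed

lemma lin_smultI:
  assumes "c \<in> carrier R" "lin R V W f" shows "lin R V W (\<lambda>x. c \<odot>\<^bsub>W\<^esub> f x)"
proof -
  interpret W: module R W using assms(2) by (rule lin_modules)
  show ?thesis
  proof (rule linI)
    show "module R V" "module R W" using assms(2) by (fact lin_modules)+
  next
    fix x assume "x \<in> carrier V"
    then show "c \<odot>\<^bsub>W\<^esub> f x \<in> carrier W" using assms by (simp add: lin_closed[OF assms(2)])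
  next
    fix x y assume "x \<in> carrier V" "y \<in> carrier V"
    then show "c \<odot>\<^bsub>W\<^esub> f (x \<oplus>\<^bsub>V\<^esub> y) = c \<odot>\<^bsub>W\<^esub> f x \<oplus>\<^bsub>W\<^esub> c \<odot>\<^bsub>W\<^esub> f y"
      using assms by (simp add: lin_closed[OF assms(2)] lin_add[OF assms(2)] W.smult_r_distr)
  next
    fix d x assume d: "d \<in> carrier R" and x: "x \<in> carrier V"
    show "c \<odot>\<^bsub>W\<^esub> f (d \<odot>\<^bsub>V\<^esub> x) = d \<odot>\<^bsub>W\<^esub> (c \<odot>\<^bsub>W\<^esub> f x)"
      unfolding lin_smult[OF assms(2) d x]
      by (rule smult_commute[OF lin_modules(2)[OF assms(2)] assms(1) d lin_closed[OF assms(2) x]])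
  qed
qed

section \<open>Bilinear maps\<close>

definition bilin ::
  "('k, 'r) ring_scheme \<Rightarrow> ('k, 'a, 'x) module_scheme \<Rightarrow> ('k, 'b, 'y) module_scheme \<Rightarrow>
   ('k, 'c, 'z) module_scheme \<Rightarrow> ('a \<Rightarrow> 'b \<Rightarrow> 'c) \<Rightarrow> bool"
  where "bilin R V W U f \<longleftrightarrow> module R V \<and> module R W \<and> module R U \<and>
    (\<forall>v\<in>carrier V. lin R W U (f v)) \<and> (\<forall>w\<in>carrier W. lin R V U (\<lambda>v. f v w))"

lemma bilinI:
  assumes "module R V" "module R W" "module R U" "\<And>v. v \<in> carrier V \<Longrightarrow> lin R W U (\<lambda>w. f v w)"
    "\<And>w. w \<in> carrier W \<Longrightarrow> lin R V U (\<lambda>v. f v w)"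
  shows "bilin R V W U f"
  using assms by (auto simp: bilin_def)

lemma bilin_modules:
  "bilin R V W U f \<Longrightarrow> module R V" "bilin R V W U f \<Longrightarrow> module R W" "bilin R V W U f \<Longrightarrow> module R U"
  by (simp_all add: bilin_def)

text \<open>The composition with an arbitrary linear \<open>g\<close> lets backward chaining peel a
  nested multilinear expression layer by layer; \<open>bilin_right_lin\<close> and
  \<open>bilin_left_lin\<close> end the recursion.\<close>

lemma bilin_right: "bilin R V W U f \<Longrightarrow> v \<in> carrier V \<Longrightarrow> lin R X W g \<Longrightarrow> lin R X U (\<lambda>x. f v (g x))"
  by (rule lin_comp[of R W U "f v" X g]) (auto simp: bilin_def)

lemma bilin_left: "bilin R V W U f \<Longrightarrow> w \<in> carrier W \<Longrightarrow> lin R X V g \<Longrightarrow> lin R X U (\<lambda>x. f (g x) w)"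
  by (rule lin_comp[of R V U "\<lambda>v. f v w" X g]) (auto simp: bilin_def)

lemma bilin_right_lin: "bilin R V W U f \<Longrightarrow> v \<in> carrier V \<Longrightarrow> lin R W U (f v)"
  by (auto simp: bilin_def)

lemma bilin_left_lin: "bilin R V W U f \<Longrightarrow> w \<in> carrier W \<Longrightarrow> lin R V U (\<lambda>v. f v w)"
  by (auto simp: bilin_def)

lemma bilin_closed: "bilin R V W U f \<Longrightarrow> v \<in> carrier V \<Longrightarrow> w \<in> carrier W \<Longrightarrow> f v w \<in> carrier U"
  by (rule lin_closed[OF bilin_right_lin])

lemma bilin_cong:
  assumes "bilin R V W U f" "\<And>v w. v \<in> carrier V \<Longrightarrow> w \<in> carrier W \<Longrightarrow> f v w = g v w"
  shows "bilin R V W U g"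
  by (intro bilinI bilin_modules[OF assms(1)])
    (auto intro: lin_cong[OF bilin_right_lin[OF assms(1)]] lin_cong[OF bilin_left_lin[OF assms(1)]]
      simp: assms(2))

lemma bilin_comp: "lin R U X g \<Longrightarrow> bilin R V W U f \<Longrightarrow> bilin R V W X (\<lambda>v w. g (f v w))"
  by (auto simp: bilin_def dest: lin_modules intro: lin_comp)

lemma bilin_swap: "bilin R V W U f \<Longrightarrow> bilin R W V U (\<lambda>w v. f v w)"
  by (auto simp: bilin_def)

section \<open>The ground field as a module over itself\<close>

lemma self_module_simps [simp]:
  "carrier (self_module R) = carrier R" "add (self_module R) = add R" "smult (self_module R) = mult R"
  "zero (self_module R) = zero R"
  by (simp_all add: self_module_def)

lemma abelian_group_transfer:
  assumes "abelian_group G" "carrier G' = carrier G" "zero G' = zero G"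
    "\<And>x y. x \<in> carrier G \<Longrightarrow> y \<in> carrier G \<Longrightarrow> x \<oplus>\<^bsub>G'\<^esub> y = x \<oplus>\<^bsub>G\<^esub> y"
  shows "abelian_group G'"
proof -
  interpret abelian_group G by (rule assms)
  show ?thesis
  proof (rule abelian_groupI)
    fix x assume "x \<in> carrier G'"
    then show "\<exists>y\<in>carrier G'. y \<oplus>\<^bsub>G'\<^esub> x = \<zero>\<^bsub>G'\<^esub>"
      using assms(2-4) l_neg[of x] a_inv_closed[of x] by (metis (full_types))
  qed (simp_all add: assms(2-4) a_ac)
qed

lemma module_self_module:
  assumes "cring R" shows "module R (self_module R)"
proof -
  interpret cring R by (rule assms)
  have a: "abelian_group (self_module R)"
    by (rule abelian_group_transfer[OF abelian_group_axioms]) (simp_all only: self_module_simps)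
  show ?thesis
    by (rule moduleI[OF assms a]; simp only: self_module_simps;
      rule m_closed l_distr r_distr m_assoc l_one; assumption)
qed

lemma bilin_smult:
  assumes "module R V" shows "bilin R (self_module R) V V (\<lambda>c v. c \<odot>\<^bsub>V\<^esub> v)"
proof -
  interpret module R V by (rule assms)
  have m: "module R (self_module R)" by (rule module_self_module) unfold_locales
  show ?thesis
  proof (rule bilinI[OF m assms assms])
    fix c assume "c \<in> carrier (self_module R)"
    then show "lin R V V (\<lambda>v. c \<odot>\<^bsub>V\<^esub> v)" by (intro lin_smultI lin_id assms) simp
  next
    fix v assume "v \<in> carrier V"
    then show "lin R (self_module R) V (\<lambda>c. c \<odot>\<^bsub>V\<^esub> v)"
      by (intro linI m assms) (simp_all add: smult_l_distr smult_assoc1)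
  qed
qed

section \<open>Tensor products\<close>

locale tensor_product = V: module R V + W: module R W
  for R :: "('k, 'r) ring_scheme" and V :: "('k, 'a, 'x) module_scheme" and W :: "('k, 'b, 'y) module_scheme"
begin

abbreviation teq :: "('a \<times> 'b) list \<Rightarrow> ('a \<times> 'b) list \<Rightarrow> bool" (infix \<open>\<approx>\<close> 50)
  where "s \<approx> t \<equiv> tensor_eq R V W s t"

abbreviation "formal t \<equiv> set t \<subseteq> carrier V \<times> carrier W"

abbreviation "nf \<equiv> tensor_nf R V W"

abbreviation "T \<equiv> tensor R V W"

abbreviation scale :: "'k \<Rightarrow> ('a \<times> 'b) list \<Rightarrow> ('a \<times> 'b) list"
  where "scale c t \<equiv> [(c \<odot>\<^bsub>V\<^esub> v, w). (v, w) \<leftarrow> t]"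

lemma left_module: "module R V" and right_module: "module R W"
  by unfold_locales

lemmas teq_trans [trans] = tensor_eq.trans[of R V W]

section \<open>The module structure on the quotient of formal sums\<close>

lemma teq_formal: "s \<approx> t \<Longrightarrow> formal s \<and> formal t"
  by (induction rule: tensor_eq.induct) auto

lemma teq_nf: "formal t \<Longrightarrow> t \<approx> nf t"
  unfolding tensor_nf_def by (rule someI_ex) (auto intro: tensor_eq.refl)

lemma nf_teq: "formal t \<Longrightarrow> nf t \<approx> t"
  by (rule tensor_eq.sym[OF teq_nf])

text \<open>Equivalent lists have the same equivalence class as a predicate, and the choice made by
  \<open>SOME\<close> depends on nothing else. So equations in the tensor product reduce to
  derivations in \<open>tensor_eq\<close>.\<close>

lemma nf_eq: assumes "s \<approx> t" shows "nf s = nf t"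
proof -
  have "tensor_eq R V W s = tensor_eq R V W t"
    using assms by (auto intro: tensor_eq.trans tensor_eq.sym)
  then show ?thesis by (simp add: tensor_nf_def)
qed

lemma formal_nf: "formal t \<Longrightarrow> formal (nf t)"
  using teq_formal[OF teq_nf] by blast

lemma nf_nf: "formal t \<Longrightarrow> nf (nf t) = nf t"
  by (rule nf_eq[OF nf_teq])

lemma tensor_carrier: "carrier T = {t. formal t \<and> nf t = t}"
  by (auto simp: tensor_def nf_nf dest: formal_nf[THEN subsetD]) metis

lemma nf_closed: "formal t \<Longrightarrow> nf t \<in> carrier T"
  by (auto simp: tensor_def)

lemma tensor_formal: "t \<in> carrier T \<Longrightarrow> formal t"
  by (simp add: tensor_carrier)

lemma tensor_nf_id: "t \<in> carrier T \<Longrightarrow> nf t = t"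
  by (simp add: tensor_carrier)

lemma tensor_simps: "s \<oplus>\<^bsub>T\<^esub> t = nf (s @ t)" "c \<odot>\<^bsub>T\<^esub> t = nf (scale c t)" "\<zero>\<^bsub>T\<^esub> = nf []"
  by (simp_all add: tensor_def)

lemma teq_scale: "s \<approx> t \<Longrightarrow> c \<in> carrier R \<Longrightarrow> scale c s \<approx> scale c t"
proof (induction rule: tensor_eq.induct)
  \<comment> \<open>The scalar \<open>d\<close> crosses to the right factor while \<open>c\<close>
    stays on the left, so the two have to be interchanged first.\<close>
  case (balanced d v w)
  then have "c \<odot>\<^bsub>V\<^esub> (d \<odot>\<^bsub>V\<^esub> v) = d \<odot>\<^bsub>V\<^esub> (c \<odot>\<^bsub>V\<^esub> v)"
    by (intro smult_commute[OF left_module])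
  then show ?case using balanced by (simp add: tensor_eq.balanced)
qed (auto simp: V.smult_r_distr intro: tensor_eq.intros intro!: tensor_eq.refl tensor_eq.comm V.smult_closed)

lemma formal_scale: "formal t \<Longrightarrow> c \<in> carrier R \<Longrightarrow> formal (scale c t)"
  by auto

lemma teq_append_left: "s \<approx> s' \<Longrightarrow> formal t \<Longrightarrow> s @ t \<approx> s' @ t"
  by (rule tensor_eq.append) (auto intro: tensor_eq.refl)

lemma teq_append_right: "t \<approx> t' \<Longrightarrow> formal s \<Longrightarrow> s @ t \<approx> s @ t'"
  by (rule tensor_eq.append) (auto intro: tensor_eq.refl)

lemma teq_scale_add:
  assumes "formal t" "c \<in> carrier R" "d \<in> carrier R"
  shows "scale (c \<oplus>\<^bsub>R\<^esub> d) t \<approx> scale c t @ scale d t"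
  using assms(1)
proof (induction t)
  case Nil
  show ?case by (simp add: tensor_eq.refl)
next
  case (Cons p t)
  obtain v w where p: "p = (v, w)" "v \<in> carrier V" "w \<in> carrier W" using Cons.prems by (cases p) auto
  have f: "formal (scale c t)" "formal (scale d t)" using Cons.prems assms(2,3) by (auto intro!: formal_scale)
  have "scale (c \<oplus>\<^bsub>R\<^esub> d) (p # t) = [(c \<odot>\<^bsub>V\<^esub> v \<oplus>\<^bsub>V\<^esub> d \<odot>\<^bsub>V\<^esub> v, w)] @ scale (c \<oplus>\<^bsub>R\<^esub> d) t"
    using p assms by (simp add: V.smult_l_distr)
  also have "\<dots> \<approx> [(c \<odot>\<^bsub>V\<^esub> v, w), (d \<odot>\<^bsub>V\<^esub> v, w)] @ (scale c t @ scale d t)"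
    using p assms Cons by (intro tensor_eq.append tensor_eq.add_left) auto
  \<comment> \<open>The second half of the split head has to travel past the first scaled tail; the
    bracketing isolates this one swap.\<close>
  also have "\<dots> = [(c \<odot>\<^bsub>V\<^esub> v, w)] @ (([(d \<odot>\<^bsub>V\<^esub> v, w)] @ scale c t) @ scale d t)" by simp
  also have "\<dots> \<approx> [(c \<odot>\<^bsub>V\<^esub> v, w)] @ ((scale c t @ [(d \<odot>\<^bsub>V\<^esub> v, w)]) @ scale d t)"
    using p assms f by (intro teq_append_right teq_append_left tensor_eq.comm) auto
  also have "\<dots> = scale c (p # t) @ scale d (p # t)" using p by simp
  finally show ?case .
qed

lemma teq_scale_zero: "formal t \<Longrightarrow> scale \<zero>\<^bsub>R\<^esub> t \<approx> []"
proof (induction t)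
  case Nil
  show ?case by (simp add: tensor_eq.refl)
next
  case (Cons p t)
  then obtain v w where p: "p = (v, w)" "v \<in> carrier V" "w \<in> carrier W" by (cases p) auto
  have "[(\<zero>\<^bsub>V\<^esub>, w)] @ scale \<zero>\<^bsub>R\<^esub> t \<approx> [] @ []"
    using Cons p by (intro tensor_eq.append tensor_eq.zero_left) auto
  then show ?case using p by simp
qed

lemma scale_one: "formal t \<Longrightarrow> scale \<one>\<^bsub>R\<^esub> t = t"
  by (induction t) auto

lemma scale_scale: "formal t \<Longrightarrow> c \<in> carrier R \<Longrightarrow> d \<in> carrier R \<Longrightarrow> scale c (scale d t) = scale (c \<otimes>\<^bsub>R\<^esub> d) t"
  by (induction t) (auto simp: V.smult_assoc1)

text \<open>Normal forms may be dropped inside an outer \<open>nf\<close>. With this and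
  \<open>nf_scale\<close>, the module axioms for the normalised operations become statements about
  plain lists.\<close>

lemma nf_append: "formal s \<Longrightarrow> formal t \<Longrightarrow> nf (nf s @ nf t) = nf (s @ t)"
  by (intro nf_eq tensor_eq.append nf_teq)

lemma nf_scale: "formal t \<Longrightarrow> c \<in> carrier R \<Longrightarrow> nf (scale c (nf t)) = nf (scale c t)"
  by (intro nf_eq teq_scale nf_teq)

lemma tensor_module: "module R T"
proof (rule moduleI)
  show "cring R" by (rule V.is_cring)
  show "abelian_group T"
  proof (rule abelian_groupI)
    fix s t u assume c: "s \<in> carrier T" "t \<in> carrier T" "u \<in> carrier T"
    then have f: "formal s" "formal t" "formal u" by (auto dest: tensor_formal)
    show "s \<oplus>\<^bsub>T\<^esub> t \<in> carrier T" using f by (simp add: tensor_simps nf_closed)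
    have "nf (nf (s @ t) @ nf u) = nf (nf s @ nf (t @ u))" using f by (simp add: nf_append)
    then show "(s \<oplus>\<^bsub>T\<^esub> t) \<oplus>\<^bsub>T\<^esub> u = s \<oplus>\<^bsub>T\<^esub> (t \<oplus>\<^bsub>T\<^esub> u)"
      using c by (simp add: tensor_simps tensor_nf_id)
    show comm: "s \<oplus>\<^bsub>T\<^esub> t = t \<oplus>\<^bsub>T\<^esub> s" using f by (simp add: tensor_simps nf_eq tensor_eq.comm)
    have "nf (nf [] @ nf s) = nf s" using f by (simp add: nf_append)
    then show "\<zero>\<^bsub>T\<^esub> \<oplus>\<^bsub>T\<^esub> s = s" using c by (simp add: tensor_simps tensor_nf_id)
    \<comment> \<open>The negative of \<open>s\<close> is its multiple by -1: the two add up to the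
      multiple by 0, whose entries all vanish.\<close>
    let ?m = "\<ominus>\<^bsub>R\<^esub> \<one>\<^bsub>R\<^esub>"
    have "scale ?m s @ scale \<one>\<^bsub>R\<^esub> s \<approx> scale (?m \<oplus>\<^bsub>R\<^esub> \<one>\<^bsub>R\<^esub>) s"
      using f by (intro tensor_eq.sym[OF teq_scale_add]) auto
    also have "scale (?m \<oplus>\<^bsub>R\<^esub> \<one>\<^bsub>R\<^esub>) s \<approx> []" using teq_scale_zero[OF f(1)] by (simp add: V.R.l_neg)
    finally have "scale ?m s @ s \<approx> []" by (simp only: scale_one[OF f(1)])
    then have "nf (scale ?m s @ s) = nf []" by (rule nf_eq)
    moreover have "formal (scale ?m s)" using f by (intro formal_scale) auto
    ultimately have "nf (nf (scale ?m s) @ nf s) = nf []" using f by (simp only: nf_append)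
    then have "nf (scale ?m s) \<oplus>\<^bsub>T\<^esub> s = \<zero>\<^bsub>T\<^esub>" using c by (simp add: tensor_simps tensor_nf_id)
    then show "\<exists>t\<in>carrier T. t \<oplus>\<^bsub>T\<^esub> s = \<zero>\<^bsub>T\<^esub>"
      using nf_closed[OF formal_scale[OF f(1), of ?m]] by auto
  qed (simp add: tensor_simps nf_closed)
next
  fix t assume t: "t \<in> carrier T"
  show "\<one>\<^bsub>R\<^esub> \<odot>\<^bsub>T\<^esub> t = t"
    using t tensor_formal[OF t] by (simp add: tensor_simps scale_one tensor_nf_id)
next
  fix c t assume c: "c \<in> carrier R" "t \<in> carrier T"
  note f = tensor_formal[OF c(2)]
  show "c \<odot>\<^bsub>T\<^esub> t \<in> carrier T" using c f formal_scale[OF f c(1)] by (simp add: tensor_simps nf_closed)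
  fix d assume d: "d \<in> carrier R"
  note fc = formal_scale[OF f c(1)] note fd = formal_scale[OF f d]
  show "(c \<oplus>\<^bsub>R\<^esub> d) \<odot>\<^bsub>T\<^esub> t = c \<odot>\<^bsub>T\<^esub> t \<oplus>\<^bsub>T\<^esub> d \<odot>\<^bsub>T\<^esub> t"
    using nf_eq[OF teq_scale_add[OF f c(1) d]] nf_append[OF fc fd] by (simp add: tensor_simps)
  show "(c \<otimes>\<^bsub>R\<^esub> d) \<odot>\<^bsub>T\<^esub> t = c \<odot>\<^bsub>T\<^esub> (d \<odot>\<^bsub>T\<^esub> t)"
    using nf_scale[OF fd c(1)] scale_scale[OF f c(1) d] by (simp only: tensor_simps)
next
  fix c s t assume c: "c \<in> carrier R" "s \<in> carrier T" "t \<in> carrier T"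
  note f = tensor_formal[OF c(2)] tensor_formal[OF c(3)]
  have "nf (scale c (nf (s @ t))) = nf (nf (scale c s) @ nf (scale c t))"
    using f formal_scale[OF f(1) c(1)] formal_scale[OF f(2) c(1)] nf_scale[of "s @ t" c] c
      nf_append[of "scale c s" "scale c t"] by simp
  then show "c \<odot>\<^bsub>T\<^esub> (s \<oplus>\<^bsub>T\<^esub> t) = c \<odot>\<^bsub>T\<^esub> s \<oplus>\<^bsub>T\<^esub> c \<odot>\<^bsub>T\<^esub> t" by (simp only: tensor_simps)
qed

section \<open>The universal property of the tensor product\<close>

lemma teq_tsum:
  assumes "bilin R V W U f" "s \<approx> t" shows "tsum U f s = tsum U f t"
proof -
  interpret U: module R U by (rule bilin_modules(3)[OF assms(1)])
  note b = bilin_right_lin[OF assms(1)] bilin_left_lin[OF assms(1)]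
  have c: "f v w \<in> carrier U" if "(v, w) \<in> set t" "formal t" for v w t
    using that by (intro bilin_closed[OF assms(1)]) auto
  show ?thesis using assms(2)
  proof (induction rule: tensor_eq.induct)
    case (append xs xs' ys ys')
    then show ?case using teq_formal[OF append(1)] teq_formal[OF append(2)]
      by (subst (1 2) U.tsum_append) (auto intro: bilin_closed[OF assms(1)])
  next
    case (comm xs ys)
    then have "tsum U f (xs @ ys) = tsum U f xs \<oplus>\<^bsub>U\<^esub> tsum U f ys"
      "tsum U f (ys @ xs) = tsum U f ys \<oplus>\<^bsub>U\<^esub> tsum U f xs"
      "tsum U f xs \<in> carrier U" "tsum U f ys \<in> carrier U"
      by (auto intro!: U.tsum_append U.tsum_closed bilin_closed[OF assms(1)])
    then show ?case by (simp add: U.a_comm)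
  next
    case (zero_left w)
    then show ?case using lin_zero[OF b(2)] by simp
  next
    case (zero_right v)
    then show ?case using lin_zero[OF b(1)] by simp
  next
    case (add_left v v' w)
    then show ?case using lin_add[OF b(2), of w v v'] by (simp add: bilin_closed[OF assms(1)])
  next
    case (add_right v w w')
    then show ?case using lin_add[OF b(1), of v w w'] by (simp add: bilin_closed[OF assms(1)])
  next
    case (balanced c v w)
    then show ?case using lin_smult[OF b(1), of v c w] lin_smult[OF b(2), of w c v] by simp
  qed auto
qed

lemma tsum_nf: "bilin R V W U f \<Longrightarrow> formal t \<Longrightarrow> tsum U f (nf t) = tsum U f t"
  by (rule teq_tsum[OF _ nf_teq])

lemma pure_closed: "v \<in> carrier V \<Longrightarrow> w \<in> carrier W \<Longrightarrow> pure_tensor R V W v w \<in> carrier T"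
  by (simp add: pure_tensor_def nf_closed)

lemma pure_bilin: "bilin R V W T (pure_tensor R V W)"
proof (rule bilinI[OF left_module right_module tensor_module])
  fix v assume v: "v \<in> carrier V"
  show "lin R W T (\<lambda>w. pure_tensor R V W v w)"
  proof (rule linI[OF right_module tensor_module])
    fix w w' assume w: "w \<in> carrier W" "w' \<in> carrier W"
    have "nf [(v, w \<oplus>\<^bsub>W\<^esub> w')] = nf ([(v, w)] @ [(v, w')])"
      using v w by (simp add: nf_eq tensor_eq.add_right)
    also have "\<dots> = nf (nf [(v, w)] @ nf [(v, w')])" using v w by (intro nf_append[symmetric]) auto
    finally show "pure_tensor R V W v (w \<oplus>\<^bsub>W\<^esub> w') = pure_tensor R V W v w \<oplus>\<^bsub>T\<^esub> pure_tensor R V W v w'"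
      by (simp only: pure_tensor_def tensor_simps)
  next
    fix c w assume c: "c \<in> carrier R" "w \<in> carrier W"
    have "nf [(v, c \<odot>\<^bsub>W\<^esub> w)] = nf (scale c [(v, w)])"
      using v c by (simp add: nf_eq tensor_eq.sym tensor_eq.balanced)
    also have "\<dots> = nf (scale c (nf [(v, w)]))" using v c by (intro nf_scale[symmetric]) auto
    finally show "pure_tensor R V W v (c \<odot>\<^bsub>W\<^esub> w) = c \<odot>\<^bsub>T\<^esub> pure_tensor R V W v w"
      by (simp only: pure_tensor_def tensor_simps)
  qed (simp add: pure_closed v)
next
  fix w assume w: "w \<in> carrier W"
  show "lin R V T (\<lambda>v. pure_tensor R V W v w)"
  proof (rule linI[OF left_module tensor_module])
    fix v v' assume v: "v \<in> carrier V" "v' \<in> carrier V"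
    have "nf [(v \<oplus>\<^bsub>V\<^esub> v', w)] = nf ([(v, w)] @ [(v', w)])"
      using v w by (simp add: nf_eq tensor_eq.add_left)
    also have "\<dots> = nf (nf [(v, w)] @ nf [(v', w)])" using v w by (intro nf_append[symmetric]) auto
    finally show "pure_tensor R V W (v \<oplus>\<^bsub>V\<^esub> v') w = pure_tensor R V W v w \<oplus>\<^bsub>T\<^esub> pure_tensor R V W v' w"
      by (simp only: pure_tensor_def tensor_simps)
  next
    fix c v assume c: "c \<in> carrier R" "v \<in> carrier V"
    have "nf [(c \<odot>\<^bsub>V\<^esub> v, w)] = nf (scale c [(v, w)])" by simp
    also have "\<dots> = nf (scale c (nf [(v, w)]))" using w c by (intro nf_scale[symmetric]) auto
    finally show "pure_tensor R V W (c \<odot>\<^bsub>V\<^esub> v) w = c \<odot>\<^bsub>T\<^esub> pure_tensor R V W v w"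
      by (simp only: pure_tensor_def tensor_simps)
  qed (simp add: pure_closed w)
qed

text \<open>Adding pure tensors one at a time concatenates their lists up to equivalence, so the sum
  over a list returns the class of that list. For an element of \<open>T\<close> this means that it
  is the sum of the pure tensors it lists.\<close>

lemma nf_tsum: "formal t \<Longrightarrow> tsum T (pure_tensor R V W) t = nf t"
proof (induction t)
  case Nil
  then show ?case by (simp add: tensor_simps)
next
  case (Cons p t)
  then obtain v w where p: "p = (v, w)" "v \<in> carrier V" "w \<in> carrier W" by (cases p) auto
  then show ?case using Cons nf_append[of "[p]" t] by (simp add: tensor_simps pure_tensor_def)
qed

lemma tensor_tsum: "t \<in> carrier T \<Longrightarrow> tsum T (pure_tensor R V W) t = t"
  by (simp add: nf_tsum tensor_formal tensor_nf_id)

lemma tsum_pure: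
  "bilin R V W U f \<Longrightarrow> v \<in> carrier V \<Longrightarrow> w \<in> carrier W \<Longrightarrow> tsum U f (pure_tensor R V W v w) = f v w"
  unfolding pure_tensor_def
  by (subst tsum_nf)
    (auto simp: bilin_closed abelian_monoid.r_zero[OF module_abelian_monoid[OF bilin_modules(3)]])

text \<open>Existence half of the universal property: the operations of \<open>T\<close> are list
  operations followed by \<open>nf\<close>, and by \<open>tsum_nf\<close> the sum of a bilinear
  \<open>f\<close> does not see \<open>nf\<close>.\<close>

lemma lift_lin:
  assumes "bilin R V W U f" shows "lin R T U (tsum U f)"
proof -
  interpret U: module R U by (rule bilin_modules(3)[OF assms(1)])
  show ?thesis
  proof (rule linI[OF tensor_module bilin_modules(3)[OF assms(1)]])
    fix t assume t: "t \<in> carrier T"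
    note ft = tensor_formal[OF t]
    then show "tsum U f t \<in> carrier U" by (auto intro!: U.tsum_closed bilin_closed[OF assms])
    {
      fix s assume "s \<in> carrier T"
      then have "formal s" by (rule tensor_formal)
      then show "tsum U f (t \<oplus>\<^bsub>T\<^esub> s) = tsum U f t \<oplus>\<^bsub>U\<^esub> tsum U f s" using ft
        unfolding tensor_simps
        by (subst tsum_nf[OF assms]) (auto intro!: U.tsum_append bilin_closed[OF assms])
    }
    fix c assume c: "c \<in> carrier R"
    have "tsum U f (c \<odot>\<^bsub>T\<^esub> t) = tsum U (\<lambda>v w. f (c \<odot>\<^bsub>V\<^esub> v) w) t"
      unfolding tensor_simps by (simp add: tsum_nf[OF assms formal_scale[OF ft c]] tsum_map)
    also have "\<dots> = tsum U (\<lambda>v w. c \<odot>\<^bsub>U\<^esub> f v w) t"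
      using ft c by (intro tsum_cong lin_smult[OF bilin_left_lin[OF assms]]) auto
    also have "\<dots> = c \<odot>\<^bsub>U\<^esub> tsum U f t"
      using ft c by (intro tsum_smult[OF bilin_modules(3)[OF assms]]) (auto intro: bilin_closed[OF assms])
    finally show "tsum U f (c \<odot>\<^bsub>T\<^esub> t) = c \<odot>\<^bsub>U\<^esub> tsum U f t" .
  qed
qed

text \<open>Uniqueness half: by \<open>tensor_tsum\<close> every element is a sum of pure tensors,
  and both maps commute with that sum.\<close>

lemma tensor_ext:
  assumes "lin R T U f" "lin R T U g" "t \<in> carrier T"
    "\<And>v w. v \<in> carrier V \<Longrightarrow> w \<in> carrier W \<Longrightarrow> f (pure_tensor R V W v w) = g (pure_tensor R V W v w)"
  shows "f t = g t"
proof -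
  have c: "pure_tensor R V W v w \<in> carrier T" if "(v, w) \<in> set t" for v w
    using that tensor_formal[OF assms(3)] by (auto intro: pure_closed)
  have "f (tsum T (pure_tensor R V W) t) = g (tsum T (pure_tensor R V W) t)"
    using tensor_formal[OF assms(3)]
    by (auto simp: lin_tsum[OF assms(1) c] lin_tsum[OF assms(2) c] intro!: tsum_cong assms(4))
  then show ?thesis by (simp add: tensor_tsum[OF assms(3)])
qed

end

section \<open>Sweedler sums\<close>

text \<open>The two conditions are the two bracketings that coassociativity and the associator
  compare: \<open>f\<close> is to factor through a tensor product of the last two arguments, and
  through one of the first two.\<close>

definition trilin ::
  "('k, 'r) ring_scheme \<Rightarrow> ('k, 'a, 'x) module_scheme \<Rightarrow> ('k, 'b, 'y) module_scheme \<Rightarrow>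
   ('k, 'c, 'z) module_scheme \<Rightarrow> ('k, 'd, 'w) module_scheme \<Rightarrow> ('a \<Rightarrow> 'b \<Rightarrow> 'c \<Rightarrow> 'd) \<Rightarrow> bool"
  where "trilin R A B C U f \<longleftrightarrow> (\<forall>a\<in>carrier A. bilin R B C U (f a)) \<and>
    (\<forall>c\<in>carrier C. bilin R A B U (\<lambda>a b. f a b c))"

lemma trilinI:
  assumes "module R A" "module R B" "module R C" "module R U"
    "\<And>b c. b \<in> carrier B \<Longrightarrow> c \<in> carrier C \<Longrightarrow> lin R A U (\<lambda>a. f a b c)"
    "\<And>a c. a \<in> carrier A \<Longrightarrow> c \<in> carrier C \<Longrightarrow> lin R B U (\<lambda>b. f a b c)"
    "\<And>a b. a \<in> carrier A \<Longrightarrow> b \<in> carrier B \<Longrightarrow> lin R C U (\<lambda>c. f a b c)"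
  shows "trilin R A B C U f"
  using assms by (auto simp: trilin_def bilin_def)

lemma trilin_bilin:
  "trilin R A B C U f \<Longrightarrow> a \<in> carrier A \<Longrightarrow> bilin R B C U (f a)"
  "trilin R A B C U f \<Longrightarrow> c \<in> carrier C \<Longrightarrow> bilin R A B U (\<lambda>a b. f a b c)"
  by (auto simp: trilin_def)

context hopf_algebra
begin

interpretation R: field R by (rule field)

lemma hopf_module: "module R H"
  using algebra by (simp add: k_algebra_def)

interpretation H: ring H
  using algebra by (simp add: k_algebra_def)

interpretation HH: tensor_product R H H
  by (intro tensor_product.intro hopf_module)

lemma self_module: "module R (self_module R)"
  by (rule module_self_module) unfold_locales

lemma mult_bilin: "bilin R H H H (mult H)"
  using algebra
  by (intro bilinI hopf_module) (auto simp: k_algebra_def H.l_distr H.r_distr intro!: linI)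

lemma counit_lin: "lin R H (self_module R) (counit H)"
  using counit_linear self_module hopf_module by (simp add: lin_def)

lemma counit_closed: "h \<in> carrier H \<Longrightarrow> counit H h \<in> carrier R"
  using lin_closed[OF counit_lin] by simp

lemma counit_mult: "h \<in> carrier H \<Longrightarrow> l \<in> carrier H \<Longrightarrow> counit H (h \<otimes>\<^bsub>H\<^esub> l) = counit H h \<otimes>\<^bsub>R\<^esub> counit H l"
  using counit_ring_hom by (simp add: ring_hom_def)

lemma counit_one: "counit H \<one>\<^bsub>H\<^esub> = \<one>\<^bsub>R\<^esub>"
  using counit_ring_hom by (simp add: ring_hom_def)

lemma comult_lin: "lin R H (tensor R H H) (comult H)"
  using comult_linear HH.tensor_module hopf_module by (simp add: lin_def)

lemma comult_closed: "h \<in> carrier H \<Longrightarrow> comult H h \<in> carrier (tensor R H H)"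
  by (rule lin_closed[OF comult_lin])

lemma comult_elem: "(a, b) \<in> set (comult H h) \<Longrightarrow> h \<in> carrier H \<Longrightarrow> a \<in> carrier H \<and> b \<in> carrier H"
  using HH.tensor_formal[OF comult_closed] by blast

text \<open>\<open>cosum sw U f h\<close> is the sum of the \<open>f h\<^sub>1 h\<^sub>2\<close>, and of the \<open>f h\<^sub>2 h\<^sub>1\<close> if \<open>sw\<close> holds: the flag selects
  the Hopf algebra or its co-opposite bialgebra, so that both parts of the theorem are treated alike.\<close>

definition cosum :: "bool \<Rightarrow> ('k, 'u, 'y) module_scheme \<Rightarrow> ('h \<Rightarrow> 'h \<Rightarrow> 'u) \<Rightarrow> 'h \<Rightarrow> 'u"
  where "cosum sw U f h = tsum U (\<lambda>a b. if sw then f b a else f a b) (comult H h)"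

lemma cosum_cong:
  assumes "h \<in> carrier H" "\<And>a b. a \<in> carrier H \<Longrightarrow> b \<in> carrier H \<Longrightarrow> f a b = g a b"
  shows "cosum sw U f h = cosum sw U g h"
  unfolding cosum_def using assms by (auto intro!: tsum_cong dest: comult_elem)

text \<open>This brings a statement about the co-opposite comultiplication back to the action of
  \<open>H\<close> itself on a tensor product.\<close>

lemma cosum_swap_args: "cosum sw U (\<lambda>a b. f b a) h = cosum (\<not> sw) U f h"
  by (cases sw) (simp_all add: cosum_def)

lemma if_bilin: "bilin R V V U f \<Longrightarrow> bilin R V V U (\<lambda>a b. if sw then f b a else f a b)"
  by (cases sw) (auto dest: bilin_swap)

lemma cosum_lin: "bilin R H H U f \<Longrightarrow> lin R H U (cosum sw U f)"
  using lin_comp[OF HH.lift_lin[OF if_bilin] comult_lin] unfolding cosum_def[abs_def] .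

lemma cosum_closed:
  assumes "module R U" "h \<in> carrier H" "\<And>a b. a \<in> carrier H \<Longrightarrow> b \<in> carrier H \<Longrightarrow> f a b \<in> carrier U"
  shows "cosum sw U f h \<in> carrier U"
  unfolding cosum_def using assms
  by (auto intro!: abelian_monoid.tsum_closed module_abelian_monoid dest: comult_elem)

lemma lin_cosum:
  assumes "lin R U W \<phi>" "h \<in> carrier H" "\<And>a b. a \<in> carrier H \<Longrightarrow> b \<in> carrier H \<Longrightarrow> f a b \<in> carrier U"
  shows "\<phi> (cosum sw U f h) = cosum sw W (\<lambda>a b. \<phi> (f a b)) h"
  unfolding cosum_def using assms
  by (subst lin_tsum[OF assms(1)]) (auto intro!: tsum_cong dest: comult_elem)

text \<open>Counterpart of \<open>cosum_lin\<close>: there the element \<open>h\<close> varies, here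
  it is fixed and a parameter of the summand varies. Together they give the bilinearity of
  expressions in Sweedler notation.\<close>

lemma cosum_linI:
  assumes "module R V" "module R U" "h \<in> carrier H"
    "\<And>a b. a \<in> carrier H \<Longrightarrow> b \<in> carrier H \<Longrightarrow> lin R V U (\<lambda>x. f x a b)"
  shows "lin R V U (\<lambda>x. cosum sw U (f x) h)"
  unfolding cosum_def using assms by (cases sw) (auto intro!: lin_tsumI dest: comult_elem)

lemma cosum_exchange:
  assumes "module R U" "h \<in> carrier H" "l \<in> carrier H"
    "\<And>a b c d. a \<in> carrier H \<Longrightarrow> b \<in> carrier H \<Longrightarrow> c \<in> carrier H \<Longrightarrow> d \<in> carrier H \<Longrightarrow> f a b c d \<in> carrier U"
  shows "cosum sw U (\<lambda>a b. cosum sw' U (f a b) l) h = cosum sw' U (\<lambda>c d. cosum sw U (\<lambda>a b. f a b c d) h) l"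
proof -
  interpret U: module R U by (rule assms)
  \<comment> \<open>Moving the flags into the arguments of \<open>f\<close> covers all four
    combinations of them by one exchange of finite sums.\<close>
  have "tsum U (\<lambda>a b. tsum U (\<lambda>c d. f (if sw then b else a) (if sw then a else b) (if sw' then d else c) (if sw' then c else d)) (comult H l)) (comult H h)
     = tsum U (\<lambda>c d. tsum U (\<lambda>a b. f (if sw then b else a) (if sw then a else b) (if sw' then d else c) (if sw' then c else d)) (comult H h)) (comult H l)"
    using assms by (intro U.tsum_swap) (auto intro!: assms(4) dest: comult_elem)
  then show ?thesis by (cases sw; cases sw') (simp_all add: cosum_def)
qed

lemma comult_one: "comult H \<one>\<^bsub>H\<^esub> = tensor_nf R H H [(\<one>\<^bsub>H\<^esub>, \<one>\<^bsub>H\<^esub>)]"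
  using comult_ring_hom by (simp add: ring_hom_def tensor_def)

lemma comult_mult:
  "h \<in> carrier H \<Longrightarrow> l \<in> carrier H \<Longrightarrow> comult H (h \<otimes>\<^bsub>H\<^esub> l) =
    tensor_nf R H H [(v \<otimes>\<^bsub>H\<^esub> v', w \<otimes>\<^bsub>H\<^esub> w'). (v, w) \<leftarrow> comult H h, (v', w') \<leftarrow> comult H l]"
  using comult_ring_hom by (simp add: ring_hom_def tensor_def)

lemma cosum_one: "bilin R H H U f \<Longrightarrow> cosum sw U f \<one>\<^bsub>H\<^esub> = f \<one>\<^bsub>H\<^esub> \<one>\<^bsub>H\<^esub>"
  using HH.tsum_pure[OF if_bilin, of U f "\<one>\<^bsub>H\<^esub>" "\<one>\<^bsub>H\<^esub>" sw]
  by (simp add: cosum_def comult_one pure_tensor_def)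

text \<open>The comultiplication is an algebra map, and it remains one after exchanging its two
  legs.\<close>

lemma cosum_mult:
  assumes f: "bilin R H H U f" and h: "h \<in> carrier H" and l: "l \<in> carrier H"
  shows "cosum sw U f (h \<otimes>\<^bsub>H\<^esub> l) = cosum sw U (\<lambda>a b. cosum sw U (\<lambda>a' b'. f (a \<otimes>\<^bsub>H\<^esub> a') (b \<otimes>\<^bsub>H\<^esub> b')) l) h"
proof -
  interpret U: module R U by (rule bilin_modules(3)[OF f])
  let ?f = "\<lambda>a b. if sw then f b a else f a b"
  have "tsum U ?f (comult H (h \<otimes>\<^bsub>H\<^esub> l)) =
    tsum U ?f [(v \<otimes>\<^bsub>H\<^esub> v', w \<otimes>\<^bsub>H\<^esub> w'). (v, w) \<leftarrow> comult H h, (v', w') \<leftarrow> comult H l]"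
    unfolding comult_mult[OF h l] using h l
    by (intro HH.tsum_nf if_bilin f) (auto dest: comult_elem)
  also have "\<dots> = tsum U (\<lambda>v w. tsum U (\<lambda>v' w'. ?f (v \<otimes>\<^bsub>H\<^esub> v') (w \<otimes>\<^bsub>H\<^esub> w')) (comult H l)) (comult H h)"
    using h l by (intro U.tsum_concat bilin_closed[OF if_bilin[OF f]]) (auto dest: comult_elem)
  finally show ?thesis by (cases sw) (simp_all add: cosum_def)
qed

text \<open>The trilinear \<open>f\<close> induces a linear map on
  \<open>H \<otimes> (H \<otimes> H)\<close>; applying it to both sides of the coassociativity axiom
  gives the equation.\<close>

lemma cosum_coassoc:
  assumes f: "trilin R H H H U f" and h: "h \<in> carrier H"
  shows "cosum sw U (\<lambda>a b. cosum sw U (\<lambda>a' a''. f a' a'' b) a) h =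
    cosum sw U (\<lambda>a b. cosum sw U (\<lambda>b' b''. f a b' b'') b) h"
proof -
  interpret H3: tensor_product R H "tensor R H H"
    by (intro tensor_product.intro hopf_module HH.tensor_module)
  have c: "tsum U (\<lambda>a b. tsum U (\<lambda>a' a''. f a' a'' b) (comult H a)) (comult H h) =
    tsum U (\<lambda>a b. tsum U (f a) (comult H b)) (comult H h)"
    if f: "trilin R H H H U f" for f
  proof -
    let ?T = "tensor R H (tensor R H H)"
    let ?p = "pure_tensor R H (tensor R H H)"
    note fa = trilin_bilin(1)[OF f]
    \<comment> \<open>The trilinear map is lifted in two stages: \<open>F a\<close> is the lift of
      \<open>f a\<close> to \<open>H \<otimes> H\<close>, and \<open>F\<close> is then lifted once
      more.\<close>
    define F where "F = (\<lambda>a. tsum U (f a))"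
    have m: "module R U" using bilin_modules(3)[OF fa[of "\<one>\<^bsub>H\<^esub>"]] by simp
    have F: "bilin R H (tensor R H H) U F" unfolding F_def
    proof (rule bilinI[OF hopf_module HH.tensor_module m])
      fix t assume t: "t \<in> carrier (tensor R H H)"
      then show "lin R H U (\<lambda>a. tsum U (f a) t)"
        using HH.tensor_formal[OF t]
        by (intro lin_tsumI hopf_module m) (auto intro!: bilin_left_lin[OF trilin_bilin(2)[OF f]])
    qed (auto intro!: HH.lift_lin fa)
    note l = H3.lift_lin[OF F]
    have p: "?p a (pure_tensor R H H b d) \<in> carrier ?T" "F a (pure_tensor R H H b d) = f a b d"
      if "a \<in> carrier H" "b \<in> carrier H" "d \<in> carrier H" for a b d
      using that by (auto intro!: H3.pure_closed HH.pure_closed simp: F_def HH.tsum_pure fa)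
    have "tsum U F (tsum ?T (\<lambda>a b. tsum ?T (\<lambda>a' a''. ?p a' (pure_tensor R H H a'' b)) (comult H a)) (comult H h))
      = tsum U F (tsum ?T (\<lambda>a b. ?p a (comult H b)) (comult H h))"
      using coassociative[OF h] by (simp add: tsum_def)
    moreover have "tsum U F (tsum ?T (\<lambda>a b. ?p a (comult H b)) (comult H h)) =
       tsum U (\<lambda>a b. tsum U F (?p a (comult H b))) (comult H h)"
      using h by (intro lin_tsum[OF l]) (auto dest!: comult_elem intro!: H3.pure_closed comult_closed)
    moreover have "\<dots> = tsum U (\<lambda>a b. tsum U (f a) (comult H b)) (comult H h)"
      using h by (intro tsum_cong) (auto dest!: comult_elem simp: H3.tsum_pure[OF F] comult_closed, simp add: F_def)
    moreover have "tsum U F (tsum ?T (\<lambda>a b. tsum ?T (\<lambda>a' a''. ?p a' (pure_tensor R H H a'' b)) (comult H a)) (comult H h))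
      = tsum U (\<lambda>a b. tsum U F (tsum ?T (\<lambda>a' a''. ?p a' (pure_tensor R H H a'' b)) (comult H a))) (comult H h)"
      using h by (intro lin_tsum[OF l] abelian_monoid.tsum_closed[OF module_abelian_monoid[OF H3.tensor_module]])
        (meson comult_elem p(1))
    moreover have "\<dots> = tsum U (\<lambda>a b. tsum U (\<lambda>a' a''. f a' a'' b) (comult H a)) (comult H h)"
    proof (intro tsum_cong)
      fix a b assume "(a, b) \<in> set (comult H h)"
      then have ab: "a \<in> carrier H" "b \<in> carrier H" using h by (auto dest: comult_elem)
      have "tsum U F (tsum ?T (\<lambda>a' a''. ?p a' (pure_tensor R H H a'' b)) (comult H a)) =
        tsum U (\<lambda>a' a''. tsum U F (?p a' (pure_tensor R H H a'' b))) (comult H a)"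
        using ab by (intro lin_tsum[OF l]) (meson comult_elem p(1))
      also have "\<dots> = tsum U (\<lambda>a' a''. f a' a'' b) (comult H a)"
        using ab by (intro tsum_cong) (auto dest!: comult_elem simp: H3.tsum_pure[OF F] HH.pure_closed p)
      finally show "tsum U F (tsum ?T (\<lambda>a' a''. ?p a' (pure_tensor R H H a'' b)) (comult H a)) =
        tsum U (\<lambda>a' a''. f a' a'' b) (comult H a)" .
    qed
    ultimately show ?thesis by simp
  qed
  show ?thesis
  proof (cases sw)
    case True
    \<comment> \<open>Reversing all three arguments turns the co-opposite identity into the original
      one with its two sides exchanged.\<close>
    have "trilin R H H H U (\<lambda>a b c. f c b a)"
      using f by (auto simp: trilin_def dest: bilin_swap)
    from c[OF this] True show ?thesis by (simp add: cosum_def)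
  next
    case False
    with c[OF f] show ?thesis by (simp add: cosum_def)
  qed
qed

text \<open>The images under \<open>f\<close> of the two counit laws. The flag only decides which of
  the two laws proves which equation.\<close>

lemma cosum_counit:
  assumes f: "lin R H U f" and h: "h \<in> carrier H"
  shows "cosum sw U (\<lambda>a b. counit H a \<odot>\<^bsub>U\<^esub> f b) h = f h" (is ?L)
    and "cosum sw U (\<lambda>a b. counit H b \<odot>\<^bsub>U\<^esub> f a) h = f h" (is ?R)
proof -
  have *: "f (tsum H (\<lambda>a b. counit H a \<odot>\<^bsub>H\<^esub> b) (comult H h)) = tsum U (\<lambda>a b. counit H a \<odot>\<^bsub>U\<^esub> f b) (comult H h)"
    "f (tsum H (\<lambda>a b. counit H b \<odot>\<^bsub>H\<^esub> a) (comult H h)) = tsum U (\<lambda>a b. counit H b \<odot>\<^bsub>U\<^esub> f a) (comult H h)"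
    using h by (subst lin_tsum[OF f]; auto intro!: tsum_cong lin_smult[OF f] module.smult_closed[OF hopf_module] counit_closed dest: comult_elem)+
  then have "tsum U (\<lambda>a b. counit H a \<odot>\<^bsub>U\<^esub> f b) (comult H h) = f h"
    "tsum U (\<lambda>a b. counit H b \<odot>\<^bsub>U\<^esub> f a) (comult H h) = f h"
    using counit_left[OF h] counit_right[OF h] by (simp_all add: tsum_def)
  then show ?L ?R by (cases sw; simp add: cosum_def)+
qed

end

section \<open>Global modules and their tensor products\<close>

lemma with_action_simps [simp]:
  "carrier (with_action M \<pi>) = carrier M" "zero (with_action M \<pi>) = zero M"
  "add (with_action M \<pi>) = add M" "smult (with_action M \<pi>) = smult M" "act (with_action M \<pi>) = \<pi>"
  by (simp_all add: with_action_def)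

lemma tsum_with_action [simp]: "tsum (with_action M \<pi>) = tsum M"
  by (intro ext) (simp add: tsum_def lsum_def)

lemma module_with_action:
  assumes "module R M" shows "module R (with_action M \<pi>)"
proof -
  interpret module R M by (rule assms)
  have a: "abelian_group (with_action M \<pi>)"
    by (rule abelian_group_transfer[OF module_abelian_group[OF assms]]) simp_all
  show ?thesis
    by (rule moduleI[OF is_cring a])
      (simp_all add: smult_l_distr smult_r_distr smult_assoc1)
qed

lemma lin_from_with_action: "lin R V W f \<Longrightarrow> lin R (with_action V \<pi>) W f"
  by (auto simp: lin_def linear_maps_def module_with_action)

lemma lin_to_with_action: "lin R V W f \<Longrightarrow> lin R V (with_action W \<pi>) f"
  by (auto simp: lin_def linear_maps_def module_with_action)

lemma module_relabel:
  assumes "module R M" and d: "\<And>x. x \<in> carrier M \<Longrightarrow> d (c x) = x"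
  shows "module R (relabel c d M)"
proof -
  interpret module R M by (rule assms)
  have a: "abelian_group (relabel c d M)"
  proof (rule abelian_groupI)
    fix x assume "x \<in> carrier (relabel c d M)"
    then obtain y where y: "x = c y" "y \<in> carrier M" by (auto simp: relabel_def)
    then have "c (\<ominus>\<^bsub>M\<^esub> y) \<in> carrier (relabel c d M)"
      "c (\<ominus>\<^bsub>M\<^esub> y) \<oplus>\<^bsub>relabel c d M\<^esub> x = \<zero>\<^bsub>relabel c d M\<^esub>"
      by (auto simp: relabel_def d M.l_neg)
    then show "\<exists>z\<in>carrier (relabel c d M). z \<oplus>\<^bsub>relabel c d M\<^esub> x = \<zero>\<^bsub>relabel c d M\<^esub>" by blast
  qed (auto simp: relabel_def d M.a_ac)
  show ?thesis
    by (rule moduleI[OF is_cring a])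
      (auto simp: relabel_def d smult_l_distr smult_r_distr smult_assoc1)
qed

lemma lin_relabel:
  assumes "module R M" and d: "\<And>x. x \<in> carrier M \<Longrightarrow> d (c x) = x"
  shows "lin R M (relabel c d M) c" "lin R (relabel c d M) M d"
proof -
  interpret module R M by (rule assms)
  have "module R (relabel c d M)" using assms by (rule module_relabel)
  then show "lin R M (relabel c d M) c" "lin R (relabel c d M) M d"
    using assms(1) by (intro linI; simp; auto simp: relabel_def d)+
qed

section \<open>Morphisms of modules\<close>

lemma LinI: "lin R V W f \<Longrightarrow> f \<in> extensional (carrier V) \<Longrightarrow> f \<in> Lin R V W"
  by (simp add: Lin_def lin_def)

lemma Lin_lin: "f \<in> Lin R V W \<Longrightarrow> module R V \<Longrightarrow> module R W \<Longrightarrow> lin R V W f"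
  by (simp add: Lin_def lin_def)

lemma module_mapsI:
  "lin R X Y f \<Longrightarrow> f \<in> extensional (carrier X) \<Longrightarrow>
   (\<And>h x. h \<in> carrier H \<Longrightarrow> x \<in> carrier X \<Longrightarrow> f (act X h x) = act Y h (f x)) \<Longrightarrow> f \<in> module_maps R H X Y"
  by (simp add: module_maps_def LinI)

lemma module_maps_lin: "f \<in> module_maps R H X Y \<Longrightarrow> module R X \<Longrightarrow> module R Y \<Longrightarrow> lin R X Y f"
  by (simp add: module_maps_def Lin_lin)

lemma module_maps_closed: "f \<in> module_maps R H X Y \<Longrightarrow> x \<in> carrier X \<Longrightarrow> f x \<in> carrier Y"
  by (auto simp: module_maps_def Lin_def linear_maps_def)

lemma module_maps_act:
  "f \<in> module_maps R H X Y \<Longrightarrow> h \<in> carrier H \<Longrightarrow> x \<in> carrier X \<Longrightarrow> f (act X h x) = act Y h (f x)"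
  by (simp add: module_maps_def)

lemma module_maps_extensional: "f \<in> module_maps R H X Y \<Longrightarrow> f \<in> extensional (carrier X)"
  by (simp add: module_maps_def Lin_def)

lemma module_maps_eqI:
  "f \<in> module_maps R H X Y \<Longrightarrow> g \<in> module_maps R H X Z \<Longrightarrow> (\<And>x. x \<in> carrier X \<Longrightarrow> f x = g x) \<Longrightarrow> f = g"
  by (blast intro: extensionalityI module_maps_extensional)

text \<open>The action is only assumed to preserve the carrier, so that the lemma serves global and
  partial modules alike.\<close>

lemma module_maps_compose:
  assumes "module R X" "\<And>h x. h \<in> carrier H \<Longrightarrow> x \<in> carrier X \<Longrightarrow> act X h x \<in> carrier X"
    and f: "f \<in> module_maps R H X Y" and g: "g \<in> module_maps R H Y Z"
  shows "compose (carrier X) g f \<in> module_maps R H X Z"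
proof -
  interpret X: module R X by (rule assms)
  show ?thesis
    using f g assms(2) module_maps_closed[OF f]
    by (auto simp: module_maps_def Lin_def linear_maps_def compose_def)
qed

context hopf_algebra
begin

interpretation R: field R by (rule field)

interpretation H: ring H
  using algebra by (simp add: k_algebra_def)

abbreviation gmod :: "('k, 'h, 'm) hmod \<Rightarrow> bool"
  where "gmod \<equiv> global_module R H"

abbreviation gten :: "('k, 'h, 'a) umod \<Rightarrow> ('k, 'h, 'a) umod \<Rightarrow> ('k, 'h, 'a) umod" (infixr \<open>\<odot>\<odot>\<close> 70)
  where "X \<odot>\<odot> Y \<equiv> global_tensor R H X Y"

lemma global_moduleI:
  assumes "module R X" "bilin R H X X (act X)"
    "\<And>h. h \<in> carrier H \<Longrightarrow> act X h \<in> extensional (carrier X)"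
    "\<And>h l x. h \<in> carrier H \<Longrightarrow> l \<in> carrier H \<Longrightarrow> x \<in> carrier X \<Longrightarrow> act X (h \<otimes>\<^bsub>H\<^esub> l) x = act X h (act X l x)"
    "\<And>x. x \<in> carrier X \<Longrightarrow> act X \<one>\<^bsub>H\<^esub> x = x"
  shows "gmod X"
proof -
  interpret X: module R X by (rule assms)
  note r = bilin_right_lin[OF assms(2)] and l = bilin_left_lin[OF assms(2)]
  \<comment> \<open>Equality in \<open>End_algebra\<close> is equality of functions, also outside
    the carrier; this reduces it to a pointwise one.\<close>
  have e: "act X h = g" if "h \<in> carrier H" "g \<in> extensional (carrier X)"
    "\<And>x. x \<in> carrier X \<Longrightarrow> act X h x = g x" for h g
    using that by (intro extensionalityI[of _ "carrier X"] assms(3)) auto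
  have "act X \<in> linear_maps R H (End_algebra R X)"
    using lin_add[OF l] lin_smult[OF l]
    by (auto simp: linear_maps_def End_algebra_def map_space_def intro!: LinI r assms(3) e
        module.smult_closed[OF hopf_module])
  moreover have "act X \<in> ring_hom H (End_algebra R X)"
    using lin_add[OF l]
    by (auto simp: ring_hom_def End_algebra_def map_space_def intro!: LinI r assms(3) e)
      (auto simp: compose_def assms)
  ultimately show ?thesis using assms(1) by (simp add: global_module_def)
qed

lemma gmod_module: "gmod X \<Longrightarrow> module R X"
  by (simp add: global_module_def)

lemma linear_action_bilin:
  assumes "module R M" "\<pi> \<in> linear_maps R H (End_algebra R M)"
  shows "bilin R H M M \<pi>"
proof (rule bilinI[OF hopf_module assms(1) assms(1)])
  show "lin R M M (\<lambda>x. \<pi> h x)" if "h \<in> carrier H" for h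
    using assms that by (auto simp: linear_maps_def End_algebra_def map_space_def intro!: Lin_lin)
  show "lin R H M (\<lambda>h. \<pi> h x)" if "x \<in> carrier M" for x
    using assms that
    by (auto simp: linear_maps_def End_algebra_def map_space_def Lin_def hopf_module intro!: linI)
qed

lemma act_bilin: "gmod X \<Longrightarrow> bilin R H X X (act X)"
  by (simp add: global_module_def linear_action_bilin)

lemma act_closed: "gmod X \<Longrightarrow> h \<in> carrier H \<Longrightarrow> x \<in> carrier X \<Longrightarrow> act X h x \<in> carrier X"
  by (rule bilin_closed[OF act_bilin])

lemma act_mult:
  "gmod X \<Longrightarrow> h \<in> carrier H \<Longrightarrow> l \<in> carrier H \<Longrightarrow> x \<in> carrier X \<Longrightarrow> act X (h \<otimes>\<^bsub>H\<^esub> l) x = act X h (act X l x)"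
  by (auto simp: global_module_def ring_hom_def End_algebra_def compose_def)

lemma act_one: "gmod X \<Longrightarrow> x \<in> carrier X \<Longrightarrow> act X \<one>\<^bsub>H\<^esub> x = x"
  by (auto simp: global_module_def ring_hom_def End_algebra_def)

lemma module_maps_id:
  assumes "module R X" "\<And>h x. h \<in> carrier H \<Longrightarrow> x \<in> carrier X \<Longrightarrow> act X h x \<in> carrier X"
  shows "(\<lambda>x\<in>carrier X. x) \<in> module_maps R H X X"
  using assms by (intro module_mapsI lin_restrict lin_id) auto

text \<open>Equivariance of a linear inverse is automatic: write \<open>y\<close> as
  \<open>f (g y)\<close> and move the action through \<open>f\<close>. Thus the inverses of the
  associator and of the unitors need no Sweedler computation.\<close>

lemma module_maps_inverse:
  assumes "gmod X" "gmod Y" "f \<in> module_maps R H X Y" "lin R Y X g" "g \<in> extensional (carrier Y)"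
    "\<And>x. x \<in> carrier X \<Longrightarrow> g (f x) = x" "\<And>y. y \<in> carrier Y \<Longrightarrow> f (g y) = y"
  shows "g \<in> module_maps R H Y X"
proof (rule module_mapsI[OF assms(4,5)])
  fix h y assume hy: "h \<in> carrier H" "y \<in> carrier Y"
  note gy = lin_closed[OF assms(4) hy(2)]
  have "g (act Y h y) = g (f (act X h (g y)))"
    using module_maps_act[OF assms(3) hy(1) gy] assms(7)[OF hy(2)] by simp
  also have "\<dots> = act X h (g y)" by (rule assms(6)[OF act_closed[OF assms(1) hy(1) gy]])
  finally show "g (act Y h y) = act X h (g y)" .
qed

section \<open>The tensor product of two global modules\<close>

context
  fixes X Y :: "('k, 'h, 'a) umod"
  assumes X: "module R X" and Y: "module R Y"
begin

interpretation XY: tensor_product R X Y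
  by (intro tensor_product.intro X Y)

lemma gten_module: "module R (X \<odot>\<odot> Y)"
  unfolding global_tensor_def Let_def
  by (intro module_with_action module_relabel XY.tensor_module) simp

lemma gten_carrier: "carrier (X \<odot>\<odot> Y) = Formal ` carrier XY.T"
  by (simp add: global_tensor_def relabel_def)

lemma Formal_lin: "lin R XY.T (X \<odot>\<odot> Y) Formal"
  unfolding global_tensor_def Let_def
  by (intro lin_to_with_action lin_relabel(1) XY.tensor_module) simp

lemma unformal_lin: "lin R (X \<odot>\<odot> Y) XY.T unformal"
  unfolding global_tensor_def Let_def
  by (intro lin_from_with_action lin_relabel(2) XY.tensor_module) simp

lemma upure_bilin: "bilin R X Y (X \<odot>\<odot> Y) (upure R X Y)"
  unfolding upure_def[abs_def] by (rule bilin_comp[OF Formal_lin XY.pure_bilin])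

lemma gten_elem: "t \<in> carrier (X \<odot>\<odot> Y) \<Longrightarrow> (x, y) \<in> set (unformal t) \<Longrightarrow> x \<in> carrier X \<and> y \<in> carrier Y"
  by (auto simp: gten_carrier dest: XY.tensor_formal[THEN subsetD])

lemma glift_lin: "bilin R X Y U f \<Longrightarrow> lin R (X \<odot>\<odot> Y) U (\<lambda>t. tsum U f (unformal t))"
  by (rule lin_comp[OF XY.lift_lin unformal_lin])

lemma glift_pure:
  "bilin R X Y U f \<Longrightarrow> x \<in> carrier X \<Longrightarrow> y \<in> carrier Y \<Longrightarrow> tsum U f (unformal (upure R X Y x y)) = f x y"
  by (simp add: upure_def XY.tsum_pure)

lemma gten_ext:
  assumes f: "lin R (X \<odot>\<odot> Y) U f" and g: "lin R (X \<odot>\<odot> Y) U g" and t: "t \<in> carrier (X \<odot>\<odot> Y)"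
    and e: "\<And>x y. x \<in> carrier X \<Longrightarrow> y \<in> carrier Y \<Longrightarrow> f (upure R X Y x y) = g (upure R X Y x y)"
  shows "f t = g t"
proof -
  have "f (Formal (unformal t)) = g (Formal (unformal t))"
    by (rule XY.tensor_ext[OF lin_comp[OF f Formal_lin] lin_comp[OF g Formal_lin] lin_closed[OF unformal_lin t]])
      (use e in \<open>simp add: upure_def\<close>)
  then show ?thesis using t by (auto simp: gten_carrier)
qed

end

lemma gten_act_def:
  "act (X \<odot>\<odot> Y) h = (\<lambda>t\<in>carrier (X \<odot>\<odot> Y).
    tsum (X \<odot>\<odot> Y) (\<lambda>x y. cosum False (X \<odot>\<odot> Y) (\<lambda>a b. upure R X Y (act X a x) (act Y b y)) h) (unformal t))"
  by (simp add: global_tensor_def Let_def cosum_def tsum_def)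

context
  fixes X Y :: "('k, 'h, 'a) umod"
  assumes X: "gmod X" and Y: "gmod Y"
begin

lemmas modX = gmod_module[OF X] and modY = gmod_module[OF Y]

lemma gten_act_bilin:
  assumes "h \<in> carrier H"
  shows "bilin R X Y (X \<odot>\<odot> Y) (\<lambda>x y. cosum False (X \<odot>\<odot> Y) (\<lambda>a b. upure R X Y (act X a x) (act Y b y)) h)"
  using assms
  by (intro bilinI modX modY gten_module cosum_linI)
    (auto intro!: bilin_left[OF upure_bilin[OF modX modY]] bilin_right[OF upure_bilin[OF modX modY]] act_closed X Y
      bilin_right_lin[OF act_bilin])

lemma upure_closed: "x \<in> carrier X \<Longrightarrow> y \<in> carrier Y \<Longrightarrow> upure R X Y x y \<in> carrier (X \<odot>\<odot> Y)"
  by (rule bilin_closed[OF upure_bilin[OF modX modY]])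

lemma gten_act:
  "h \<in> carrier H \<Longrightarrow> x \<in> carrier X \<Longrightarrow> y \<in> carrier Y \<Longrightarrow>
   act (X \<odot>\<odot> Y) h (upure R X Y x y) = cosum False (X \<odot>\<odot> Y) (\<lambda>a b. upure R X Y (act X a x) (act Y b y)) h"
  by (simp add: gten_act_def glift_pure[OF modX modY] gten_act_bilin upure_closed)

text \<open>Bilinearity in the two legs of \<open>h\<close> makes the diagonal action linear in
  \<open>h\<close>; \<open>gten_act_bilin\<close>, in the two vectors, makes it well defined on
  tensors.\<close>

lemma act_act_bilin:
  assumes "x \<in> carrier X" "y \<in> carrier Y"
  shows "bilin R H H (X \<odot>\<odot> Y) (\<lambda>a b. upure R X Y (act X a x) (act Y b y))"
  using assms
  by (intro bilinI hopf_module gten_module modX modY)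
    (auto intro!: bilin_left[OF upure_bilin[OF modX modY]] bilin_right[OF upure_bilin[OF modX modY]] act_closed X Y
      bilin_left_lin[OF act_bilin])

lemma gten_act_lin: "h \<in> carrier H \<Longrightarrow> lin R (X \<odot>\<odot> Y) (X \<odot>\<odot> Y) (act (X \<odot>\<odot> Y) h)"
  unfolding gten_act_def by (intro lin_restrict glift_lin[OF modX modY] gten_act_bilin)

lemma gten_gmod: "gmod (X \<odot>\<odot> Y)"
proof (rule global_moduleI)
  let ?T = "X \<odot>\<odot> Y" and ?p = "upure R X Y"
  show m: "module R ?T" by (rule gten_module[OF modX modY])
  note ext = gten_ext[OF modX modY]
  show "bilin R H ?T ?T (act ?T)"
  proof (rule bilinI[OF hopf_module m m gten_act_lin])
    fix t assume t: "t \<in> carrier ?T"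
    show "lin R H ?T (\<lambda>h. act ?T h t)"
      unfolding gten_act_def restrict_apply'[OF t]
      by (intro lin_tsumI[OF hopf_module m] cosum_lin act_act_bilin)
        (use gten_elem[OF modX modY t] in auto)
  qed
  show "act ?T h \<in> extensional (carrier ?T)" for h by (simp add: gten_act_def)
  show "act ?T (h \<otimes>\<^bsub>H\<^esub> l) t = act ?T h (act ?T l t)"
    if h: "h \<in> carrier H" and l: "l \<in> carrier H" and t: "t \<in> carrier ?T" for h l t
  proof (rule ext[OF gten_act_lin lin_comp[OF gten_act_lin gten_act_lin] t])
    fix x y assume xy: "x \<in> carrier X" "y \<in> carrier Y"
    have "act ?T h (act ?T l (?p x y)) = act ?T h (cosum False ?T (\<lambda>c d. ?p (act X c x) (act Y d y)) l)"
      by (simp add: gten_act l xy)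
    also have "\<dots> = cosum False ?T (\<lambda>c d. act ?T h (?p (act X c x) (act Y d y))) l"
      by (intro lin_cosum[OF gten_act_lin[OF h] l] upure_closed act_closed X Y xy)
    also have "\<dots> = cosum False ?T (\<lambda>c d. cosum False ?T (\<lambda>a b. ?p (act X a (act X c x)) (act Y b (act Y d y))) h) l"
      by (intro cosum_cong l gten_act h act_closed X Y xy)
    \<comment> \<open>With the sum over \<open>h\<close> outside, the double sum is the one into
      which \<open>cosum_mult\<close> splits the comultiplication of a product.\<close>
    also have "\<dots> = cosum False ?T (\<lambda>a b. cosum False ?T (\<lambda>c d. ?p (act X a (act X c x)) (act Y b (act Y d y))) l) h"
      by (intro cosum_exchange m l h upure_closed act_closed X Y xy)
    also have "\<dots> = cosum False ?T (\<lambda>a b. cosum False ?T (\<lambda>c d. ?p (act X (a \<otimes>\<^bsub>H\<^esub> c) x) (act Y (b \<otimes>\<^bsub>H\<^esub> d) y)) l) h"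
      by (intro cosum_cong h l) (simp add: act_mult X Y xy)
    also have "\<dots> = act ?T (h \<otimes>\<^bsub>H\<^esub> l) (?p x y)"
      by (simp add: gten_act h l xy cosum_mult[OF act_act_bilin])
    finally show "act ?T (h \<otimes>\<^bsub>H\<^esub> l) (?p x y) = act ?T h (act ?T l (?p x y))" by simp
  qed (use h l in auto)
  show "act ?T \<one>\<^bsub>H\<^esub> t = t" if t: "t \<in> carrier ?T" for t
    by (rule ext[OF gten_act_lin lin_id[OF m] t])
      (simp_all add: gten_act cosum_one[OF act_act_bilin] act_one X Y)
qed

text \<open>The criterion by which all structural morphisms out of a tensor product are recognised:
  equivariance is an equation of linear maps, so it is enough to check it on pure tensors, where the
  diagonal action is a Sweedler sum.\<close>

lemma glift_module_maps:
  assumes "gmod U" "bilin R X Y U f"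
    "\<And>h x y. h \<in> carrier H \<Longrightarrow> x \<in> carrier X \<Longrightarrow> y \<in> carrier Y \<Longrightarrow>
      cosum False U (\<lambda>a b. f (act X a x) (act Y b y)) h = act U h (f x y)"
  shows "(\<lambda>t\<in>carrier (X \<odot>\<odot> Y). tsum U f (unformal t)) \<in> module_maps R H (X \<odot>\<odot> Y) U"
proof (rule module_mapsI)
  let ?F = "\<lambda>t\<in>carrier (X \<odot>\<odot> Y). tsum U f (unformal t)"
  have F: "?F (upure R X Y x y) = f x y" if "x \<in> carrier X" "y \<in> carrier Y" for x y
    using that by (simp add: upure_closed glift_pure[OF modX modY assms(2)])
  show l: "lin R (X \<odot>\<odot> Y) U ?F" by (intro lin_restrict glift_lin modX modY assms)
  fix h t assume h: "h \<in> carrier H" and t: "t \<in> carrier (X \<odot>\<odot> Y)"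
  show "?F (act (X \<odot>\<odot> Y) h t) = act U h (?F t)"
  proof (rule gten_ext[OF modX modY lin_comp[OF l gten_act_lin[OF h]] lin_comp[OF bilin_right_lin[OF act_bilin h] l] t])
    fix x y assume xy: "x \<in> carrier X" "y \<in> carrier Y"
    have "?F (act (X \<odot>\<odot> Y) h (upure R X Y x y)) = ?F (cosum False (X \<odot>\<odot> Y) (\<lambda>a b. upure R X Y (act X a x) (act Y b y)) h)"
      using gten_act[OF h xy] by simp
    also have "\<dots> = cosum False U (\<lambda>a b. ?F (upure R X Y (act X a x) (act Y b y))) h"
      by (intro lin_cosum[OF l h] upure_closed act_closed X Y xy)
    also have "\<dots> = cosum False U (\<lambda>a b. f (act X a x) (act Y b y)) h"
      by (intro cosum_cong h F act_closed X Y xy)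
    also have "\<dots> = act U h (f x y)" by (rule assms(3)[OF h xy])
    finally show "?F (act (X \<odot>\<odot> Y) h (upure R X Y x y)) = act U h (?F (upure R X Y x y))"
      by (simp only: F[OF xy])
  qed (rule assms)
qed simp

lemma gten_maps_eqI:
  assumes "gmod U" "f \<in> module_maps R H (X \<odot>\<odot> Y) U" "g \<in> module_maps R H (X \<odot>\<odot> Y) U"
    "\<And>x y. x \<in> carrier X \<Longrightarrow> y \<in> carrier Y \<Longrightarrow> f (upure R X Y x y) = g (upure R X Y x y)"
  shows "f = g"
proof (rule module_maps_eqI[OF assms(2,3)])
  note m = gmod_module[OF gten_gmod] gmod_module[OF assms(1)]
  show "f t = g t" if "t \<in> carrier (X \<odot>\<odot> Y)" for t
    by (rule gten_ext[OF modX modY module_maps_lin[OF assms(2) m] module_maps_lin[OF assms(3) m] that assms(4)])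
qed

end

section \<open>The unit object\<close>

abbreviation gunit :: "('k, 'h, 'a) umod"
  where "gunit \<equiv> global_unit R H"

lemma gunit_module: "module R gunit"
  unfolding global_unit_def Let_def
  by (intro module_with_action module_relabel self_module) simp

lemma unscalar_lin: "lin R gunit (self_module R) unscalar"
  unfolding global_unit_def Let_def
  by (intro lin_from_with_action lin_relabel(2) self_module) simp

lemma gunit_carrier: "carrier gunit = Scalar ` carrier R"
  by (simp add: global_unit_def relabel_def)

lemma gunit_smult: "c \<odot>\<^bsub>gunit\<^esub> Scalar d = Scalar (c \<otimes>\<^bsub>R\<^esub> d)"
  by (simp add: global_unit_def relabel_def)

lemma gunit_act: "c \<in> carrier R \<Longrightarrow> act gunit h (Scalar c) = Scalar (counit H h \<otimes>\<^bsub>R\<^esub> c)"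
  by (simp add: global_unit_def relabel_def)

lemma gunit_gmod: "gmod gunit"
proof (rule global_moduleI)
  show m: "module R gunit" by (rule gunit_module)
  show "bilin R H gunit gunit (act gunit)"
  proof (rule bilin_cong)
    show "bilin R H gunit gunit (\<lambda>h x. counit H h \<odot>\<^bsub>gunit\<^esub> x)"
      by (intro bilinI hopf_module m lin_smultI lin_id counit_closed bilin_left[OF bilin_smult[OF m]] counit_lin)
    show "counit H h \<odot>\<^bsub>gunit\<^esub> x = act gunit h x" if "x \<in> carrier gunit" for h x
      using that by (auto simp: gunit_carrier gunit_smult gunit_act)
  qed
  show "act gunit h \<in> extensional (carrier gunit)" for h
    by (simp add: global_unit_def Let_def)
  show "act gunit (h \<otimes>\<^bsub>H\<^esub> l) x = act gunit h (act gunit l x)"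
    if "h \<in> carrier H" "l \<in> carrier H" "x \<in> carrier gunit" for h l x
    using that by (auto simp: gunit_carrier gunit_act counit_mult counit_closed R.m_assoc)
  show "act gunit \<one>\<^bsub>H\<^esub> x = x" if "x \<in> carrier gunit" for x
    using that by (auto simp: gunit_carrier gunit_act counit_one)
qed

end

section \<open>The monoidal category of global modules\<close>

context hopf_algebra
begin

interpretation R: field R by (rule field)

interpretation H: ring H
  using algebra by (simp add: k_algebra_def)

abbreviation hmod_cat :: "(('k, 'h, 'a) umod, ('k, 'a) univ \<Rightarrow> ('k, 'a) univ) moncat"
  where "hmod_cat \<equiv> HMod R H"

abbreviation gmaps :: "('k, 'h, 'm) hmod \<Rightarrow> ('k, 'h, 'n) hmod \<Rightarrow> ('m \<Rightarrow> 'n) set"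
  where "gmaps \<equiv> module_maps R H"

lemma HMod_simps:
  "objects hmod_cat = {X. gmod X}" "arrows hmod_cat = gmaps"
  "identity hmod_cat = (\<lambda>X. \<lambda>x\<in>carrier X. x)"
  "composition hmod_cat = (\<lambda>X Y Z g f. compose (carrier X) g f)"
  "tensor_ob hmod_cat = gten" "unit_ob hmod_cat = gunit"
  by (simp_all add: HMod_def)

lemma gmaps_lin: "f \<in> gmaps X Y \<Longrightarrow> gmod X \<Longrightarrow> gmod Y \<Longrightarrow> lin R X Y f"
  by (simp add: module_maps_lin gmod_module)

lemma gmaps_compose: "gmod X \<Longrightarrow> f \<in> gmaps X Y \<Longrightarrow> g \<in> gmaps Y Z \<Longrightarrow> compose (carrier X) g f \<in> gmaps X Z"
  by (rule module_maps_compose) (auto simp: gmod_module act_closed)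

lemma gmaps_id: "gmod X \<Longrightarrow> (\<lambda>x\<in>carrier X. x) \<in> gmaps X X"
  by (rule module_maps_id) (auto simp: gmod_module act_closed)

lemma HMod_category: "category hmod_cat"
proof (rule category.intro)
  fix W X Y Z :: "('k, 'h, 'a) umod" and f g h
  assume "f \<in> arrows hmod_cat W X"
  then show "composition hmod_cat W W X f (identity hmod_cat W) = f"
    "composition hmod_cat W X X (identity hmod_cat X) f = f"
    by (auto simp: HMod_simps compose_def module_maps_closed
        intro!: extensionalityI[OF restrict_extensional module_maps_extensional])
next
  fix W X Y Z :: "('k, 'h, 'a) umod" and f g h
  assume "f \<in> arrows hmod_cat W X" "g \<in> arrows hmod_cat X Y" "h \<in> arrows hmod_cat Y Z"
  then show "composition hmod_cat W X Z (composition hmod_cat X Y Z h g) f =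
    composition hmod_cat W Y Z h (composition hmod_cat W X Y g f)"
    by (auto simp: HMod_simps compose_def module_maps_closed fun_eq_iff)
qed (auto simp: HMod_simps gmaps_id gmaps_compose)

section \<open>Maps out of iterated tensor products\<close>

context
  fixes X Y Z :: "('k, 'h, 'a) umod" and U :: "('k, 'h, 'a) umod"
  assumes X: "gmod X" and Y: "gmod Y" and Z: "gmod Z" and U: "gmod U"
begin

lemmas mods = gmod_module[OF X] gmod_module[OF Y] gmod_module[OF Z] gmod_module[OF U]
lemmas XY = gten_gmod[OF X Y] and YZ = gten_gmod[OF Y Z]

text \<open>An element of \<open>X \<odot>\<odot> Y\<close> need not be pure, so the test on pure
  tensors is done twice: first for the outer product, then, with \<open>z\<close> fixed, for the
  first factor.\<close>

lemma gten_left_maps_eqI: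
  assumes "f \<in> gmaps ((X \<odot>\<odot> Y) \<odot>\<odot> Z) U" "g \<in> gmaps ((X \<odot>\<odot> Y) \<odot>\<odot> Z) U"
    "\<And>x y z. x \<in> carrier X \<Longrightarrow> y \<in> carrier Y \<Longrightarrow> z \<in> carrier Z \<Longrightarrow>
      f (upure R (X \<odot>\<odot> Y) Z (upure R X Y x y) z) = g (upure R (X \<odot>\<odot> Y) Z (upure R X Y x y) z)"
  shows "f = g"
proof (rule gten_maps_eqI[OF XY Z U assms(1,2)])
  fix p z assume p: "p \<in> carrier (X \<odot>\<odot> Y)" and z: "z \<in> carrier Z"
  have l: "lin R (X \<odot>\<odot> Y) U (\<lambda>p. k (upure R (X \<odot>\<odot> Y) Z p z))" if "k \<in> gmaps ((X \<odot>\<odot> Y) \<odot>\<odot> Z) U" for k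
    by (rule lin_comp[OF gmaps_lin[OF that gten_gmod[OF XY Z] U]
          bilin_left_lin[OF upure_bilin[OF gmod_module[OF XY] mods(3)] z]])
  show "f (upure R (X \<odot>\<odot> Y) Z p z) = g (upure R (X \<odot>\<odot> Y) Z p z)"
    by (rule gten_ext[OF mods(1,2) l[OF assms(1)] l[OF assms(2)] p]) (rule assms(3)[OF _ _ z])
qed

text \<open>First stage of the lift of a trilinear map to a bracketed triple product: the associator
  is built from this lemma, its inverse from \<open>trilin_lift_right\<close>.\<close>

lemma trilin_lift_left:
  assumes "trilin R X Y Z U A"
  shows "bilin R (X \<odot>\<odot> Y) Z U (\<lambda>p z. tsum U (\<lambda>x y. A x y z) (unformal p))"
proof (rule bilinI[OF gmod_module[OF XY] mods(3,4)])
  show "lin R (X \<odot>\<odot> Y) U (\<lambda>p. tsum U (\<lambda>x y. A x y z) (unformal p))" if "z \<in> carrier Z" for z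
    by (rule glift_lin[OF mods(1,2) trilin_bilin(2)[OF assms that]])
  show "lin R Z U (\<lambda>z. tsum U (\<lambda>x y. A x y z) (unformal p))" if p: "p \<in> carrier (X \<odot>\<odot> Y)" for p
  proof (rule lin_tsumI[OF mods(3,4)])
    fix x y assume "(x, y) \<in> set (unformal p)"
    then have xy: "x \<in> carrier X" "y \<in> carrier Y" using gten_elem[OF mods(1,2) p] by auto
    show "lin R Z U (\<lambda>z. A x y z)" by (rule bilin_right_lin[OF trilin_bilin(1)[OF assms xy(1)] xy(2)])
  qed
qed

lemma trilin_lift_right:
  assumes "trilin R X Y Z U A"
  shows "bilin R X (Y \<odot>\<odot> Z) U (\<lambda>x q. tsum U (A x) (unformal q))"
proof (rule bilinI[OF mods(1) gmod_module[OF YZ] mods(4)])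
  show "lin R (Y \<odot>\<odot> Z) U (\<lambda>q. tsum U (A x) (unformal q))" if "x \<in> carrier X" for x
    by (rule glift_lin[OF mods(2,3) trilin_bilin(1)[OF assms that]])
  show "lin R X U (\<lambda>x. tsum U (A x) (unformal q))" if q: "q \<in> carrier (Y \<odot>\<odot> Z)" for q
  proof (rule lin_tsumI[OF mods(1,4)])
    fix y z assume "(y, z) \<in> set (unformal q)"
    then have yz: "y \<in> carrier Y" "z \<in> carrier Z" using gten_elem[OF mods(2,3) q] by auto
    show "lin R X U (\<lambda>x. A x y z)" by (rule bilin_left_lin[OF trilin_bilin(2)[OF assms yz(2)] yz(1)])
  qed
qed

end

text \<open>The bracketing is that of the common source of the two sides of the pentagon.\<close>

lemma gten_left4_maps_eqI:
  fixes W X Y Z U :: "('k, 'h, 'a) umod"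
  assumes W: "gmod W" and X: "gmod X" and Y: "gmod Y" and Z: "gmod Z" and U: "gmod U"
    and f: "f \<in> gmaps (((W \<odot>\<odot> X) \<odot>\<odot> Y) \<odot>\<odot> Z) U" and g: "g \<in> gmaps (((W \<odot>\<odot> X) \<odot>\<odot> Y) \<odot>\<odot> Z) U"
    and e: "\<And>w x y z. w \<in> carrier W \<Longrightarrow> x \<in> carrier X \<Longrightarrow> y \<in> carrier Y \<Longrightarrow> z \<in> carrier Z \<Longrightarrow>
      f (upure R ((W \<odot>\<odot> X) \<odot>\<odot> Y) Z (upure R (W \<odot>\<odot> X) Y (upure R W X w x) y) z) =
      g (upure R ((W \<odot>\<odot> X) \<odot>\<odot> Y) Z (upure R (W \<odot>\<odot> X) Y (upure R W X w x) y) z)"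
  shows "f = g"
proof (rule gten_left_maps_eqI[OF gten_gmod[OF W X] Y Z U f g])
  fix p y z assume p: "p \<in> carrier (W \<odot>\<odot> X)" and y: "y \<in> carrier Y" and z: "z \<in> carrier Z"
  note WX = gten_gmod[OF W X]
  note WXY = gten_gmod[OF WX Y]
  note m = gmod_module
  have l: "lin R (W \<odot>\<odot> X) U (\<lambda>p. k (upure R ((W \<odot>\<odot> X) \<odot>\<odot> Y) Z (upure R (W \<odot>\<odot> X) Y p y) z))"
    if "k \<in> gmaps (((W \<odot>\<odot> X) \<odot>\<odot> Y) \<odot>\<odot> Z) U" for k
    by (rule lin_comp[OF gmaps_lin[OF that gten_gmod[OF WXY Z] U]
          bilin_left[OF upure_bilin[OF m[OF WXY] m[OF Z]] z bilin_left_lin[OF upure_bilin[OF m[OF WX] m[OF Y]] y]]])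
  show "f (upure R ((W \<odot>\<odot> X) \<odot>\<odot> Y) Z (upure R (W \<odot>\<odot> X) Y p y) z) =
      g (upure R ((W \<odot>\<odot> X) \<odot>\<odot> Y) Z (upure R (W \<odot>\<odot> X) Y p y) z)"
    by (rule gten_ext[OF m[OF W] m[OF X] l[OF f] l[OF g] p]) (rule e[OF _ _ y z])
qed

section \<open>The tensor product of morphisms\<close>

abbreviation "gtar \<equiv> tensor_ar hmod_cat"

context
  fixes X X' Y Y' :: "('k, 'h, 'a) umod" and f g
  assumes X: "gmod X" and X': "gmod X'" and Y: "gmod Y" and Y': "gmod Y'"
    and f: "f \<in> gmaps X X'" and g: "g \<in> gmaps Y Y'"
begin

lemma gtar_bilin: "bilin R X Y (X' \<odot>\<odot> Y') (\<lambda>x y. upure R X' Y' (f x) (g y))"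
proof (rule bilinI[OF gmod_module[OF X] gmod_module[OF Y] gmod_module[OF gten_gmod[OF X' Y']]])
  note b = upure_bilin[OF gmod_module[OF X'] gmod_module[OF Y']]
  show "lin R Y (X' \<odot>\<odot> Y') (\<lambda>y. upure R X' Y' (f x) (g y))" if "x \<in> carrier X" for x
    by (rule bilin_right[OF b module_maps_closed[OF f that] gmaps_lin[OF g Y Y']])
  show "lin R X (X' \<odot>\<odot> Y') (\<lambda>x. upure R X' Y' (f x) (g y))" if "y \<in> carrier Y" for y
    by (rule bilin_left[OF b module_maps_closed[OF g that] gmaps_lin[OF f X X']])
qed

lemma gtar_def:
  "gtar X X' Y Y' f g = (\<lambda>t\<in>carrier (X \<odot>\<odot> Y). tsum (X' \<odot>\<odot> Y') (\<lambda>x y. upure R X' Y' (f x) (g y)) (unformal t))"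
  by (simp add: HMod_def tsum_def)

lemma gtar_maps: "gtar X X' Y Y' f g \<in> gmaps (X \<odot>\<odot> Y) (X' \<odot>\<odot> Y')"
  unfolding gtar_def
proof (rule glift_module_maps[OF X Y gten_gmod[OF X' Y'] gtar_bilin])
  fix h x y assume h: "h \<in> carrier H" and xy: "x \<in> carrier X" "y \<in> carrier Y"
  have "cosum False (X' \<odot>\<odot> Y') (\<lambda>a b. upure R X' Y' (f (act X a x)) (g (act Y b y))) h =
    cosum False (X' \<odot>\<odot> Y') (\<lambda>a b. upure R X' Y' (act X' a (f x)) (act Y' b (g y))) h"
    using xy by (intro cosum_cong h) (simp add: module_maps_act[OF f] module_maps_act[OF g])
  also have "\<dots> = act (X' \<odot>\<odot> Y') h (upure R X' Y' (f x) (g y))"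
    using xy by (intro gten_act[symmetric] X' Y' h) (auto intro: module_maps_closed[OF f] module_maps_closed[OF g])
  finally show "cosum False (X' \<odot>\<odot> Y') (\<lambda>a b. upure R X' Y' (f (act X a x)) (g (act Y b y))) h =
    act (X' \<odot>\<odot> Y') h (upure R X' Y' (f x) (g y))" .
qed

lemma gtar_pure:
  "x \<in> carrier X \<Longrightarrow> y \<in> carrier Y \<Longrightarrow> gtar X X' Y Y' f g (upure R X Y x y) = upure R X' Y' (f x) (g y)"
  by (simp add: gtar_def upure_closed X Y glift_pure[OF gmod_module[OF X] gmod_module[OF Y] gtar_bilin])

end

section \<open>The associator\<close>

abbreviation "gasc \<equiv> associator hmod_cat"

context
  fixes X Y Z :: "('k, 'h, 'a) umod"
  assumes X: "gmod X" and Y: "gmod Y" and Z: "gmod Z"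
begin

lemmas mXYZ = gmod_module[OF X] gmod_module[OF Y] gmod_module[OF Z]
lemmas gXY = gten_gmod[OF X Y] and gYZ = gten_gmod[OF Y Z]
lemmas gl = gten_gmod[OF gXY Z] and gr = gten_gmod[OF X gYZ]
lemmas bX_YZ = upure_bilin[OF mXYZ(1) gmod_module[OF gYZ]] and bXY_Z = upure_bilin[OF gmod_module[OF gXY] mXYZ(3)]
  and bXY = upure_bilin[OF mXYZ(1,2)] and bYZ = upure_bilin[OF mXYZ(2,3)]

lemma right_trilin: "trilin R X Y Z (X \<odot>\<odot> (Y \<odot>\<odot> Z)) (\<lambda>x y z. upure R X (Y \<odot>\<odot> Z) x (upure R Y Z y z))"
  by (intro trilinI mXYZ gmod_module gr bilin_left_lin[OF bX_YZ] bilin_right[OF bX_YZ] bilin_left_lin[OF bYZ]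
      bilin_right_lin[OF bYZ] bilin_closed[OF bYZ])

lemma left_trilin: "trilin R X Y Z ((X \<odot>\<odot> Y) \<odot>\<odot> Z) (\<lambda>x y z. upure R (X \<odot>\<odot> Y) Z (upure R X Y x y) z)"
  by (intro trilinI mXYZ gmod_module gl bilin_right_lin[OF bXY_Z] bilin_left[OF bXY_Z] bilin_left_lin[OF bXY]
      bilin_right_lin[OF bXY] bilin_closed[OF bXY])

lemma gasc_def:
  "gasc X Y Z = (\<lambda>t\<in>carrier ((X \<odot>\<odot> Y) \<odot>\<odot> Z). tsum (X \<odot>\<odot> (Y \<odot>\<odot> Z)) (\<lambda>p z.
     tsum (X \<odot>\<odot> (Y \<odot>\<odot> Z)) (\<lambda>x y. upure R X (Y \<odot>\<odot> Z) x (upure R Y Z y z)) (unformal p)) (unformal t))"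
  by (simp add: HMod_def Let_def tsum_def)

lemmas gasc_bilin = trilin_lift_left[OF X Y Z gr right_trilin]

lemma gasc_pure:
  assumes "x \<in> carrier X" "y \<in> carrier Y" "z \<in> carrier Z"
  shows "gasc X Y Z (upure R (X \<odot>\<odot> Y) Z (upure R X Y x y) z) = upure R X (Y \<odot>\<odot> Z) x (upure R Y Z y z)"
  using assms
  by (simp add: gasc_def upure_closed gXY X Y Z glift_pure[OF gmod_module[OF gXY] mXYZ(3) gasc_bilin]
      glift_pure[OF mXYZ(1,2) trilin_bilin(2)[OF right_trilin]])

text \<open>Makes a trilinear map on the modules a trilinear map on \<open>H\<close>, the form that
  \<open>cosum_coassoc\<close> requires.\<close>

lemma trilin_act:
  assumes "trilin R X Y Z U A" "x \<in> carrier X" "y \<in> carrier Y" "z \<in> carrier Z"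
  shows "trilin R H H H U (\<lambda>a b c. A (act X a x) (act Y b y) (act Z c z))"
proof -
  note t1 = trilin_bilin(1)[OF assms(1)] and t2 = trilin_bilin(2)[OF assms(1)]
  have U: "module R U" using bilin_modules(3)[OF t1[OF assms(2)]] .
  show ?thesis
    by (intro trilinI hopf_module U bilin_left[OF t2] bilin_right[OF t1] bilin_left[OF t1]
      act_closed X Y Z assms(2-4) bilin_left_lin[OF act_bilin])
qed

text \<open>On one bracketing \<open>H\<close> acts through the iterated comultiplication that
  splits the first leg, on the other through the one that splits the second leg; equivariance of the
  associator is therefore coassociativity.\<close>

lemma gasc_maps: "gasc X Y Z \<in> gmaps ((X \<odot>\<odot> Y) \<odot>\<odot> Z) (X \<odot>\<odot> (Y \<odot>\<odot> Z))"
  unfolding gasc_def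
proof (rule glift_module_maps[OF gXY Z gr gasc_bilin])
  let ?T = "X \<odot>\<odot> (Y \<odot>\<odot> Z)"
  let ?p = "\<lambda>x y z. upure R X (Y \<odot>\<odot> Z) x (upure R Y Z y z)"
  \<comment> \<open>Opaque name for the inner lift: its linearity reduces the arbitrary
    \<open>q\<close> to a pure tensor, and only then is it evaluated.\<close>
  define F where "F = (\<lambda>p z. tsum ?T (\<lambda>x y. ?p x y z) (unformal p))"
  have F: "bilin R (X \<odot>\<odot> Y) Z ?T F" unfolding F_def by (rule gasc_bilin)
  have Fp: "F (upure R X Y x y) z = ?p x y z" if "x \<in> carrier X" "y \<in> carrier Y" "z \<in> carrier Z" for x y z
    unfolding F_def using that by (simp add: glift_pure[OF mXYZ(1,2) trilin_bilin(2)[OF right_trilin]])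
  fix h q z assume h: "h \<in> carrier H" and q: "q \<in> carrier (X \<odot>\<odot> Y)" and z: "z \<in> carrier Z"
  have "cosum False ?T (\<lambda>a b. F (act (X \<odot>\<odot> Y) a q) (act Z b z)) h = act ?T h (F q z)"
  proof (rule gten_ext[OF mXYZ(1,2) _ _ q])
    show "lin R (X \<odot>\<odot> Y) ?T (\<lambda>q. cosum False ?T (\<lambda>a b. F (act (X \<odot>\<odot> Y) a q) (act Z b z)) h)"
      by (intro cosum_linI gmod_module gXY gr h bilin_left[OF F] act_closed Z z bilin_right_lin[OF act_bilin])
    show "lin R (X \<odot>\<odot> Y) ?T (\<lambda>q. act ?T h (F q z))"
      by (rule bilin_right[OF act_bilin[OF gr] h bilin_left_lin[OF F z]])
    fix x y assume x: "x \<in> carrier X" and y: "y \<in> carrier Y"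
    note c = act_closed[OF X _ x] act_closed[OF Y _ y] act_closed[OF Z _ z]
    have "cosum False ?T (\<lambda>a b. F (act (X \<odot>\<odot> Y) a (upure R X Y x y)) (act Z b z)) h =
      cosum False ?T (\<lambda>a b. cosum False ?T (\<lambda>a' a''. ?p (act X a' x) (act Y a'' y) (act Z b z)) a) h"
    proof (intro cosum_cong h)
      fix a b assume ab: "a \<in> carrier H" "b \<in> carrier H"
      have "F (act (X \<odot>\<odot> Y) a (upure R X Y x y)) (act Z b z) =
        F (cosum False (X \<odot>\<odot> Y) (\<lambda>a' a''. upure R X Y (act X a' x) (act Y a'' y)) a) (act Z b z)"
        by (simp add: gten_act X Y ab x y)
      also have "\<dots> = cosum False ?T (\<lambda>a' a''. F (upure R X Y (act X a' x) (act Y a'' y)) (act Z b z)) a"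
        by (rule lin_cosum[OF bilin_left_lin[OF F c(3)[OF ab(2)]] ab(1)]) (intro upure_closed X Y c)
      also have "\<dots> = cosum False ?T (\<lambda>a' a''. ?p (act X a' x) (act Y a'' y) (act Z b z)) a"
        by (intro cosum_cong ab Fp c)
      finally show "F (act (X \<odot>\<odot> Y) a (upure R X Y x y)) (act Z b z) =
        cosum False ?T (\<lambda>a' a''. ?p (act X a' x) (act Y a'' y) (act Z b z)) a" .
    qed
    also have "\<dots> = cosum False ?T (\<lambda>a b. cosum False ?T (\<lambda>b' b''. ?p (act X a x) (act Y b' y) (act Z b'' z)) b) h"
      by (rule cosum_coassoc[OF trilin_act[OF right_trilin x y z] h])
    also have "\<dots> = cosum False ?T (\<lambda>a b. upure R X (Y \<odot>\<odot> Z) (act X a x) (act (Y \<odot>\<odot> Z) b (upure R Y Z y z))) h"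
    proof (intro cosum_cong h)
      fix a b assume ab: "a \<in> carrier H" "b \<in> carrier H"
      have "upure R X (Y \<odot>\<odot> Z) (act X a x) (act (Y \<odot>\<odot> Z) b (upure R Y Z y z)) =
        upure R X (Y \<odot>\<odot> Z) (act X a x) (cosum False (Y \<odot>\<odot> Z) (\<lambda>b' b''. upure R Y Z (act Y b' y) (act Z b'' z)) b)"
        by (simp add: gten_act Y Z ab y z)
      also have "\<dots> = cosum False ?T (\<lambda>b' b''. ?p (act X a x) (act Y b' y) (act Z b'' z)) b"
        by (rule lin_cosum[OF bilin_right_lin[OF bX_YZ c(1)[OF ab(1)]] ab(2)]) (intro upure_closed Y Z c)
      finally show "cosum False ?T (\<lambda>b' b''. ?p (act X a x) (act Y b' y) (act Z b'' z)) b =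
        upure R X (Y \<odot>\<odot> Z) (act X a x) (act (Y \<odot>\<odot> Z) b (upure R Y Z y z))" by simp
    qed
    also have "\<dots> = act ?T h (?p x y z)"
      by (intro gten_act[symmetric] X gYZ h x upure_closed Y Z y z)
    finally show "cosum False ?T (\<lambda>a b. F (act (X \<odot>\<odot> Y) a (upure R X Y x y)) (act Z b z)) h =
      act ?T h (F (upure R X Y x y) z)" by (simp add: Fp x y z)
  qed
  then show "cosum False ?T (\<lambda>a b. tsum ?T (\<lambda>x y. ?p x y (act Z b z)) (unformal (act (X \<odot>\<odot> Y) a q))) h =
    act ?T h (tsum ?T (\<lambda>x y. ?p x y z) (unformal q))"
    by (simp add: F_def)
qed

lemma gasc_iso: "iso_arrow hmod_cat ((X \<odot>\<odot> Y) \<odot>\<odot> Z) (X \<odot>\<odot> (Y \<odot>\<odot> Z)) (gasc X Y Z)"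
proof -
  let ?L = "(X \<odot>\<odot> Y) \<odot>\<odot> Z" and ?T = "X \<odot>\<odot> (Y \<odot>\<odot> Z)"
  let ?f = "\<lambda>x q. tsum ?L (\<lambda>y z. upure R (X \<odot>\<odot> Y) Z (upure R X Y x y) z) (unformal q)"
  \<comment> \<open>The mirror image of the associator, lifted from the right-bracketed
    product.\<close>
  define g where "g = (\<lambda>t\<in>carrier ?T. tsum ?L ?f (unformal t))"
  note b = trilin_lift_right[OF X Y Z gl left_trilin]
  have gp: "g (upure R X (Y \<odot>\<odot> Z) x (upure R Y Z y z)) = upure R (X \<odot>\<odot> Y) Z (upure R X Y x y) z"
    if "x \<in> carrier X" "y \<in> carrier Y" "z \<in> carrier Z" for x y z
    using that
    by (simp add: g_def upure_closed gYZ X Y Z glift_pure[OF mXYZ(1) gmod_module[OF gYZ] b]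
      glift_pure[OF mXYZ(2,3) trilin_bilin(1)[OF left_trilin]])
  have gl': "lin R ?T ?L g" unfolding g_def
    by (intro lin_restrict glift_lin[OF mXYZ(1) gmod_module[OF gYZ] b])
  have al: "lin R ?L ?T (gasc X Y Z)" by (rule gmaps_lin[OF gasc_maps gl gr])
  have 1: "g (gasc X Y Z t) = t" if t: "t \<in> carrier ?L" for t
  proof (rule gten_ext[OF gmod_module[OF gXY] mXYZ(3) lin_comp[OF gl' al] lin_id[OF gmod_module[OF gl]] t])
    fix p z assume p: "p \<in> carrier (X \<odot>\<odot> Y)" and z: "z \<in> carrier Z"
    show "g (gasc X Y Z (upure R (X \<odot>\<odot> Y) Z p z)) = upure R (X \<odot>\<odot> Y) Z p z"
      by (rule gten_ext[OF mXYZ(1,2) lin_comp[OF lin_comp[OF gl' al] bilin_left_lin[OF bXY_Z z]]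
            bilin_left_lin[OF bXY_Z z] p])
        (simp add: gasc_pure gp z)
  qed
  have 2: "gasc X Y Z (g t) = t" if t: "t \<in> carrier ?T" for t
  proof (rule gten_ext[OF mXYZ(1) gmod_module[OF gYZ] lin_comp[OF al gl'] lin_id[OF gmod_module[OF gr]] t])
    fix x q assume x: "x \<in> carrier X" and q: "q \<in> carrier (Y \<odot>\<odot> Z)"
    show "gasc X Y Z (g (upure R X (Y \<odot>\<odot> Z) x q)) = upure R X (Y \<odot>\<odot> Z) x q"
      by (rule gten_ext[OF mXYZ(2,3) lin_comp[OF lin_comp[OF al gl'] bilin_right_lin[OF bX_YZ x]]
            bilin_right_lin[OF bX_YZ x] q])
        (simp add: gasc_pure gp x)
  qed
  have "g \<in> gmaps ?T ?L"
    by (rule module_maps_inverse[OF gl gr gasc_maps gl' _ 1 2]) (unfold g_def, rule restrict_extensional)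
  then show ?thesis
    using gasc_maps 1 2 unfolding iso_arrow_def inverse_arrows_def
    by (intro exI[of _ g]) (auto simp: HMod_simps compose_def fun_eq_iff)
qed

end

section \<open>The unitors\<close>

abbreviation "glun \<equiv> left_unitor hmod_cat"

abbreviation "grun \<equiv> right_unitor hmod_cat"

abbreviation "uone \<equiv> Scalar \<one>\<^bsub>R\<^esub>"

lemma gunit_one: "uone \<in> carrier gunit"
  by (simp add: gunit_carrier)

lemma unscalar_closed: "c \<in> carrier gunit \<Longrightarrow> unscalar c \<in> carrier R"
  by (auto simp: gunit_carrier)

lemma gunit_eq: "c \<in> carrier gunit \<Longrightarrow> c = unscalar c \<odot>\<^bsub>gunit\<^esub> uone"
  by (auto simp: gunit_carrier gunit_smult)

text \<open>The unit object is spanned by \<open>uone\<close>, so linearity suffices.\<close>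

lemma gunit_maps_eqI:
  fixes f g :: "('k, 'a) univ \<Rightarrow> 'm"
  assumes "gmod X" "f \<in> gmaps gunit X" "g \<in> gmaps gunit X" "f uone = g uone"
  shows "f = g"
proof (rule module_maps_eqI[OF assms(2,3)])
  fix c :: "('k, 'a) univ" assume c: "c \<in> carrier gunit"
  have "k c = unscalar c \<odot>\<^bsub>X\<^esub> k uone" if "k \<in> gmaps gunit X" for k :: "('k, 'a) univ \<Rightarrow> 'm"
    by (subst gunit_eq[OF c]) (rule lin_smult[OF gmaps_lin[OF that gunit_gmod assms(1)] unscalar_closed[OF c] gunit_one])
  from this[OF assms(2)] this[OF assms(3)] show "f c = g c" by (simp add: assms(4))
qed

context
  fixes X :: "('k, 'h, 'a) umod"
  assumes X: "gmod X"
begin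

interpretation X: module R X by (rule gmod_module[OF X])

lemmas mX = gmod_module[OF X]

lemma unit_action_bilin: "bilin R gunit X X (\<lambda>c x. unscalar c \<odot>\<^bsub>X\<^esub> x)"
  by (intro bilinI gunit_module mX lin_smultI lin_id unscalar_closed bilin_left[OF bilin_smult[OF mX]] unscalar_lin)

lemmas unit_action_bilin' = bilin_swap[OF unit_action_bilin]

lemma glun_def: "glun X = (\<lambda>t\<in>carrier (gunit \<odot>\<odot> X). tsum X (\<lambda>c x. unscalar c \<odot>\<^bsub>X\<^esub> x) (unformal t))"
  by (simp add: HMod_def tsum_def)

lemma grun_def: "grun X = (\<lambda>t\<in>carrier (X \<odot>\<odot> gunit). tsum X (\<lambda>x c. unscalar c \<odot>\<^bsub>X\<^esub> x) (unformal t))"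
  by (simp add: HMod_def tsum_def)

lemma glun_pure: "c \<in> carrier gunit \<Longrightarrow> x \<in> carrier X \<Longrightarrow> glun X (upure R gunit X c x) = unscalar c \<odot>\<^bsub>X\<^esub> x"
  by (simp add: glun_def upure_closed gunit_gmod X glift_pure[OF gunit_module mX unit_action_bilin])

lemma grun_pure: "x \<in> carrier X \<Longrightarrow> c \<in> carrier gunit \<Longrightarrow> grun X (upure R X gunit x c) = unscalar c \<odot>\<^bsub>X\<^esub> x"
  by (simp add: grun_def upure_closed gunit_gmod X glift_pure[OF mX gunit_module unit_action_bilin'])

text \<open>Equivariance of the two unitors: \<open>H\<close> acts on the scalar factor through the
  counit, and a counit law absorbs that leg.\<close>

lemma unit_action_act:
  assumes "h \<in> carrier H" "x \<in> carrier X" "c \<in> carrier gunit"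
  shows "cosum sw X (\<lambda>a b. unscalar (act gunit a c) \<odot>\<^bsub>X\<^esub> act X b x) h = act X h (unscalar c \<odot>\<^bsub>X\<^esub> x)"
    and "cosum sw X (\<lambda>a b. unscalar (act gunit b c) \<odot>\<^bsub>X\<^esub> act X a x) h = act X h (unscalar c \<odot>\<^bsub>X\<^esub> x)"
proof -
  obtain d where d: "c = Scalar d" "d \<in> carrier R" using assms(3) by (auto simp: gunit_carrier)
  have e: "unscalar (act gunit a c) \<odot>\<^bsub>X\<^esub> act X b x = counit H a \<odot>\<^bsub>X\<^esub> (d \<odot>\<^bsub>X\<^esub> act X b x)"
    if "a \<in> carrier H" "b \<in> carrier H" for a b
    using that d assms(2) by (simp add: gunit_act X.smult_assoc1 counit_closed act_closed X)
  have l: "lin R H X (\<lambda>b. d \<odot>\<^bsub>X\<^esub> act X b x)"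
    by (intro lin_smultI d bilin_left_lin[OF act_bilin] X assms)
  have r: "d \<odot>\<^bsub>X\<^esub> act X h x = act X h (unscalar c \<odot>\<^bsub>X\<^esub> x)"
    using lin_smult[OF bilin_right_lin[OF act_bilin[OF X] assms(1)] d(2) assms(2)] d(1) by simp
  have "cosum sw X (\<lambda>a b. unscalar (act gunit a c) \<odot>\<^bsub>X\<^esub> act X b x) h =
    cosum sw X (\<lambda>a b. counit H a \<odot>\<^bsub>X\<^esub> (d \<odot>\<^bsub>X\<^esub> act X b x)) h"
    by (intro cosum_cong assms(1) e)
  then show "cosum sw X (\<lambda>a b. unscalar (act gunit a c) \<odot>\<^bsub>X\<^esub> act X b x) h = act X h (unscalar c \<odot>\<^bsub>X\<^esub> x)"
    using cosum_counit(1)[OF l assms(1)] r by simp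
  have "cosum sw X (\<lambda>a b. unscalar (act gunit b c) \<odot>\<^bsub>X\<^esub> act X a x) h =
    cosum sw X (\<lambda>a b. counit H b \<odot>\<^bsub>X\<^esub> (d \<odot>\<^bsub>X\<^esub> act X a x)) h"
    by (intro cosum_cong assms(1) e)
  then show "cosum sw X (\<lambda>a b. unscalar (act gunit b c) \<odot>\<^bsub>X\<^esub> act X a x) h = act X h (unscalar c \<odot>\<^bsub>X\<^esub> x)"
    using cosum_counit(2)[OF l assms(1)] r by simp
qed

lemma glun_maps: "glun X \<in> gmaps (gunit \<odot>\<odot> X) X"
  unfolding glun_def
  by (rule glift_module_maps[OF gunit_gmod X X unit_action_bilin]) (rule unit_action_act(1))

lemma grun_maps: "grun X \<in> gmaps (X \<odot>\<odot> gunit) X"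
  unfolding grun_def
  by (rule glift_module_maps[OF X gunit_gmod X unit_action_bilin']) (rule unit_action_act(2))

text \<open>The inverse is given explicitly because the composition of \<open>underlying_cat\<close>
  passes through it. That it is inverse amounts to moving the scalar across the tensor sign.
  \<open>grun_inverse\<close> plays this part for the reversed tensor product.\<close>

lemma glun_inverse:
  "inverse_arrows hmod_cat (gunit \<odot>\<odot> X) X (glun X) (\<lambda>x\<in>carrier X. upure R gunit X uone x)"
proof -
  note b = upure_bilin[OF gunit_module mX]
  let ?g = "\<lambda>x\<in>carrier X. upure R gunit X uone x"
  have g: "lin R X (gunit \<odot>\<odot> X) ?g"
    by (intro lin_restrict bilin_right_lin[OF b] gunit_one)
  note l = gmaps_lin[OF glun_maps gten_gmod[OF gunit_gmod X] X]
  have 1: "?g (glun X t) = t" if t: "t \<in> carrier (gunit \<odot>\<odot> X)" for t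
  proof (rule gten_ext[OF gunit_module mX lin_comp[OF g l] lin_id[OF gmod_module[OF gten_gmod[OF gunit_gmod X]]] t])
    fix c x :: "('k, 'a) univ" assume c: "c \<in> carrier gunit" and x: "x \<in> carrier X"
    have "?g (glun X (upure R gunit X c x)) = upure R gunit X uone (unscalar c \<odot>\<^bsub>X\<^esub> x)"
      by (simp add: glun_pure c x unscalar_closed)
    also have "\<dots> = upure R gunit X (unscalar c \<odot>\<^bsub>gunit\<^esub> uone) x"
      using lin_smult[OF bilin_right_lin[OF b gunit_one] unscalar_closed[OF c] x]
        lin_smult[OF bilin_left_lin[OF b x] unscalar_closed[OF c] gunit_one] by simp
    finally show "?g (glun X (upure R gunit X c x)) = upure R gunit X c x"
      by (simp add: gunit_eq[OF c, symmetric])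
  qed
  have 2: "glun X (?g x) = x" if x: "x \<in> carrier X" for x
    by (simp add: x glun_pure gunit_one)
  have "?g \<in> gmaps X (gunit \<odot>\<odot> X)"
    by (rule module_maps_inverse[OF gten_gmod[OF gunit_gmod X] X glun_maps g restrict_extensional 1 2])
  then show ?thesis
    using glun_maps 1 2 unfolding inverse_arrows_def
    by (auto simp: HMod_simps compose_def fun_eq_iff)
qed

lemma grun_inverse:
  "inverse_arrows hmod_cat (X \<odot>\<odot> gunit) X (grun X) (\<lambda>x\<in>carrier X. upure R X gunit x uone)"
proof -
  note b = upure_bilin[OF mX gunit_module]
  let ?g = "\<lambda>x\<in>carrier X. upure R X gunit x uone"
  have g: "lin R X (X \<odot>\<odot> gunit) ?g"
    by (intro lin_restrict bilin_left_lin[OF b] gunit_one)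
  note l = gmaps_lin[OF grun_maps gten_gmod[OF X gunit_gmod] X]
  have 1: "?g (grun X t) = t" if t: "t \<in> carrier (X \<odot>\<odot> gunit)" for t
  proof (rule gten_ext[OF mX gunit_module lin_comp[OF g l] lin_id[OF gmod_module[OF gten_gmod[OF X gunit_gmod]]] t])
    fix c x :: "('k, 'a) univ" assume c: "c \<in> carrier gunit" and x: "x \<in> carrier X"
    have "?g (grun X (upure R X gunit x c)) = upure R X gunit (unscalar c \<odot>\<^bsub>X\<^esub> x) uone"
      by (simp add: grun_pure c x unscalar_closed)
    also have "\<dots> = upure R X gunit x (unscalar c \<odot>\<^bsub>gunit\<^esub> uone)"
      using lin_smult[OF bilin_left_lin[OF b gunit_one] unscalar_closed[OF c] x]
        lin_smult[OF bilin_right_lin[OF b x] unscalar_closed[OF c] gunit_one] by simp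
    finally show "?g (grun X (upure R X gunit x c)) = upure R X gunit x c"
      by (simp add: gunit_eq[OF c, symmetric])
  qed
  have 2: "grun X (?g x) = x" if x: "x \<in> carrier X" for x
    by (simp add: x grun_pure gunit_one)
  have "?g \<in> gmaps X (X \<odot>\<odot> gunit)"
    by (rule module_maps_inverse[OF gten_gmod[OF X gunit_gmod] X grun_maps g restrict_extensional 1 2])
  then show ?thesis
    using grun_maps 1 2 unfolding inverse_arrows_def
    by (auto simp: HMod_simps compose_def fun_eq_iff)
qed

end

section \<open>The monoidal axioms\<close>

lemmas gmod_intros = gten_gmod gunit_gmod
lemmas gmaps_intros = gmaps_compose gmaps_id gtar_maps gasc_maps glun_maps grun_maps
lemmas gmaps_pure = compose_eq upure_closed gtar_pure gasc_pure glun_pure grun_pure module_maps_closed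

text \<open>Every coherence equation compares two morphisms out of an iterated tensor product:
  \<open>gmaps_intros\<close> recognises both sides as morphisms, and \<open>gmaps_pure\<close>
  evaluates them on pure tensors, where they visibly agree.\<close>

lemma HMod_monoidal: "monoidal_category hmod_cat"
proof (intro monoidal_category.intro HMod_category monoidal_category_axioms.intro; unfold HMod_simps mem_Collect_eq)
  show "gmod gunit" by (rule gunit_gmod)
next
  fix X Y :: "('k, 'h, 'a) umod" assume "gmod X" "gmod Y"
  then show "gmod (X \<odot>\<odot> Y)" by (rule gten_gmod)
next
  fix X X' Y Y' :: "('k, 'h, 'a) umod" and f g
  assume "gmod X" "gmod X'" "gmod Y" "gmod Y'" "f \<in> gmaps X X'" "g \<in> gmaps Y Y'"
  then show "gtar X X' Y Y' f g \<in> gmaps (X \<odot>\<odot> Y) (X' \<odot>\<odot> Y')" by (rule gtar_maps)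
next
  fix X Y :: "('k, 'h, 'a) umod" assume XY: "gmod X" "gmod Y"
  show "gtar X X Y Y (\<lambda>x\<in>carrier X. x) (\<lambda>x\<in>carrier Y. x) = (\<lambda>x\<in>carrier (X \<odot>\<odot> Y). x)"
    by (rule gten_maps_eqI[OF XY gten_gmod[OF XY]])
      (auto intro!: gmaps_intros gmod_intros XY simp: gmaps_pure XY gmaps_id)
next
  fix X X' X'' Y Y' Y'' :: "('k, 'h, 'a) umod" and f f' g g'
  assume a: "gmod X" "gmod X'" "gmod X''" "gmod Y" "gmod Y'" "gmod Y''"
    and f: "f \<in> gmaps X X'" "f' \<in> gmaps X' X''" "g \<in> gmaps Y Y'" "g' \<in> gmaps Y' Y''"
  note c = f[THEN module_maps_closed]
  show "gtar X X'' Y Y'' (compose (carrier X) f' f) (compose (carrier Y) g' g) =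
    compose (carrier (X \<odot>\<odot> Y)) (gtar X' X'' Y' Y'' f' g') (gtar X X' Y Y' f g)"
    by (rule gten_maps_eqI[OF a(1,4) gten_gmod[OF a(3,6)]])
      (use f in \<open>auto intro!: gmaps_intros gmod_intros a simp: gmaps_pure a c gmaps_compose gmod_intros\<close>)
next
  fix X Y Z :: "('k, 'h, 'a) umod" assume "gmod X" "gmod Y" "gmod Z"
  then show "iso_arrow hmod_cat ((X \<odot>\<odot> Y) \<odot>\<odot> Z) (X \<odot>\<odot> (Y \<odot>\<odot> Z)) (gasc X Y Z)" by (rule gasc_iso)
next
  fix X X' Y Y' Z Z' :: "('k, 'h, 'a) umod" and f g h
  assume a: "gmod X" "gmod X'" "gmod Y" "gmod Y'" "gmod Z" "gmod Z'"
    and f: "f \<in> gmaps X X'" "g \<in> gmaps Y Y'" "h \<in> gmaps Z Z'"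
  note c = f[THEN module_maps_closed]
  note f12 = gtar_maps[OF a(1-4) f(1,2)] and f23 = gtar_maps[OF a(3-6) f(2,3)]
  show "compose (carrier ((X \<odot>\<odot> Y) \<odot>\<odot> Z)) (gasc X' Y' Z')
      (gtar (X \<odot>\<odot> Y) (X' \<odot>\<odot> Y') Z Z' (gtar X X' Y Y' f g) h) =
    compose (carrier ((X \<odot>\<odot> Y) \<odot>\<odot> Z)) (gtar X X' (Y \<odot>\<odot> Z) (Y' \<odot>\<odot> Z') f (gtar Y Y' Z Z' g h)) (gasc X Y Z)"
    by (rule gten_left_maps_eqI[OF a(1,3,5) gten_gmod[OF a(2) gten_gmod[OF a(4,6)]]])
      (use f f12 f23 in \<open>auto intro!: gmaps_intros gmod_intros a simp: gmaps_pure a c gmod_intros\<close>)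
next
  fix X :: "('k, 'h, 'a) umod" assume X: "gmod X"
  show "iso_arrow hmod_cat (gunit \<odot>\<odot> X) X (glun X)" "iso_arrow hmod_cat (X \<odot>\<odot> gunit) X (grun X)"
    using glun_inverse[OF X] grun_inverse[OF X] by (auto simp: iso_arrow_def)
next
  fix X Y :: "('k, 'h, 'a) umod" and f assume a: "gmod X" "gmod Y" and f: "f \<in> gmaps X Y"
  note c = module_maps_closed[OF f] lin_smult[OF gmaps_lin[OF f a] unscalar_closed]
  show "compose (carrier (gunit \<odot>\<odot> X)) (glun Y) (gtar gunit gunit X Y (\<lambda>x\<in>carrier gunit. x) f) =
    compose (carrier (gunit \<odot>\<odot> X)) f (glun X)"
    by (rule gten_maps_eqI[OF gunit_gmod a])
      (use f in \<open>auto intro!: gmaps_intros gmod_intros a simp: gmaps_pure a c gmod_intros gmaps_id\<close>)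
  show "compose (carrier (X \<odot>\<odot> gunit)) (grun Y) (gtar X Y gunit gunit f (\<lambda>x\<in>carrier gunit. x)) =
    compose (carrier (X \<odot>\<odot> gunit)) f (grun X)"
    by (rule gten_maps_eqI[OF a(1) gunit_gmod a(2)])
      (use f in \<open>auto intro!: gmaps_intros gmod_intros a simp: gmaps_pure a c gmod_intros gmaps_id\<close>)
next
  fix W X Y Z :: "('k, 'h, 'a) umod" assume a: "gmod W" "gmod X" "gmod Y" "gmod Z"
  note i = gmaps_id[OF a(1)] gmaps_id[OF a(4)] gasc_maps[OF a(1-3)] gasc_maps[OF a(2-4)]
  show "compose (carrier (((W \<odot>\<odot> X) \<odot>\<odot> Y) \<odot>\<odot> Z)) (gasc W X (Y \<odot>\<odot> Z)) (gasc (W \<odot>\<odot> X) Y Z) =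
    compose (carrier (((W \<odot>\<odot> X) \<odot>\<odot> Y) \<odot>\<odot> Z))
      (gtar W W ((X \<odot>\<odot> Y) \<odot>\<odot> Z) (X \<odot>\<odot> (Y \<odot>\<odot> Z)) (\<lambda>x\<in>carrier W. x) (gasc X Y Z))
      (compose (carrier (((W \<odot>\<odot> X) \<odot>\<odot> Y) \<odot>\<odot> Z)) (gasc W (X \<odot>\<odot> Y) Z)
        (gtar ((W \<odot>\<odot> X) \<odot>\<odot> Y) (W \<odot>\<odot> (X \<odot>\<odot> Y)) Z Z (gasc W X Y) (\<lambda>x\<in>carrier Z. x)))"
    by (rule gten_left4_maps_eqI[OF a gten_gmod[OF a(1) gten_gmod[OF a(2) gten_gmod[OF a(3,4)]]]])
      (use i in \<open>auto intro!: gmaps_intros gmod_intros a simp: gmaps_pure a gmod_intros\<close>)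
next
  fix X Y :: "('k, 'h, 'a) umod" assume a: "gmod X" "gmod Y"
  note i = gmaps_id[OF a(1)] gmaps_id[OF a(2)] glun_maps[OF a(2)] grun_maps[OF a(1)]
  \<comment> \<open>On pure tensors the triangle says no more than that the scalar from the middle
    factor may be given to either neighbour.\<close>
  have s: "upure R X Y x (unscalar c \<odot>\<^bsub>Y\<^esub> y) = upure R X Y (unscalar c \<odot>\<^bsub>X\<^esub> x) y"
    if "x \<in> carrier X" "y \<in> carrier Y" "c \<in> carrier gunit" for x y c
  proof -
    note b = upure_bilin[OF gmod_module[OF a(1)] gmod_module[OF a(2)]]
    show ?thesis
      using lin_smult[OF bilin_right_lin[OF b that(1)] unscalar_closed[OF that(3)] that(2)]
        lin_smult[OF bilin_left_lin[OF b that(2)] unscalar_closed[OF that(3)] that(1)] by simp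
  qed
  show "compose (carrier ((X \<odot>\<odot> gunit) \<odot>\<odot> Y))
      (gtar X X (gunit \<odot>\<odot> Y) Y (\<lambda>x\<in>carrier X. x) (glun Y)) (gasc X gunit Y) =
    gtar (X \<odot>\<odot> gunit) X Y Y (grun X) (\<lambda>x\<in>carrier Y. x)"
    by (rule gten_left_maps_eqI[OF a(1) gunit_gmod a(2) gten_gmod[OF a]])
      (use i in \<open>auto intro!: gmaps_intros gmod_intros a simp: gmaps_pure a gmod_intros s\<close>)
qed

end

section \<open>Reversed monoidal categories and opposite enriched categories\<close>

context category
begin

section \<open>Inverse arrows\<close>

abbreviation "obj \<equiv> objects C"

lemma inverse_arrows_arrows: "inverse_arrows C X Y f g \<Longrightarrow> f \<in> arrows C X Y" "inverse_arrows C X Y f g \<Longrightarrow> g \<in> arrows C Y X"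
  by (auto simp: inverse_arrows_def)

lemma inverse_arrows_sym: "inverse_arrows C X Y f g \<Longrightarrow> inverse_arrows C Y X g f"
  by (auto simp: inverse_arrows_def)

text \<open>The equation is a premise so that an axiom whose one side starts with an associator can
  be inserted directly; the conclusion is the same axiom for the inverse associator.\<close>

lemma compose_inverse_right:
  assumes "A \<in> obj" "B \<in> obj" "D \<in> obj" "inverse_arrows C A B a a'" "q \<in> arrows C B D"
    "p = composition C A B D q a"
  shows "composition C B A D p a' = q"
  using assms composition_assoc[of B A B D a' a q] identity_right[of B D q]
  by (auto simp: inverse_arrows_def)

lemma inverse_arrows_unique:
  assumes "X \<in> obj" "Y \<in> obj" "inverse_arrows C X Y f g" "inverse_arrows C X Y f g'"
  shows "g = g'"
  using compose_inverse_right[OF assms(1,2,1,4), of g "identity C X"] assms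
  by (auto simp: inverse_arrows_def identity_left)

lemma inverse_arrow_eq:
  assumes "X \<in> obj" "Y \<in> obj" "inverse_arrows C X Y f g" shows "inverse_arrow C X Y f = g"
  unfolding inverse_arrow_def
  by (rule the_equality[of "inverse_arrows C X Y f", OF assms(3) inverse_arrows_unique[OF assms(1,2) _ assms(3)]])

lemma inverse_arrow:
  assumes "X \<in> obj" "Y \<in> obj" "iso_arrow C X Y f" shows "inverse_arrows C X Y f (inverse_arrow C X Y f)"
  using assms inverse_arrow_eq unfolding iso_arrow_def by metis

lemma inverse_arrows_compose:
  assumes "X \<in> obj" "Y \<in> obj" "Z \<in> obj" and f: "inverse_arrows C X Y f f'" and g: "inverse_arrows C Y Z g g'"
  shows "inverse_arrows C X Z (composition C X Y Z g f) (composition C Z Y X f' g')"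
proof -
  note o = assms(1-3) note a = inverse_arrows_arrows[OF f] inverse_arrows_arrows[OF g]
  note c = composition_arrow[OF o a(1,3)] composition_arrow[OF o(3,2,1) a(4,2)]
  have "composition C X Z X (composition C Z Y X f' g') (composition C X Y Z g f) =
    composition C X Y X f' (composition C X Z Y g' (composition C X Y Z g f))"
    by (rule composition_assoc[OF o(1,3,2,1) c(1) a(4,2)])
  also have "composition C X Z Y g' (composition C X Y Z g f) =
     composition C X Y Y (composition C Y Z Y g' g) f"
    by (rule composition_assoc[OF o(1,2,3,2) a(1,3,4), symmetric])
  also have "\<dots> = f" using g by (simp add: inverse_arrows_def identity_left o a)
  finally have 1: "composition C X Z X (composition C Z Y X f' g') (composition C X Y Z g f) = identity C X"
    using f by (simp add: inverse_arrows_def)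
  have "composition C Z X Z (composition C X Y Z g f) (composition C Z Y X f' g') =
    composition C Z Y Z g (composition C Z X Y f (composition C Z Y X f' g'))"
    by (rule composition_assoc[OF o(3,1,2,3) c(2) a(1,3)])
  also have "composition C Z X Y f (composition C Z Y X f' g') =
     composition C Z Y Y (composition C Y X Y f f') g'"
    by (rule composition_assoc[OF o(3,2,1,2) a(4,2,1), symmetric])
  also have "\<dots> = g'" using f by (simp add: inverse_arrows_def identity_left o a)
  finally have 2: "composition C Z X Z (composition C X Y Z g f) (composition C Z Y X f' g') = identity C Z"
    using g by (simp add: inverse_arrows_def)
  show ?thesis using 1 2 c by (simp add: inverse_arrows_def)
qed

text \<open>If the components of a natural transformation are invertible, the inverses are natural:
  insert the inverse of \<open>b\<close> on the left of the square and cancel \<open>a\<close> on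
  the right.\<close>

lemma inverse_square:
  assumes o: "A \<in> obj" "B \<in> obj" "A' \<in> obj" "B' \<in> obj"
    and a: "inverse_arrows C A B a a'" and b: "inverse_arrows C A' B' b b'"
    and F: "F \<in> arrows C A A'" and G: "G \<in> arrows C B B'"
    and e: "composition C A A' B' b F = composition C A B B' G a"
  shows "composition C B B' A' b' G = composition C B A A' F a'"
proof (rule compose_inverse_right[OF o(1,2,3) a, symmetric])
  note aa = inverse_arrows_arrows[OF a] and bb = inverse_arrows_arrows[OF b]
  show "composition C B B' A' b' G \<in> arrows C B A'" by (rule composition_arrow[OF o(2,4,3) G bb(2)])
  have "F = composition C A A' A' (composition C A' B' A' b' b) F"
    using b by (simp add: inverse_arrows_def identity_left o F)
  also have "\<dots> = composition C A B' A' b' (composition C A A' B' b F)"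
    by (rule composition_assoc[OF o(1,3,4,3) F bb])
  also have "\<dots> = composition C A B A' (composition C B B' A' b' G) a"
    unfolding e by (rule composition_assoc[OF o(1,2,4,3) aa(1) G bb(2), symmetric])
  finally show "F = composition C A B A' (composition C B B' A' b' G) a" .
qed

end

context monoidal_category
begin

abbreviation "inv_asc X Y Z \<equiv> inverse_arrow V ((X \<boxtimes> Y) \<boxtimes> Z) (X \<boxtimes> (Y \<boxtimes> Z)) (asc X Y Z)"

lemma inv_asc:
  "X \<in> obs \<Longrightarrow> Y \<in> obs \<Longrightarrow> Z \<in> obs \<Longrightarrow>
   inverse_arrows V ((X \<boxtimes> Y) \<boxtimes> Z) (X \<boxtimes> (Y \<boxtimes> Z)) (asc X Y Z) (inv_asc X Y Z)"
  by (intro inverse_arrow associator_iso tensor_object)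

lemma tensor_inverse_arrows:
  assumes o: "X \<in> obs" "X' \<in> obs" "Y \<in> obs" "Y' \<in> obs"
    and f: "inverse_arrows V X X' f f'" and g: "inverse_arrows V Y Y' g g'"
  shows "inverse_arrows V (X \<boxtimes> Y) (X' \<boxtimes> Y') (ten X X' Y Y' f g) (ten X' X Y' Y f' g')"
proof -
  note ff = inverse_arrows_arrows[OF f] and gg = inverse_arrows_arrows[OF g]
  show ?thesis
    using f g tensor_composition[OF o(1,2,1) o(3,4,3) ff gg] tensor_composition[OF o(2,1,2) o(4,3,4) ff(2,1) gg(2,1)]
    by (simp add: inverse_arrows_def tensor_identity o tensor_arrow)
qed

lemma identity_inverse: "X \<in> obs \<Longrightarrow> inverse_arrows V X X (idn X) (idn X)"
  by (simp add: inverse_arrows_def identity_arrow identity_left)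

end

section \<open>The reversed monoidal category\<close>

lemma reverse_moncat_simps:
  "objects (reverse_moncat V) = objects V" "arrows (reverse_moncat V) = arrows V"
  "identity (reverse_moncat V) = identity V" "composition (reverse_moncat V) = composition V"
  "tensor_ob (reverse_moncat V) = (\<lambda>X Y. tensor_ob V Y X)"
  "tensor_ar (reverse_moncat V) = (\<lambda>X X' Y Y' f g. tensor_ar V Y Y' X X' g f)"
  "unit_ob (reverse_moncat V) = unit_ob V"
  "associator (reverse_moncat V) = (\<lambda>X Y Z. inverse_arrow V
       (tensor_ob V (tensor_ob V Z Y) X) (tensor_ob V Z (tensor_ob V Y X)) (associator V Z Y X))"
  "left_unitor (reverse_moncat V) = right_unitor V" "right_unitor (reverse_moncat V) = left_unitor V"
  by (simp_all add: reverse_moncat_def)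

lemma reverse_inverse_arrows: "inverse_arrows (reverse_moncat V) = inverse_arrows V"
  by (intro ext) (simp add: inverse_arrows_def reverse_moncat_simps)

lemma reverse_iso_arrow: "iso_arrow (reverse_moncat V) = iso_arrow V"
  by (intro ext) (simp add: iso_arrow_def reverse_inverse_arrows)

lemma reverse_inverse_arrow: "inverse_arrow (reverse_moncat V) = inverse_arrow V"
  by (intro ext) (simp add: inverse_arrow_def reverse_inverse_arrows)

lemma reverse_category: "category V \<Longrightarrow> category (reverse_moncat V)"
  by (simp add: category_def reverse_moncat_simps)

lemma reverse_monoidal:
  fixes V :: "('o, 'f) moncat"
  assumes "monoidal_category V" shows "monoidal_category (reverse_moncat V)"
proof -
  interpret monoidal_category V by (rule assms)
  note o = tensor_object unit_object
  show ?thesis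
  proof (intro monoidal_category.intro reverse_category category_axioms monoidal_category_axioms.intro;
      unfold reverse_moncat_simps reverse_iso_arrow)
    fix X Y Z assume "X \<in> obs" "Y \<in> obs" "Z \<in> obs"
    then show "iso_arrow V (Z \<boxtimes> (Y \<boxtimes> X)) ((Z \<boxtimes> Y) \<boxtimes> X) (inv_asc Z Y X)"
      using inverse_arrows_sym[OF inv_asc] by (auto simp: iso_arrow_def)
  next
    fix X X' Y Y' Z Z' f g h
    assume a: "X \<in> obs" "X' \<in> obs" "Y \<in> obs" "Y' \<in> obs" "Z \<in> obs" "Z' \<in> obs"
      and f: "f \<in> hm X X'" "g \<in> hm Y Y'" "h \<in> hm Z Z'"
    show "cmp (Z \<boxtimes> (Y \<boxtimes> X)) (Z' \<boxtimes> (Y' \<boxtimes> X')) ((Z' \<boxtimes> Y') \<boxtimes> X') (inv_asc Z' Y' X')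
        (ten Z Z' (Y \<boxtimes> X) (Y' \<boxtimes> X') h (ten Y Y' X X' g f)) =
      cmp (Z \<boxtimes> (Y \<boxtimes> X)) ((Z \<boxtimes> Y) \<boxtimes> X) ((Z' \<boxtimes> Y') \<boxtimes> X')
        (ten (Z \<boxtimes> Y) (Z' \<boxtimes> Y') X X' (ten Z Z' Y Y' h g) f) (inv_asc Z Y X)"
      by (intro inverse_square[OF _ _ _ _ inv_asc inv_asc] associator_natural o a f tensor_arrow)
  next
    fix W X Y Z assume a: "W \<in> obs" "X \<in> obs" "Y \<in> obs" "Z \<in> obs"
    note i = identity_inverse[OF a(1)] identity_inverse[OF a(4)]
    let ?S = "((Z \<boxtimes> Y) \<boxtimes> X) \<boxtimes> W" and ?T = "Z \<boxtimes> (Y \<boxtimes> (X \<boxtimes> W))"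
    let ?M = "(Z \<boxtimes> (Y \<boxtimes> X)) \<boxtimes> W" and ?N = "Z \<boxtimes> ((Y \<boxtimes> X) \<boxtimes> W)"
    let ?P = "cmp ?S ((Z \<boxtimes> Y) \<boxtimes> (X \<boxtimes> W)) ?T (asc Z Y (X \<boxtimes> W)) (asc (Z \<boxtimes> Y) X W)"
    \<comment> \<open>Both sides of the reversed pentagon are inverse to the common value
      \<open>?P\<close> of the original pentagon for the objects in opposite order, and inverses are
      unique.\<close>
    have "inverse_arrows V ?S ?T ?P (cmp ?T ((Z \<boxtimes> Y) \<boxtimes> (X \<boxtimes> W)) ?S (inv_asc (Z \<boxtimes> Y) X W) (inv_asc Z Y (X \<boxtimes> W)))"
      by (intro inverse_arrows_compose inv_asc o a)
    moreover have "inverse_arrows V ?S ?T ?P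
      (cmp ?T ?M ?S (ten (Z \<boxtimes> (Y \<boxtimes> X)) ((Z \<boxtimes> Y) \<boxtimes> X) W W (inv_asc Z Y X) (idn W))
        (cmp ?T ?N ?M (inv_asc Z (Y \<boxtimes> X) W) (ten Z Z (Y \<boxtimes> (X \<boxtimes> W)) ((Y \<boxtimes> X) \<boxtimes> W) (idn Z) (inv_asc Y X W))))"
      unfolding pentagon[OF a(4,3,2,1)]
      \<comment> \<open>After rebracketing, inverting the threefold composite produces the
        bracketing of the goal.\<close>
      by (subst composition_assoc[symmetric])
        (intro inverse_arrows_compose inv_asc o a tensor_inverse_arrows i inverse_arrows_arrows[OF inv_asc]
          tensor_arrow identity_arrow)+
    ultimately show "cmp ?T ((Z \<boxtimes> Y) \<boxtimes> (X \<boxtimes> W)) ?S (inv_asc (Z \<boxtimes> Y) X W) (inv_asc Z Y (X \<boxtimes> W)) =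
      cmp ?T ?M ?S (ten (Z \<boxtimes> (Y \<boxtimes> X)) ((Z \<boxtimes> Y) \<boxtimes> X) W W (inv_asc Z Y X) (idn W))
        (cmp ?T ?N ?M (inv_asc Z (Y \<boxtimes> X) W) (ten Z Z (Y \<boxtimes> (X \<boxtimes> W)) ((Y \<boxtimes> X) \<boxtimes> W) (idn Z) (inv_asc Y X W)))"
      by (rule inverse_arrows_unique[rotated 2]) (intro o a)+
  next
    fix X Y assume a: "X \<in> obs" "Y \<in> obs"
    show "cmp (Y \<boxtimes> (iob \<boxtimes> X)) ((Y \<boxtimes> iob) \<boxtimes> X) (Y \<boxtimes> X) (ten (Y \<boxtimes> iob) Y X X (run Y) (idn X)) (inv_asc Y iob X) =
      ten Y Y (iob \<boxtimes> X) X (idn Y) (lun X)"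
      using left_unitor_iso[OF a(1)]
      by (intro compose_inverse_right[OF _ _ _ inv_asc] o a tensor_arrow identity_arrow triangle[symmetric])
        (auto simp: iso_arrow_def inverse_arrows_def)
  qed (intro o tensor_arrow tensor_identity tensor_composition left_unitor_iso right_unitor_iso
      left_unitor_natural right_unitor_natural; assumption)+
qed

text \<open>Composition in an opposite enriched category needs the tensor factors exchanged. Instead
  of a braiding, the reversed tensor product of the base supplies the exchange.\<close>

definition opposite_vcat :: "('b, 'o, 'f) vcat \<Rightarrow> ('b, 'o, 'f) vcat"
  where "opposite_vcat E = \<lparr>vobjects = vobjects E, vhom = (\<lambda>X Y. vhom E Y X),
    vcomposition = (\<lambda>X Y Z. vcomposition E Z Y X), videntity = videntity E\<rparr>"

lemma opposite_vcat_simps: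
  "vobjects (opposite_vcat E) = vobjects E" "vhom (opposite_vcat E) = (\<lambda>X Y. vhom E Y X)"
  "vcomposition (opposite_vcat E) = (\<lambda>X Y Z. vcomposition E Z Y X)" "videntity (opposite_vcat E) = videntity E"
  by (simp_all add: opposite_vcat_def)

text \<open>The associativity axiom is read from right to left with the associator moved to the
  other side; the two unit laws change places, as do the two unitors.\<close>

lemma opposite_enriched:
  fixes V :: "('o, 'f) moncat"
  assumes "enriched_category V E" shows "enriched_category (reverse_moncat V) (opposite_vcat E)"
proof -
  interpret enriched_category V E by (rule assms)
  note o = tensor_object unit_object vhom_object
  show ?thesis
  proof (intro enriched_category.intro reverse_monoidal monoidal_category_axioms enriched_category_axioms.intro;
      unfold reverse_moncat_simps opposite_vcat_simps)
    fix W X Y Z assume a: "W \<in> vobjects E" "X \<in> vobjects E" "Y \<in> vobjects E" "Z \<in> vobjects E"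
    let ?A = "vhom E X W" and ?B = "vhom E Y X" and ?C = "vhom E Z Y"
    have e: "cmp ((?A \<boxtimes> ?B) \<boxtimes> ?C) (vhom E Y W \<boxtimes> ?C) (vhom E Z W) (vcomposition E Z Y W)
        (ten (?A \<boxtimes> ?B) (vhom E Y W) ?C ?C (vcomposition E Y X W) (idn ?C)) =
      cmp ((?A \<boxtimes> ?B) \<boxtimes> ?C) (?A \<boxtimes> (?B \<boxtimes> ?C)) (vhom E Z W)
        (cmp (?A \<boxtimes> (?B \<boxtimes> ?C)) (?A \<boxtimes> vhom E Z X) (vhom E Z W) (vcomposition E Z X W)
          (ten ?A ?A (?B \<boxtimes> ?C) (vhom E Z X) (idn ?A) (vcomposition E Z Y X)))
        (asc ?A ?B ?C)"
      by (rule vcomposition_assoc[OF a(4,3,2,1)])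
    have i: "inverse_arrows V ((?A \<boxtimes> ?B) \<boxtimes> ?C) (?A \<boxtimes> (?B \<boxtimes> ?C)) (asc ?A ?B ?C) (inv_asc ?A ?B ?C)"
      by (intro inv_asc o a)
    show "cmp (?A \<boxtimes> (?B \<boxtimes> ?C)) (?A \<boxtimes> vhom E Z X) (vhom E Z W) (vcomposition E Z X W)
        (ten ?A ?A (?B \<boxtimes> ?C) (vhom E Z X) (idn ?A) (vcomposition E Z Y X)) =
      cmp (?A \<boxtimes> (?B \<boxtimes> ?C)) ((?A \<boxtimes> ?B) \<boxtimes> ?C) (vhom E Z W)
        (cmp ((?A \<boxtimes> ?B) \<boxtimes> ?C) (vhom E Y W \<boxtimes> ?C) (vhom E Z W) (vcomposition E Z Y W)
          (ten (?A \<boxtimes> ?B) (vhom E Y W) ?C ?C (vcomposition E Y X W) (idn ?C)))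
        (inv_asc ?A ?B ?C)"
      by (rule compose_inverse_right[OF _ _ _ i _ e, symmetric])
        (intro o a composition_arrow tensor_arrow identity_arrow vcomposition_arrow)+
  qed (intro o vcomposition_arrow videntity_arrow videntity_left videntity_right; assumption)+
qed

section \<open>Enrichment over global modules from composition maps\<close>

context hopf_algebra
begin

interpretation R: field R by (rule field)

interpretation H: ring H
  using algebra by (simp add: k_algebra_def)

text \<open>The passage from elements to morphisms: a bilinear equivariant composition and invariant
  units satisfying the usual laws on elements give an enriched category. The last two conclusions
  record the values on pure tensors and on \<open>uone\<close>, from which the underlying category
  is computed.\<close>

lemma HMod_enriched:
  fixes A :: "'b set" and ho :: "'b \<Rightarrow> 'b \<Rightarrow> ('k, 'h, 'a) umod" and c u
  assumes ho: "\<And>X Y. X \<in> A \<Longrightarrow> Y \<in> A \<Longrightarrow> gmod (ho X Y)"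
    and bil: "\<And>X Y Z. X \<in> A \<Longrightarrow> Y \<in> A \<Longrightarrow> Z \<in> A \<Longrightarrow> bilin R (ho Y Z) (ho X Y) (ho X Z) (c X Y Z)"
    and equi: "\<And>X Y Z h g f. X \<in> A \<Longrightarrow> Y \<in> A \<Longrightarrow> Z \<in> A \<Longrightarrow> h \<in> carrier H \<Longrightarrow> g \<in> carrier (ho Y Z) \<Longrightarrow>
      f \<in> carrier (ho X Y) \<Longrightarrow>
      cosum False (ho X Z) (\<lambda>a b. c X Y Z (act (ho Y Z) a g) (act (ho X Y) b f)) h = act (ho X Z) h (c X Y Z g f)"
    and assoc: "\<And>W X Y Z e g f. W \<in> A \<Longrightarrow> X \<in> A \<Longrightarrow> Y \<in> A \<Longrightarrow> Z \<in> A \<Longrightarrow> e \<in> carrier (ho Y Z) \<Longrightarrow>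
      g \<in> carrier (ho X Y) \<Longrightarrow> f \<in> carrier (ho W X) \<Longrightarrow> c W X Z (c X Y Z e g) f = c W Y Z e (c W X Y g f)"
    and u: "\<And>X. X \<in> A \<Longrightarrow> u X \<in> carrier (ho X X)"
    and u_act: "\<And>X h. X \<in> A \<Longrightarrow> h \<in> carrier H \<Longrightarrow> act (ho X X) h (u X) = counit H h \<odot>\<^bsub>ho X X\<^esub> u X"
    and left: "\<And>X Y f. X \<in> A \<Longrightarrow> Y \<in> A \<Longrightarrow> f \<in> carrier (ho X Y) \<Longrightarrow> c X Y Y (u Y) f = f"
    and right: "\<And>X Y f. X \<in> A \<Longrightarrow> Y \<in> A \<Longrightarrow> f \<in> carrier (ho X Y) \<Longrightarrow> c X X Y f (u X) = f"
  defines "E \<equiv> \<lparr>vobjects = A, vhom = ho,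
    vcomposition = (\<lambda>X Y Z. \<lambda>t\<in>carrier (ho Y Z \<odot>\<odot> ho X Y). tsum (ho X Z) (c X Y Z) (unformal t)),
    videntity = (\<lambda>X. \<lambda>x\<in>carrier gunit. unscalar x \<odot>\<^bsub>ho X X\<^esub> u X)\<rparr>"
  shows "enriched_category hmod_cat E"
    and "\<And>X Y Z g f. X \<in> A \<Longrightarrow> Y \<in> A \<Longrightarrow> Z \<in> A \<Longrightarrow> g \<in> carrier (ho Y Z) \<Longrightarrow> f \<in> carrier (ho X Y) \<Longrightarrow>
      vcomposition E X Y Z (upure R (ho Y Z) (ho X Y) g f) = c X Y Z g f"
    and "\<And>X. X \<in> A \<Longrightarrow> videntity E X uone = u X"
proof -
  interpret monoidal_category hmod_cat by (rule HMod_monoidal)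
  have E_simps: "vobjects E = A" "vhom E = ho" by (simp_all add: E_def)
  note md = gmod_module[OF ho]
  have vc: "vcomposition E X Y Z \<in> gmaps (ho Y Z \<odot>\<odot> ho X Y) (ho X Z)" if "X \<in> A" "Y \<in> A" "Z \<in> A" for X Y Z
    unfolding E_def vcat.simps
    by (rule glift_module_maps[OF ho ho ho bil]; (rule that | erule equi[OF that]))
  show pure: "vcomposition E X Y Z (upure R (ho Y Z) (ho X Y) g f) = c X Y Z g f"
    if "X \<in> A" "Y \<in> A" "Z \<in> A" "g \<in> carrier (ho Y Z)" "f \<in> carrier (ho X Y)" for X Y Z g f
    using that by (simp add: E_def upure_closed ho glift_pure[OF md md bil])
  have vi_eq: "videntity E X x = unscalar x \<odot>\<^bsub>ho X X\<^esub> u X" if "x \<in> carrier gunit" for X x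
    using that by (simp add: E_def)
  have vi: "videntity E X \<in> gmaps gunit (ho X X)" if X: "X \<in> A" for X
  proof (rule module_mapsI)
    interpret M: module R "ho X X" by (rule md[OF X X])
    show l: "lin R gunit (ho X X) (videntity E X)"
      unfolding E_def vcat.simps
      by (intro lin_restrict bilin_left[OF bilin_smult[OF md[OF X X]]] u X unscalar_lin)
    show "videntity E X \<in> extensional (carrier gunit)" by (simp add: E_def)
    fix h and x :: "('k, 'a) univ" assume h: "h \<in> carrier H" and "x \<in> carrier gunit"
    then obtain d where d: "x = Scalar d" "d \<in> carrier R" by (auto simp: gunit_carrier)
    have "act (ho X X) h (d \<odot>\<^bsub>ho X X\<^esub> u X) = d \<odot>\<^bsub>ho X X\<^esub> (counit H h \<odot>\<^bsub>ho X X\<^esub> u X)"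
      using lin_smult[OF bilin_right_lin[OF act_bilin[OF ho[OF X X]] h] d(2) u[OF X]] by (simp add: u_act X h)
    also have "\<dots> = (counit H h \<otimes>\<^bsub>R\<^esub> d) \<odot>\<^bsub>ho X X\<^esub> u X"
      using smult_commute[OF md[OF X X] d(2) counit_closed[OF h] u[OF X]] d(2)
      by (simp add: M.smult_assoc1 counit_closed h u X)
    finally show "videntity E X (act gunit h x) = act (ho X X) h (videntity E X x)"
      using d h by (simp add: gunit_act vi_eq gunit_carrier counit_closed)
  qed
  show vi1: "videntity E X uone = u X" if X: "X \<in> A" for X
    using module.smult_one[OF md[OF X X] u[OF X]] by (simp add: vi_eq gunit_one)
  have c_closed: "c X Y Z g f \<in> carrier (ho X Z)"
    if "X \<in> A" "Y \<in> A" "Z \<in> A" "g \<in> carrier (ho Y Z)" "f \<in> carrier (ho X Y)" for X Y Z g f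
    using that by (intro bilin_closed[OF bil])
  show "enriched_category hmod_cat E"
  proof (intro enriched_category.intro HMod_monoidal enriched_category_axioms.intro;
      unfold HMod_simps mem_Collect_eq E_simps)
    fix W X Y Z assume a: "W \<in> A" "X \<in> A" "Y \<in> A" "Z \<in> A"
    let ?C = "ho Y Z" and ?B = "ho X Y" and ?A = "ho W X"
    note v = vc[OF a(2-4)] vc[OF a(1,2,4)] vc[OF a(1,3,4)] vc[OF a(1-3)]
    note i = gmaps_id[OF ho[OF a(1,2)]] gmaps_id[OF ho[OF a(3,4)]]
    show "compose (carrier ((?C \<odot>\<odot> ?B) \<odot>\<odot> ?A)) (vcomposition E W X Z)
        (gtar (?C \<odot>\<odot> ?B) (ho X Z) ?A ?A (vcomposition E X Y Z) (\<lambda>x\<in>carrier ?A. x)) =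
      compose (carrier ((?C \<odot>\<odot> ?B) \<odot>\<odot> ?A))
        (compose (carrier (?C \<odot>\<odot> (?B \<odot>\<odot> ?A))) (vcomposition E W Y Z)
          (gtar ?C ?C (?B \<odot>\<odot> ?A) (ho W Y) (\<lambda>x\<in>carrier ?C. x) (vcomposition E W X Y)))
        (gasc ?C ?B ?A)"
      by (rule gten_left_maps_eqI[OF ho[OF a(3,4)] ho[OF a(2,3)] ho[OF a(1,2)] ho[OF a(1,4)]])
        (use v i in \<open>auto intro!: gmaps_intros gmod_intros ho a simp: gmaps_pure pure c_closed assoc a ho gmod_intros\<close>)
  next
    fix X Y assume a: "X \<in> A" "Y \<in> A"
    note v = vc[OF a(1,2,2)] vc[OF a(1,1,2)] vi[OF a(1)] vi[OF a(2)] gmaps_id[OF ho[OF a]]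
    \<comment> \<open>The unit morphism takes all multiples of \<open>u\<close> as values, so the
      unit laws are extended to these multiples.\<close>
    have s: "c X Y Y (unscalar x \<odot>\<^bsub>ho Y Y\<^esub> u Y) f = unscalar x \<odot>\<^bsub>ho X Y\<^esub> f"
      "c X X Y f (unscalar x \<odot>\<^bsub>ho X X\<^esub> u X) = unscalar x \<odot>\<^bsub>ho X Y\<^esub> f"
      if x: "x \<in> carrier gunit" and f: "f \<in> carrier (ho X Y)" for x f
      using lin_smult[OF bilin_left_lin[OF bil[OF a(1,2,2)] f] unscalar_closed[OF x] u[OF a(2)]]
        lin_smult[OF bilin_right_lin[OF bil[OF a(1,1,2)] f] unscalar_closed[OF x] u[OF a(1)]]
      by (simp_all add: left right a f)
    have w: "unscalar x \<odot>\<^bsub>ho Z Z\<^esub> u Z \<in> carrier (ho Z Z)" if "x \<in> carrier gunit" "Z \<in> A" for x Z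
      using that by (intro module.smult_closed[OF md] unscalar_closed u)
    show "compose (carrier (gunit \<odot>\<odot> ho X Y)) (vcomposition E X Y Y)
        (gtar gunit (ho Y Y) (ho X Y) (ho X Y) (videntity E Y) (\<lambda>x\<in>carrier (ho X Y). x)) = glun (ho X Y)"
      by (rule gten_maps_eqI[OF gunit_gmod ho[OF a] ho[OF a]])
        (use v in \<open>auto intro!: gmaps_intros gmod_intros ho a simp: gmaps_pure pure vi_eq s w a ho gmod_intros\<close>)
    show "compose (carrier (ho X Y \<odot>\<odot> gunit)) (vcomposition E X X Y)
        (gtar (ho X Y) (ho X Y) gunit (ho X X) (\<lambda>x\<in>carrier (ho X Y). x) (videntity E X)) = grun (ho X Y)"
      by (rule gten_maps_eqI[OF ho[OF a] gunit_gmod ho[OF a]])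
        (use v in \<open>auto intro!: gmaps_intros gmod_intros ho a simp: gmaps_pure pure vi_eq s w a ho gmod_intros\<close>)
  qed (intro ho vc vi; assumption)+
qed

text \<open>The elements picked out by arrows from the monoidal unit, and so the elementwise form of
  the arrows of an underlying category.\<close>

definition invariants :: "('k, 'h, 'm) hmod \<Rightarrow> 'm set"
  where "invariants X = {x \<in> carrier X. \<forall>h\<in>carrier H. act X h x = counit H h \<odot>\<^bsub>X\<^esub> x}"

lemma gunit_maps_invariants:
  fixes X :: "('k, 'h, 'a) umod"
  assumes X: "gmod X"
  shows "bij_betw (\<lambda>\<phi>. \<phi> uone) (gmaps (gunit :: ('k, 'h, 'a) umod) X) (invariants X)"
proof (intro bij_betw_imageI inj_onI equalityI subsetI)
  fix \<phi> \<psi> :: "('k, 'a) univ \<Rightarrow> ('k, 'a) univ" assume "\<phi> \<in> gmaps gunit X" "\<psi> \<in> gmaps gunit X" "\<phi> uone = \<psi> uone"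
  then show "\<phi> = \<psi>" by (rule gunit_maps_eqI[OF X])
next
  fix x assume "x \<in> (\<lambda>\<phi>. \<phi> uone) ` gmaps (gunit :: ('k, 'h, 'a) umod) X"
  then obtain \<phi> :: "('k, 'a) univ \<Rightarrow> ('k, 'a) univ" where p: "\<phi> \<in> gmaps gunit X" "x = \<phi> uone" by auto
  have "act X h x = counit H h \<odot>\<^bsub>X\<^esub> x" if h: "h \<in> carrier H" for h
  proof -
    have "act X h x = \<phi> (act gunit h uone)" using module_maps_act[OF p(1) h gunit_one] p(2) by simp
    also have "act gunit h uone = counit H h \<odot>\<^bsub>gunit\<^esub> uone"
      by (simp add: gunit_act gunit_smult)
    also have "\<phi> \<dots> = counit H h \<odot>\<^bsub>X\<^esub> x"
      using lin_smult[OF gmaps_lin[OF p(1) gunit_gmod X] counit_closed[OF h] gunit_one] p(2) by simp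
    finally show ?thesis .
  qed
  then show "x \<in> invariants X"
    using module_maps_closed[OF p(1) gunit_one] p(2) by (simp add: invariants_def)
next
  fix x assume x: "x \<in> invariants X"
  interpret X: module R X by (rule gmod_module[OF X])
  let ?f = "\<lambda>c\<in>carrier (gunit :: ('k, 'h, 'a) umod). unscalar c \<odot>\<^bsub>X\<^esub> x"
  have xc: "x \<in> carrier X" and xi: "\<And>h. h \<in> carrier H \<Longrightarrow> act X h x = counit H h \<odot>\<^bsub>X\<^esub> x"
    using x by (auto simp: invariants_def)
  have "?f \<in> gmaps gunit X"
  proof (rule module_mapsI)
    show "lin R gunit X ?f"
      by (intro lin_restrict bilin_left[OF bilin_smult[OF gmod_module[OF X]]] xc unscalar_lin)
    fix h and c :: "('k, 'a) univ" assume h: "h \<in> carrier H" and "c \<in> carrier gunit"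
    then obtain d where d: "c = Scalar d" "d \<in> carrier R" by (auto simp: gunit_carrier)
    have "act X h (d \<odot>\<^bsub>X\<^esub> x) = d \<odot>\<^bsub>X\<^esub> (counit H h \<odot>\<^bsub>X\<^esub> x)"
      using lin_smult[OF bilin_right_lin[OF act_bilin[OF X] h] d(2) xc] by (simp add: xi h)
    also have "\<dots> = (counit H h \<otimes>\<^bsub>R\<^esub> d) \<odot>\<^bsub>X\<^esub> x"
      using smult_commute[OF gmod_module[OF X] d(2) counit_closed[OF h] xc] d(2)
      by (simp add: X.smult_assoc1 counit_closed h xc)
    finally show "?f (act gunit h c) = act X h (?f c)"
      using d h by (simp add: gunit_act gunit_carrier counit_closed)
  qed simp
  moreover have "x = ?f uone" using xc by (simp add: gunit_one)
  ultimately show "x \<in> (\<lambda>\<phi>. \<phi> uone) ` gmaps (gunit :: ('k, 'h, 'a) umod) X" unfolding image_iff by (intro bexI[of _ ?f])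
qed

text \<open>Lets the comparison functor be given on invariant elements; evaluation at
  \<open>uone\<close> extends it to the arrows of the underlying category.\<close>

lemma same_category_invariants:
  fixes ho :: "'b \<Rightarrow> 'b \<Rightarrow> ('k, 'h, 'a) umod" and D :: "('b, ('k, 'a) univ \<Rightarrow> ('k, 'a) univ, 'x) cat_scheme"
  assumes "objects D = objects C"
    and ar: "\<And>X Y. X \<in> objects D \<Longrightarrow> Y \<in> objects D \<Longrightarrow> arrows D X Y = gmaps gunit (ho X Y)"
    and ho: "\<And>X Y. X \<in> objects D \<Longrightarrow> Y \<in> objects D \<Longrightarrow> gmod (ho X Y)"
    and F: "\<And>X Y. X \<in> objects D \<Longrightarrow> Y \<in> objects D \<Longrightarrow> bij_betw (F X Y) (invariants (ho X Y)) (arrows C X Y)"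
    and "\<And>X. X \<in> objects D \<Longrightarrow> F X X (identity D X uone) = identity C X"
    and "\<And>X Y Z f g. X \<in> objects D \<Longrightarrow> Y \<in> objects D \<Longrightarrow> Z \<in> objects D \<Longrightarrow> f \<in> gmaps gunit (ho X Y) \<Longrightarrow>
      g \<in> gmaps gunit (ho Y Z) \<Longrightarrow> F X Z (composition D X Y Z g f uone) =
      composition C X Y Z (F Y Z (g uone)) (F X Y (f uone))"
  shows "same_category D C"
proof -
  have "bij_betw (F X Y \<circ> (\<lambda>\<phi>. \<phi> uone)) (arrows D X Y) (arrows C X Y)"
    if "X \<in> objects D" "Y \<in> objects D" for X Y
    using bij_betw_trans[OF gunit_maps_invariants[OF ho[OF that]] F[OF that]] ar[OF that] by simp
  then show ?thesis
    unfolding same_category_def using assms(1,2,5,6)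
    by (intro conjI exI[of _ "\<lambda>X Y \<phi>. F X Y (\<phi> uone)"]) (auto simp: o_def)
qed

end

section \<open>Partial modules and their Hom-objects\<close>

lemma lin_addI:
  assumes "lin R V W f" "lin R V W g" shows "lin R V W (\<lambda>x. f x \<oplus>\<^bsub>W\<^esub> g x)"
proof -
  interpret W: module R W by (rule lin_modules(2)[OF assms(1)])
  note l = assms
  show ?thesis
    by (intro linI lin_modules(1)[OF l(1)] lin_modules(2)[OF l(1)] W.a_closed lin_closed[OF l(1)] lin_closed[OF l(2)])
      (simp_all add: lin_add[OF l(1)] lin_add[OF l(2)] lin_smult[OF l(1)] lin_smult[OF l(2)]
        lin_closed[OF l(1)] lin_closed[OF l(2)] W.a_ac W.smult_r_distr)
qed

lemma lin_zeroI:
  assumes "module R V" "module R W" shows "lin R V W (\<lambda>x. \<zero>\<^bsub>W\<^esub>)"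
proof -
  interpret W: module R W by (rule assms)
  show ?thesis by (intro linI assms) simp_all
qed

lemma map_space_module:
  assumes T: "module R T" and N: "module R N"
    and act_T: "\<And>h x. h \<in> carrier H \<Longrightarrow> x \<in> carrier T \<Longrightarrow> act T h x \<in> carrier T"
    and act_N: "\<And>h. h \<in> carrier H \<Longrightarrow> lin R N N (act N h)"
  shows "module R (map_space T N (module_maps R H T N))" (is "module R ?S")
proof -
  interpret N: module R N by (rule N)
  let ?F = "module_maps R H T N"
  have S: "carrier ?S = ?F" "\<zero>\<^bsub>?S\<^esub> = (\<lambda>x\<in>carrier T. \<zero>\<^bsub>N\<^esub>)"
    "f \<oplus>\<^bsub>?S\<^esub> g = (\<lambda>x\<in>carrier T. f x \<oplus>\<^bsub>N\<^esub> g x)" "c \<odot>\<^bsub>?S\<^esub> f = (\<lambda>x\<in>carrier T. c \<odot>\<^bsub>N\<^esub> f x)" for f g c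
    by (simp_all add: map_space_def)
  have l: "lin R T N f" if "f \<in> ?F" for f using module_maps_lin[OF that T N] .
  note cl = module_maps_closed and ac = module_maps_act
  have zero: "(\<lambda>x\<in>carrier T. \<zero>\<^bsub>N\<^esub>) \<in> ?F"
    by (rule module_mapsI[OF lin_restrict[OF lin_zeroI[OF T N]] restrict_extensional])
      (simp add: act_T lin_zero[OF act_N])
  have add: "(\<lambda>x\<in>carrier T. f x \<oplus>\<^bsub>N\<^esub> g x) \<in> ?F" if f: "f \<in> ?F" and g: "g \<in> ?F" for f g
    by (rule module_mapsI[OF lin_restrict[OF lin_addI[OF l[OF f] l[OF g]]] restrict_extensional])
      (simp add: act_T lin_add[OF act_N] ac[OF f] ac[OF g] cl[OF f] cl[OF g])
  have smult: "(\<lambda>x\<in>carrier T. c \<odot>\<^bsub>N\<^esub> f x) \<in> ?F" if f: "f \<in> ?F" and c: "c \<in> carrier R" for f c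
    by (rule module_mapsI[OF lin_restrict[OF lin_smultI[OF c l[OF f]]] restrict_extensional])
      (simp add: act_T lin_smult[OF act_N] ac[OF f] cl[OF f] c)
  have e: "f = (\<lambda>x\<in>carrier T. g x)" if "f \<in> ?F" "\<And>x. x \<in> carrier T \<Longrightarrow> f x = g x" for f g
    using that by (intro extensionalityI[OF module_maps_extensional[OF that(1)] restrict_extensional]) simp
  have "abelian_group ?S"
  proof (rule abelian_groupI; unfold S)
    fix f g k assume F: "f \<in> ?F" "g \<in> ?F" "k \<in> ?F"
    note F_cl = F[THEN cl]
    show "(\<lambda>x\<in>carrier T. f x \<oplus>\<^bsub>N\<^esub> g x) \<in> ?F" by (rule add[OF F(1,2)])
    show "(\<lambda>x\<in>carrier T. (\<lambda>x\<in>carrier T. f x \<oplus>\<^bsub>N\<^esub> g x) x \<oplus>\<^bsub>N\<^esub> k x) =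
      (\<lambda>x\<in>carrier T. f x \<oplus>\<^bsub>N\<^esub> (\<lambda>x\<in>carrier T. g x \<oplus>\<^bsub>N\<^esub> k x) x)"
      by (rule restrict_ext) (simp add: F_cl N.a_assoc)
    show "(\<lambda>x\<in>carrier T. f x \<oplus>\<^bsub>N\<^esub> g x) = (\<lambda>x\<in>carrier T. g x \<oplus>\<^bsub>N\<^esub> f x)"
      by (rule restrict_ext) (simp add: F_cl N.a_comm)
    show "(\<lambda>x\<in>carrier T. (\<lambda>x\<in>carrier T. \<zero>\<^bsub>N\<^esub>) x \<oplus>\<^bsub>N\<^esub> f x) = f"
      by (rule e[OF F(1), symmetric]) (simp add: F_cl)
    \<comment> \<open>The negative is taken as the multiple by -1, so that closure under
      \<open>smult\<close> shows it to be a morphism again.\<close>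
    have "(\<lambda>x\<in>carrier T. (\<lambda>x\<in>carrier T. (\<ominus>\<^bsub>R\<^esub> \<one>\<^bsub>R\<^esub>) \<odot>\<^bsub>N\<^esub> f x) x \<oplus>\<^bsub>N\<^esub> f x) = (\<lambda>x\<in>carrier T. \<zero>\<^bsub>N\<^esub>)"
      by (rule restrict_ext) (simp add: F_cl N.smult_l_minus N.l_neg)
    then show "\<exists>g\<in>?F. (\<lambda>x\<in>carrier T. g x \<oplus>\<^bsub>N\<^esub> f x) = (\<lambda>x\<in>carrier T. \<zero>\<^bsub>N\<^esub>)"
      using smult[OF F(1)] N.R.a_inv_closed[OF N.R.one_closed] by blast
  qed (rule zero)
  then show ?thesis
  proof (rule moduleI[OF N.is_cring]; unfold S)
    fix f assume F: "f \<in> ?F"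
    show "(\<lambda>x\<in>carrier T. \<one>\<^bsub>R\<^esub> \<odot>\<^bsub>N\<^esub> f x) = f"
      by (rule e[OF F, symmetric]) (simp add: cl[OF F])
  next
    fix c f assume c: "c \<in> carrier R" and F: "f \<in> ?F"
    show "(\<lambda>x\<in>carrier T. c \<odot>\<^bsub>N\<^esub> f x) \<in> ?F" by (rule smult[OF F c])
    fix d assume d: "d \<in> carrier R"
    show "(\<lambda>x\<in>carrier T. (c \<oplus>\<^bsub>R\<^esub> d) \<odot>\<^bsub>N\<^esub> f x) =
      (\<lambda>x\<in>carrier T. (\<lambda>x\<in>carrier T. c \<odot>\<^bsub>N\<^esub> f x) x \<oplus>\<^bsub>N\<^esub> (\<lambda>x\<in>carrier T. d \<odot>\<^bsub>N\<^esub> f x) x)"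
      by (rule restrict_ext) (simp add: cl[OF F] c d N.smult_l_distr)
    show "(\<lambda>x\<in>carrier T. (c \<otimes>\<^bsub>R\<^esub> d) \<odot>\<^bsub>N\<^esub> f x) =
      (\<lambda>x\<in>carrier T. c \<odot>\<^bsub>N\<^esub> (\<lambda>x\<in>carrier T. d \<odot>\<^bsub>N\<^esub> f x) x)"
      by (rule restrict_ext) (simp add: cl[OF F] c d N.smult_assoc1)
  next
    fix c f g assume c: "c \<in> carrier R" and F: "f \<in> ?F" "g \<in> ?F"
    note F_cl = F[THEN cl]
    show "(\<lambda>x\<in>carrier T. c \<odot>\<^bsub>N\<^esub> (\<lambda>x\<in>carrier T. f x \<oplus>\<^bsub>N\<^esub> g x) x) =
      (\<lambda>x\<in>carrier T. (\<lambda>x\<in>carrier T. c \<odot>\<^bsub>N\<^esub> f x) x \<oplus>\<^bsub>N\<^esub> (\<lambda>x\<in>carrier T. c \<odot>\<^bsub>N\<^esub> g x) x)"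
      by (rule restrict_ext) (simp add: F_cl c N.smult_r_distr)
  qed
qed

context hopf_algebra
begin

interpretation R: field R by (rule field)

interpretation H: ring H
  using algebra by (simp add: k_algebra_def)

section \<open>The category of partial modules\<close>

abbreviation pmod :: "('k, 'h, 'm) hmod \<Rightarrow> bool"
  where "pmod \<equiv> partial_module R H"

lemma pmod_module: "pmod M \<Longrightarrow> module R M"
  by (simp add: partial_module_def)

lemma pact_bilin: "pmod M \<Longrightarrow> bilin R H M M (act M)"
  by (simp add: partial_module_def partial_representation_def linear_action_bilin)

lemma pact_closed: "pmod M \<Longrightarrow> h \<in> carrier H \<Longrightarrow> m \<in> carrier M \<Longrightarrow> act M h m \<in> carrier M"
  by (rule bilin_closed[OF pact_bilin])

lemma PMod_simps:
  "objects (PMod R H) = {M. pmod M}" "arrows (PMod R H) = gmaps"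
  "identity (PMod R H) = (\<lambda>M. \<lambda>x\<in>carrier M. x)"
  "composition (PMod R H) = (\<lambda>M N P g f. compose (carrier M) g f)"
  by (simp_all add: PMod_def)

lemma PMod_category: "category (PMod R H :: (('k, 'h, 'm) hmod, 'm \<Rightarrow> 'm) cat)"
proof (rule category.intro; unfold PMod_simps mem_Collect_eq)
  fix W X Y Z :: "('k, 'h, 'm) hmod" and f g h
  assume f: "f \<in> gmaps W X"
  then show "compose (carrier W) f (\<lambda>x\<in>carrier W. x) = f" "compose (carrier W) (\<lambda>x\<in>carrier X. x) f = f"
    by (auto simp: compose_def module_maps_closed
        intro!: extensionalityI[OF restrict_extensional module_maps_extensional])
next
  fix W X Y Z :: "('k, 'h, 'm) hmod" and f g h
  assume "f \<in> gmaps W X" "g \<in> gmaps X Y" "h \<in> gmaps Y Z"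
  then show "compose (carrier W) (compose (carrier X) h g) f = compose (carrier W) h (compose (carrier W) g f)"
    by (auto simp: compose_def module_maps_closed fun_eq_iff)
qed (auto intro!: module_maps_id module_maps_compose simp: pmod_module pact_closed)

text \<open>The functions \<open>(h, m) \<mapsto> f (h \<otimes> m)\<close> that come from maps \<open>f\<close> of partial modules on \<open>H \<otimes> M\<close>, and for \<open>sw\<close>
  the functions \<open>(h, m) \<mapsto> f (m \<otimes> h)\<close> that come from maps on \<open>M \<otimes> H\<close>.\<close>

definition pbilin :: "bool \<Rightarrow> ('k, 'h, 'm) hmod \<Rightarrow> ('k, 'h, 'n) hmod \<Rightarrow> ('h \<Rightarrow> 'm \<Rightarrow> 'n) \<Rightarrow> bool"
  where "pbilin sw M N F \<longleftrightarrow> bilin R H M N F \<and>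
    (\<forall>h\<in>carrier H. \<forall>l\<in>carrier H. \<forall>m\<in>carrier M.
      cosum sw N (\<lambda>a b. F (a \<otimes>\<^bsub>H\<^esub> l) (act M b m)) h = act N h (F l m))"

lemma mult_left_lin: "l \<in> carrier H \<Longrightarrow> lin R H H (\<lambda>a. a \<otimes>\<^bsub>H\<^esub> l)"
  by (rule bilin_left_lin[OF mult_bilin])

lemma mult_right_lin: "l \<in> carrier H \<Longrightarrow> lin R H H (\<lambda>a. l \<otimes>\<^bsub>H\<^esub> a)"
  by (rule bilin_right_lin[OF mult_bilin])

context
  fixes sw :: bool and M N P :: "('k, 'h, 'm) hmod" and F G
  assumes M: "pmod M" and N: "pmod N" and P: "pmod P" and F: "bilin R H M N F" and G: "bilin R H N P G"
begin

lemmas mM = pmod_module[OF M] and mN = pmod_module[OF N] and mP = pmod_module[OF P]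

lemma comp_summand_bilin: "m \<in> carrier M \<Longrightarrow> bilin R H H P (\<lambda>a b. G a (F b m))"
  by (intro bilinI hopf_module mP bilin_left_lin[OF G] bilin_right[OF G] bilin_left_lin[OF F] bilin_closed[OF F])

lemma comp_bilin: "bilin R H M P (\<lambda>h m. cosum sw P (\<lambda>a b. G a (F b m)) h)"
  by (intro bilinI hopf_module mM mP cosum_lin comp_summand_bilin cosum_linI bilin_right[OF G] bilin_right_lin[OF F])

text \<open>This serves two purposes: the composite respects the partial action, where
  \<open>l\<close> is the tensor factor acted upon, and composition respects the action on
  Hom-objects, where \<open>l\<close> is the acting element.\<close>

lemma comp_mult:
  assumes "h \<in> carrier H" "l \<in> carrier H" "m \<in> carrier M"
  shows "cosum sw P (\<lambda>a b. G a (F b m)) (h \<otimes>\<^bsub>H\<^esub> l) =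
    cosum sw P (\<lambda>a b. cosum sw P (\<lambda>a' b'. G (a \<otimes>\<^bsub>H\<^esub> a') (F (b \<otimes>\<^bsub>H\<^esub> b') m)) l) h"
  by (rule cosum_mult[OF comp_summand_bilin assms(1,2)]) fact

end

text \<open>For \<open>H \<otimes> M\<close> the calculation reads \<open>G (h\<^sub>1l\<^sub>1) (F
  (h\<^sub>2l\<^sub>2) (h\<^sub>3m)) = G (h\<^sub>1l\<^sub>1) (h\<^sub>2 (F l\<^sub>2 m)) = h (G
  l\<^sub>1 (F l\<^sub>2 m))\<close>: equivariance of \<open>F\<close> absorbs the last two legs of
  \<open>h\<close>, then equivariance of \<open>G\<close> the two that remain.\<close>

lemma pbilin_comp:
  fixes M N P :: "('k, 'h, 'm) hmod"
  assumes M: "pmod M" and N: "pmod N" and P: "pmod P" and pF: "pbilin sw M N F" and pG: "pbilin sw N P G"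
  shows "pbilin sw M P (\<lambda>h m. cosum sw P (\<lambda>a b. G a (F b m)) h)"
  unfolding pbilin_def
proof (intro conjI ballI)
  have F: "bilin R H M N F" and G: "bilin R H N P G" using pF pG by (auto simp: pbilin_def)
  note cb = comp_bilin[OF M N P F G] note mP = pmod_module[OF P]
  show "bilin R H M P (\<lambda>h m. cosum sw P (\<lambda>a b. G a (F b m)) h)" by (rule cb)
  fix h l m assume h: "h \<in> carrier H" and l: "l \<in> carrier H" and m: "m \<in> carrier M"
  let ?S = "\<lambda>f. cosum sw P f"
  note cl = H.m_closed bilin_closed[OF F] bilin_closed[OF G] pact_closed[OF M] m l
  \<comment> \<open>The sum over the legs of \<open>l\<close> is kept inside, so that
    \<open>A\<close> depends on the three legs of \<open>h\<close> only and coassociativity can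
    rebracket them.\<close>
  define A where "A = (\<lambda>a b d. ?S (\<lambda>a' b'. G (a \<otimes>\<^bsub>H\<^esub> a') (F (b \<otimes>\<^bsub>H\<^esub> b') (act M d m))) l)"
  have A: "trilin R H H H P A"
    unfolding A_def
    by (intro trilinI hopf_module mP cosum_linI l bilin_left[OF G] bilin_right[OF G] bilin_left[OF F] bilin_right[OF F]
        mult_left_lin bilin_left_lin[OF pact_bilin[OF M]] cl)
  have "?S (\<lambda>a b. ?S (\<lambda>a' b'. G a' (F b' (act M b m))) (a \<otimes>\<^bsub>H\<^esub> l)) h = ?S (\<lambda>a b. ?S (\<lambda>a' a''. A a' a'' b) a) h"
    unfolding A_def by (intro cosum_cong h comp_mult[OF M N P F G] cl)
  also have "\<dots> = ?S (\<lambda>a b. ?S (\<lambda>b' b''. A a b' b'') b) h"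
    by (rule cosum_coassoc[OF A h])
  also have "\<dots> = ?S (\<lambda>a b. ?S (\<lambda>a' b'. G (a \<otimes>\<^bsub>H\<^esub> a') (act N b (F b' m))) l) h"
  proof (intro cosum_cong h)
    fix a b assume a: "a \<in> carrier H" and b: "b \<in> carrier H"
    \<comment> \<open>The sum over the legs of \<open>b\<close> must be innermost before it can be
      drawn into the second argument of \<open>G\<close>, where equivariance of \<open>F\<close>
      applies.\<close>
    have "?S (\<lambda>c d. A a c d) b = ?S (\<lambda>a' b'. ?S (\<lambda>c d. G (a \<otimes>\<^bsub>H\<^esub> a') (F (c \<otimes>\<^bsub>H\<^esub> b') (act M d m))) b) l"
      unfolding A_def by (intro cosum_exchange mP a b cl)
    also have "\<dots> = ?S (\<lambda>a' b'. G (a \<otimes>\<^bsub>H\<^esub> a') (act N b (F b' m))) l"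
    proof (intro cosum_cong l)
      fix a' b' assume a': "a' \<in> carrier H" and b': "b' \<in> carrier H"
      have "G (a \<otimes>\<^bsub>H\<^esub> a') (act N b (F b' m)) = G (a \<otimes>\<^bsub>H\<^esub> a') (cosum sw N (\<lambda>c d. F (c \<otimes>\<^bsub>H\<^esub> b') (act M d m)) b)"
        using pF b b' m by (simp add: pbilin_def)
      also have "\<dots> = ?S (\<lambda>c d. G (a \<otimes>\<^bsub>H\<^esub> a') (F (c \<otimes>\<^bsub>H\<^esub> b') (act M d m))) b"
        by (rule lin_cosum[OF bilin_right_lin[OF G H.m_closed[OF a a']] b]) (intro cl b')
      finally show "?S (\<lambda>c d. G (a \<otimes>\<^bsub>H\<^esub> a') (F (c \<otimes>\<^bsub>H\<^esub> b') (act M d m))) b = G (a \<otimes>\<^bsub>H\<^esub> a') (act N b (F b' m))" by simp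
    qed
    finally show "?S (\<lambda>c d. A a c d) b = ?S (\<lambda>a' b'. G (a \<otimes>\<^bsub>H\<^esub> a') (act N b (F b' m))) l" .
  qed
  \<comment> \<open>The same exchange once more, now to apply equivariance of
    \<open>G\<close>.\<close>
  also have "\<dots> = ?S (\<lambda>a' b'. ?S (\<lambda>a b. G (a \<otimes>\<^bsub>H\<^esub> a') (act N b (F b' m))) h) l"
    by (intro cosum_exchange mP h cl pact_closed[OF N])
  also have "\<dots> = ?S (\<lambda>a' b'. act P h (G a' (F b' m))) l"
    using pG h by (intro cosum_cong l) (simp add: pbilin_def cl)
  also have "\<dots> = act P h (?S (\<lambda>a' b'. G a' (F b' m)) l)"
    by (rule lin_cosum[OF bilin_right_lin[OF pact_bilin[OF P] h] l, symmetric]) (intro cl)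
  finally show "?S (\<lambda>a b. ?S (\<lambda>a' b'. G a' (F b' (act M b m))) (a \<otimes>\<^bsub>H\<^esub> l)) h = act P h (?S (\<lambda>a' b'. G a' (F b' m)) l)" .
qed

text \<open>The extension of an ordinary morphism to an element of the Hom-object, inverse to
  evaluation at the unit of \<open>H\<close>; the identity morphism yields the enriched
  unit.\<close>

lemma pbilin_of_map:
  fixes M N :: "('k, 'h, 'm) hmod"
  assumes M: "pmod M" and N: "pmod N" and f: "f \<in> gmaps M N"
  shows "pbilin sw M N (\<lambda>h m. counit H h \<odot>\<^bsub>N\<^esub> f m)"
  unfolding pbilin_def
proof (intro conjI ballI)
  interpret N: module R N by (rule pmod_module[OF N])
  note mM = pmod_module[OF M] and mN = pmod_module[OF N]
  note lf = module_maps_lin[OF f mM mN]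
  show "bilin R H M N (\<lambda>h m. counit H h \<odot>\<^bsub>N\<^esub> f m)"
    by (intro bilinI hopf_module mM mN lin_smultI counit_closed lf bilin_left[OF bilin_smult[OF mN]] counit_lin
        lin_closed[OF lf])
  fix h l m assume h: "h \<in> carrier H" and l: "l \<in> carrier H" and m: "m \<in> carrier M"
  have L: "lin R H N (\<lambda>b. counit H l \<odot>\<^bsub>N\<^esub> f (act M b m))"
    by (intro lin_smultI counit_closed l lin_comp[OF lf] bilin_left_lin[OF pact_bilin[OF M]] m)
  have "cosum sw N (\<lambda>a b. counit H (a \<otimes>\<^bsub>H\<^esub> l) \<odot>\<^bsub>N\<^esub> f (act M b m)) h =
    cosum sw N (\<lambda>a b. counit H a \<odot>\<^bsub>N\<^esub> (counit H l \<odot>\<^bsub>N\<^esub> f (act M b m))) h"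
    by (intro cosum_cong h)
      (simp add: counit_mult l counit_closed N.smult_assoc1 lin_closed[OF lf] pact_closed[OF M] m)
  also have "\<dots> = counit H l \<odot>\<^bsub>N\<^esub> f (act M h m)" by (rule cosum_counit(1)[OF L h])
  also have "\<dots> = act N h (counit H l \<odot>\<^bsub>N\<^esub> f m)"
    using lin_smult[OF bilin_right_lin[OF pact_bilin[OF N] h] counit_closed[OF l] lin_closed[OF lf m]]
    by (simp add: module_maps_act[OF f h m])
  finally show "cosum sw N (\<lambda>a b. counit H (a \<otimes>\<^bsub>H\<^esub> l) \<odot>\<^bsub>N\<^esub> f (act M b m)) h = act N h (counit H l \<odot>\<^bsub>N\<^esub> f m)" .
qed

end

text \<open>The data common to \<open>H \<otimes> M\<close> and \<open>M \<otimes> H\<close>: the module \<open>T M\<close> with its pure tensors \<open>pt M h m\<close> and the map \<open>rm M h'\<close>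
  that multiplies the tensor factor in \<open>H\<close> by \<open>h'\<close> from the right.\<close>

locale hom_side = hopf_algebra R H
  for R :: "('k, 'r) ring_scheme" and H :: "('k, 'h, 'z) hopf_scheme" +
  fixes sw :: bool and T :: "('k, 'h, 'm) hmod \<Rightarrow> ('k, 'h, 't) hmod"
    and pt :: "('k, 'h, 'm) hmod \<Rightarrow> 'h \<Rightarrow> 'm \<Rightarrow> 't" and rm :: "('k, 'h, 'm) hmod \<Rightarrow> 'h \<Rightarrow> 't \<Rightarrow> 't"
    and ho :: "('k, 'h, 'm) hmod \<Rightarrow> ('k, 'h, 'm) hmod \<Rightarrow> ('k, 'h, 't \<Rightarrow> 'm) umod"
  assumes pt_bilin: "pmod M \<Longrightarrow> bilin R H M (T M) (pt M)"
    and pt_lift: "pmod M \<Longrightarrow> bilin R H M N F \<Longrightarrow> \<exists>\<phi>. lin R (T M) N \<phi> \<and>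
      (\<forall>h\<in>carrier H. \<forall>m\<in>carrier M. \<phi> (pt M h m) = F h m)"
    and pt_ext: "pmod M \<Longrightarrow> lin R (T M) N \<phi> \<Longrightarrow> lin R (T M) N \<psi> \<Longrightarrow> t \<in> carrier (T M) \<Longrightarrow>
      (\<And>h m. h \<in> carrier H \<Longrightarrow> m \<in> carrier M \<Longrightarrow> \<phi> (pt M h m) = \<psi> (pt M h m)) \<Longrightarrow> \<phi> t = \<psi> t"
    and T_act_lin: "pmod M \<Longrightarrow> h \<in> carrier H \<Longrightarrow> lin R (T M) (T M) (act (T M) h)"
    and T_act: "pmod M \<Longrightarrow> h \<in> carrier H \<Longrightarrow> l \<in> carrier H \<Longrightarrow> m \<in> carrier M \<Longrightarrow>
      act (T M) h (pt M l m) = cosum sw (T M) (\<lambda>a b. pt M (a \<otimes>\<^bsub>H\<^esub> l) (act M b m)) h"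
    and rm_lin: "pmod M \<Longrightarrow> h \<in> carrier H \<Longrightarrow> lin R (T M) (T M) (rm M h)"
    and rm_pt: "pmod M \<Longrightarrow> h \<in> carrier H \<Longrightarrow> l \<in> carrier H \<Longrightarrow> m \<in> carrier M \<Longrightarrow>
      rm M h (pt M l m) = pt M (l \<otimes>\<^bsub>H\<^esub> h) m"
    and ho_def: "ho M N = with_action (relabel Atom unatom (map_space (T M) N (gmaps (T M) N)))
      (\<lambda>h. \<lambda>u\<in>Atom ` gmaps (T M) N. Atom (\<lambda>t\<in>carrier (T M). unatom u (rm M h t)))"
begin

interpretation R: field R by (rule field)

interpretation H: ring H
  using algebra by (simp add: k_algebra_def)

text \<open>By \<open>ev_eqI\<close> and \<open>ev_exists\<close> the Hom-object is, through
  \<open>ev\<close>, the space of all functions satisfying \<open>pbilin\<close>; in this form both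
  kinds of Hom-object look the same.\<close>

definition ev :: "('k, 'h, 'm) hmod \<Rightarrow> ('k, 't \<Rightarrow> 'm) univ \<Rightarrow> 'h \<Rightarrow> 'm \<Rightarrow> 'm"
  where "ev M u h m = unatom u (pt M h m)"

lemma T_module: "pmod M \<Longrightarrow> module R (T M)"
  by (rule bilin_modules(3)[OF pt_bilin])

lemma pt_closed: "pmod M \<Longrightarrow> h \<in> carrier H \<Longrightarrow> m \<in> carrier M \<Longrightarrow> pt M h m \<in> carrier (T M)"
  by (rule bilin_closed[OF pt_bilin])

lemma ho_carrier: "carrier (ho M N) = Atom ` gmaps (T M) N"
  by (simp add: ho_def relabel_def map_space_def)

context
  fixes M N :: "('k, 'h, 'm) hmod"
  assumes M: "pmod M" and N: "pmod N"
begin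

lemmas mM = pmod_module[OF M] and mN = pmod_module[OF N] and mT = T_module[OF M]

lemma ho_module: "module R (ho M N)"
  unfolding ho_def
  by (intro module_with_action module_relabel map_space_module mT mN bilin_right_lin[OF pact_bilin[OF N]]
      lin_closed[OF T_act_lin[OF M]]) simp_all

lemma ev_pbilin:
  assumes u: "u \<in> carrier (ho M N)" shows "pbilin sw M N (ev M u)"
  unfolding pbilin_def
proof (intro conjI ballI)
  obtain \<phi> where \<phi>: "u = Atom \<phi>" "\<phi> \<in> gmaps (T M) N" using u by (auto simp: ho_carrier)
  note l\<phi> = module_maps_lin[OF \<phi>(2) mT mN]
  show "bilin R H M N (ev M u)"
    unfolding ev_def[abs_def] \<phi>(1) univ.sel by (rule bilin_comp[OF l\<phi> pt_bilin[OF M]])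
  fix h l m assume h: "h \<in> carrier H" and l: "l \<in> carrier H" and m: "m \<in> carrier M"
  have "act N h (ev M u l m) = \<phi> (act (T M) h (pt M l m))"
    by (simp add: ev_def \<phi>(1) module_maps_act[OF \<phi>(2) h pt_closed[OF M l m]])
  also have "\<dots> = cosum sw N (\<lambda>a b. ev M u (a \<otimes>\<^bsub>H\<^esub> l) (act M b m)) h"
    unfolding T_act[OF M h l m] ev_def \<phi>(1) univ.sel
    by (rule lin_cosum[OF l\<phi> h]) (intro pt_closed M H.m_closed l pact_closed m)
  finally show "cosum sw N (\<lambda>a b. ev M u (a \<otimes>\<^bsub>H\<^esub> l) (act M b m)) h = act N h (ev M u l m)" by simp
qed

lemma ev_bilin: "u \<in> carrier (ho M N) \<Longrightarrow> bilin R H M N (ev M u)"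
  using ev_pbilin by (simp add: pbilin_def)

lemma ev_closed: "u \<in> carrier (ho M N) \<Longrightarrow> h \<in> carrier H \<Longrightarrow> m \<in> carrier M \<Longrightarrow> ev M u h m \<in> carrier N"
  by (rule bilin_closed[OF ev_bilin])

lemma ev_eqI:
  assumes "u \<in> carrier (ho M N)" "v \<in> carrier (ho M N)"
    "\<And>h m. h \<in> carrier H \<Longrightarrow> m \<in> carrier M \<Longrightarrow> ev M u h m = ev M v h m"
  shows "u = v"
proof -
  obtain \<phi> \<psi> where p: "u = Atom \<phi>" "\<phi> \<in> gmaps (T M) N" "v = Atom \<psi>" "\<psi> \<in> gmaps (T M) N"
    using assms(1,2) by (auto simp: ho_carrier)
  have "\<phi> = \<psi>"
  proof (rule module_maps_eqI[OF p(2,4)])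
    show "\<phi> t = \<psi> t" if "t \<in> carrier (T M)" for t
      by (rule pt_ext[OF M module_maps_lin[OF p(2) mT mN] module_maps_lin[OF p(4) mT mN] that])
        (use assms(3) in \<open>simp add: ev_def p\<close>)
  qed
  then show ?thesis by (simp add: p)
qed

lemma ev_exists:
  assumes F: "pbilin sw M N F"
  shows "\<exists>u. u \<in> carrier (ho M N) \<and> (\<forall>h\<in>carrier H. \<forall>m\<in>carrier M. ev M u h m = F h m)"
proof -
  have b: "bilin R H M N F" using F by (simp add: pbilin_def)
  obtain \<phi> where \<phi>: "lin R (T M) N \<phi>" "\<And>h m. h \<in> carrier H \<Longrightarrow> m \<in> carrier M \<Longrightarrow> \<phi> (pt M h m) = F h m"
    using pt_lift[OF M b] by auto
  let ?\<phi> = "\<lambda>t\<in>carrier (T M). \<phi> t"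
  note l = lin_restrict[OF \<phi>(1)]
  have "?\<phi> \<in> gmaps (T M) N"
  proof (rule module_mapsI[OF l restrict_extensional])
    fix h t assume h: "h \<in> carrier H" and t: "t \<in> carrier (T M)"
    note aN = bilin_right_lin[OF pact_bilin[OF N] h]
    show "?\<phi> (act (T M) h t) = act N h (?\<phi> t)"
    proof (rule pt_ext[OF M lin_comp[OF l T_act_lin[OF M h]] lin_comp[OF aN l] t])
      fix k m assume k: "k \<in> carrier H" and m: "m \<in> carrier M"
      note c = pt_closed[OF M H.m_closed[OF _ k] pact_closed[OF M _ m]]
      have "?\<phi> (act (T M) h (pt M k m)) = cosum sw N (\<lambda>a b. ?\<phi> (pt M (a \<otimes>\<^bsub>H\<^esub> k) (act M b m))) h"
        unfolding T_act[OF M h k m] by (rule lin_cosum[OF l h]) (intro c)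
      also have "\<dots> = cosum sw N (\<lambda>a b. F (a \<otimes>\<^bsub>H\<^esub> k) (act M b m)) h"
        by (intro cosum_cong h) (simp add: c \<phi>(2) k pact_closed[OF M] m)
      also have "\<dots> = act N h (F k m)" using F h k m by (simp add: pbilin_def)
      finally show "?\<phi> (act (T M) h (pt M k m)) = act N h (?\<phi> (pt M k m))"
        by (simp add: pt_closed M k m \<phi>(2))
    qed
  qed
  then show ?thesis
    by (intro exI[of _ "Atom ?\<phi>"]) (simp add: ho_carrier ev_def pt_closed M \<phi>(2))
qed

lemma ev_lin: "h \<in> carrier H \<Longrightarrow> m \<in> carrier M \<Longrightarrow> lin R (ho M N) N (\<lambda>u. ev M u h m)"
proof (rule linI[OF ho_module mN])
  fix u v c assume "h \<in> carrier H" "m \<in> carrier M"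
  then have c: "pt M h m \<in> carrier (T M)" by (rule pt_closed[OF M])
  show "ev M (u \<oplus>\<^bsub>ho M N\<^esub> v) h m = ev M u h m \<oplus>\<^bsub>N\<^esub> ev M v h m"
    "ev M (c \<odot>\<^bsub>ho M N\<^esub> u) h m = c \<odot>\<^bsub>N\<^esub> ev M u h m"
    by (simp_all add: ev_def ho_def relabel_def map_space_def c)
qed (rule ev_closed)

text \<open>Multiplying the factor in \<open>H\<close> from the right commutes with the action,
  which multiplies it from the left; so composing with it preserves equivariance.\<close>

lemma ho_act_closed:
  assumes h: "h \<in> carrier H" and u: "u \<in> carrier (ho M N)"
  shows "act (ho M N) h u \<in> carrier (ho M N)"
proof -
  obtain \<phi> where \<phi>: "u = Atom \<phi>" "\<phi> \<in> gmaps (T M) N" using u by (auto simp: ho_carrier)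
  note l\<phi> = module_maps_lin[OF \<phi>(2) mT mN]
  note l = lin_restrict[OF lin_comp[OF l\<phi> rm_lin[OF M h]]]
  let ?\<psi> = "\<lambda>t\<in>carrier (T M). \<phi> (rm M h t)"
  have "?\<psi> \<in> gmaps (T M) N"
  proof (rule module_mapsI[OF l restrict_extensional])
    fix k t assume k: "k \<in> carrier H" and t: "t \<in> carrier (T M)"
    note aN = bilin_right_lin[OF pact_bilin[OF N] k]
    show "?\<psi> (act (T M) k t) = act N k (?\<psi> t)"
    proof (rule pt_ext[OF M lin_comp[OF l T_act_lin[OF M k]] lin_comp[OF aN l] t])
      fix j m assume j: "j \<in> carrier H" and m: "m \<in> carrier M"
      note c = pt_closed[OF M H.m_closed[OF _ j] pact_closed[OF M _ m]]
      have "rm M h (act (T M) k (pt M j m)) = cosum sw (T M) (\<lambda>a b. rm M h (pt M (a \<otimes>\<^bsub>H\<^esub> j) (act M b m))) k"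
        unfolding T_act[OF M k j m] by (rule lin_cosum[OF rm_lin[OF M h] k]) (intro c)
      also have "\<dots> = cosum sw (T M) (\<lambda>a b. pt M (a \<otimes>\<^bsub>H\<^esub> (j \<otimes>\<^bsub>H\<^esub> h)) (act M b m)) k"
        by (intro cosum_cong k) (simp add: rm_pt M h j pact_closed m H.m_assoc)
      also have "\<dots> = act (T M) k (pt M (j \<otimes>\<^bsub>H\<^esub> h) m)"
        by (simp add: T_act M k j h m)
      finally have "\<phi> (rm M h (act (T M) k (pt M j m))) = act N k (\<phi> (pt M (j \<otimes>\<^bsub>H\<^esub> h) m))"
        using module_maps_act[OF \<phi>(2) k pt_closed[OF M H.m_closed[OF j h] m]] by simp
      then show "?\<psi> (act (T M) k (pt M j m)) = act N k (?\<psi> (pt M j m))"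
        by (simp add: lin_closed[OF T_act_lin[OF M k]] pt_closed M j m rm_pt h)
    qed
  qed
  then show ?thesis using \<phi> by (simp add: ho_def ho_carrier relabel_def map_space_def)
qed

lemma ev_act:
  assumes "h \<in> carrier H" "u \<in> carrier (ho M N)" "k \<in> carrier H" "m \<in> carrier M"
  shows "ev M (act (ho M N) h u) k m = ev M u (k \<otimes>\<^bsub>H\<^esub> h) m"
  using assms by (auto simp: ev_def ho_def relabel_def map_space_def pt_closed M rm_pt)

text \<open>Right multiplication in the argument becomes a left action on functions. All axioms are
  compared on values by \<open>ev_eqI\<close>, where multiplicativity is the associativity of
  \<open>H\<close>.\<close>

lemma ho_gmod: "gmod (ho M N)"
proof (rule global_moduleI[OF ho_module])
  note mb = bilin_right_lin[OF mult_bilin]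
  note a = ho_module abelian_monoid.a_closed[OF module_abelian_monoid[OF ho_module]] module.smult_closed[OF ho_module]
    ho_act_closed module.smult_closed[OF hopf_module]
  note s = ev_act lin_add[OF ev_lin] lin_smult[OF ev_lin]
  show "bilin R H (ho M N) (ho M N) (act (ho M N))"
  proof (rule bilinI[OF hopf_module ho_module ho_module])
    show "lin R (ho M N) (ho M N) (\<lambda>u. act (ho M N) h u)" if "h \<in> carrier H" for h
      using that by (intro linI a ev_eqI) (simp_all add: a s)
    show "lin R H (ho M N) (\<lambda>h. act (ho M N) h u)" if u: "u \<in> carrier (ho M N)" for u
    proof -
      have l: "lin R H N (\<lambda>h. ev M u (k \<otimes>\<^bsub>H\<^esub> h) m)" if "k \<in> carrier H" "m \<in> carrier M" for k m
        using that by (intro bilin_left[OF ev_bilin[OF u]] mult_right_lin)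
      show ?thesis
        using u by (intro linI a hopf_module ev_eqI) (simp_all add: a s lin_add[OF l] lin_smult[OF l])
    qed
  qed
  show "act (ho M N) h \<in> extensional (carrier (ho M N))" for h
    unfolding ho_carrier by (simp add: ho_def)
  show "act (ho M N) (h \<otimes>\<^bsub>H\<^esub> l) u = act (ho M N) h (act (ho M N) l u)"
    if "h \<in> carrier H" "l \<in> carrier H" "u \<in> carrier (ho M N)" for h l u
    using that by (intro ev_eqI a) (simp_all add: a s H.m_assoc)
  show "act (ho M N) \<one>\<^bsub>H\<^esub> u = u" if "u \<in> carrier (ho M N)" for u
    using that by (intro ev_eqI a) (simp_all add: a s)
qed

text \<open>The inverse of \<open>ev\<close>; by \<open>ev_eqI\<close> the choice is between equal
  elements.\<close>

definition of_pbilin :: "('h \<Rightarrow> 'm \<Rightarrow> 'm) \<Rightarrow> ('k, 't \<Rightarrow> 'm) univ"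
  where "of_pbilin F = (SOME u. u \<in> carrier (ho M N) \<and> (\<forall>h\<in>carrier H. \<forall>m\<in>carrier M. ev M u h m = F h m))"

lemma of_pbilin_closed: "pbilin sw M N F \<Longrightarrow> of_pbilin F \<in> carrier (ho M N)"
  unfolding of_pbilin_def using someI_ex[OF ev_exists] by blast

lemma ev_of_pbilin:
  "pbilin sw M N F \<Longrightarrow> h \<in> carrier H \<Longrightarrow> m \<in> carrier M \<Longrightarrow> ev M (of_pbilin F) h m = F h m"
  unfolding of_pbilin_def using someI_ex[OF ev_exists] by blast

end

text \<open>On \<open>M \<otimes> H\<close>, where the legs arrive in exchanged order, this is
  \<open>m \<otimes> h \<mapsto> g (f (m \<otimes> h\<^sub>1) \<otimes> h\<^sub>2)\<close>.\<close>

definition hcomp ::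
  "('k, 'h, 'm) hmod \<Rightarrow> ('k, 'h, 'm) hmod \<Rightarrow> ('k, 'h, 'm) hmod \<Rightarrow>
   ('k, 't \<Rightarrow> 'm) univ \<Rightarrow> ('k, 't \<Rightarrow> 'm) univ \<Rightarrow> ('k, 't \<Rightarrow> 'm) univ"
  where "hcomp M N P g f = of_pbilin M P (\<lambda>h m. cosum sw P (\<lambda>a b. ev N g a (ev M f b m)) h)"

text \<open>The restricted identity function is left unsimplified to make this an instance of
  \<open>pbilin_of_map\<close>; invariance then comes from \<open>of_map_invariant\<close>.\<close>

definition hid :: "('k, 'h, 'm) hmod \<Rightarrow> ('k, 't \<Rightarrow> 'm) univ"
  where "hid M = of_pbilin M M (\<lambda>h m. counit H h \<odot>\<^bsub>M\<^esub> (\<lambda>x\<in>carrier M. x) m)"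

definition underlying_map :: "('k, 'h, 'm) hmod \<Rightarrow> ('k, 't \<Rightarrow> 'm) univ \<Rightarrow> 'm \<Rightarrow> 'm"
  where "underlying_map M u = (\<lambda>m\<in>carrier M. ev M u \<one>\<^bsub>H\<^esub> m)"

lemma pmaps_id: "pmod M \<Longrightarrow> (\<lambda>x\<in>carrier M. x) \<in> gmaps M M"
  by (rule module_maps_id) (auto simp: pmod_module pact_closed)

lemma hid_closed: "pmod M \<Longrightarrow> hid M \<in> carrier (ho M M)"
  unfolding hid_def by (intro of_pbilin_closed pbilin_of_map pmaps_id)

lemma ev_hid: "pmod M \<Longrightarrow> h \<in> carrier H \<Longrightarrow> m \<in> carrier M \<Longrightarrow> ev M (hid M) h m = counit H h \<odot>\<^bsub>M\<^esub> m"
  using ev_of_pbilin[OF _ _ pbilin_of_map[OF _ _ pmaps_id], of M] by (simp add: hid_def)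

context
  fixes M N P :: "('k, 'h, 'm) hmod"
  assumes M: "pmod M" and N: "pmod N" and P: "pmod P"
begin

lemma hcomp_pbilin:
  "g \<in> carrier (ho N P) \<Longrightarrow> f \<in> carrier (ho M N) \<Longrightarrow>
   pbilin sw M P (\<lambda>h m. cosum sw P (\<lambda>a b. ev N g a (ev M f b m)) h)"
  by (rule pbilin_comp[OF M N P ev_pbilin[OF M N] ev_pbilin[OF N P]])

lemma hcomp_closed: "g \<in> carrier (ho N P) \<Longrightarrow> f \<in> carrier (ho M N) \<Longrightarrow> hcomp M N P g f \<in> carrier (ho M P)"
  unfolding hcomp_def by (rule of_pbilin_closed[OF M P hcomp_pbilin])

lemma ev_hcomp:
  "g \<in> carrier (ho N P) \<Longrightarrow> f \<in> carrier (ho M N) \<Longrightarrow> h \<in> carrier H \<Longrightarrow> m \<in> carrier M \<Longrightarrow>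
   ev M (hcomp M N P g f) h m = cosum sw P (\<lambda>a b. ev N g a (ev M f b m)) h"
  unfolding hcomp_def by (rule ev_of_pbilin[OF M P hcomp_pbilin])

lemma hcomp_bilin: "bilin R (ho N P) (ho M N) (ho M P) (hcomp M N P)"
proof (rule bilinI[OF ho_module[OF N P] ho_module[OF M N] ho_module[OF M P]])
  note mods = ho_module[OF M N] ho_module[OF N P] ho_module[OF M P]
  note a = hcomp_closed mods[THEN module_abelian_monoid, THEN abelian_monoid.a_closed] mods[THEN module.smult_closed]
  note s = ev_hcomp lin_add[OF ev_lin[OF M P]] lin_smult[OF ev_lin[OF M P]]
  show "lin R (ho M N) (ho M P) (\<lambda>f. hcomp M N P g f)" if g: "g \<in> carrier (ho N P)" for g
  proof -
    have l: "lin R (ho M N) P (\<lambda>f. cosum sw P (\<lambda>a b. ev N g a (ev M f b m)) h)"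
      if "h \<in> carrier H" "m \<in> carrier M" for h m
      using that
      by (intro cosum_linI ho_module M N pmod_module P bilin_right[OF ev_bilin[OF N P g]] ev_lin)
    show ?thesis
      using g by (intro linI mods a ev_eqI[OF M P]) (simp_all add: a s lin_add[OF l] lin_smult[OF l])
  qed
  show "lin R (ho N P) (ho M P) (\<lambda>g. hcomp M N P g f)" if f: "f \<in> carrier (ho M N)" for f
  proof -
    have l: "lin R (ho N P) P (\<lambda>g. cosum sw P (\<lambda>a b. ev N g a (ev M f b m)) h)"
      if "h \<in> carrier H" "m \<in> carrier M" for h m
      using that
      by (intro cosum_linI ho_module N pmod_module P ev_lin ev_closed[OF M N f])
    show ?thesis
      using f by (intro linI mods a ev_eqI[OF M P]) (simp_all add: a s lin_add[OF l] lin_smult[OF l])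
  qed
qed

text \<open>At \<open>k\<close> and \<open>m\<close> the legs of \<open>h\<close> multiply those of
  \<open>k\<close> from the right, and multiplicativity of the comultiplication collects them into
  the value of the composite at \<open>kh\<close>. The legs of \<open>h\<close> are distributed with
  the same flag, so for \<open>sw\<close> the first leg acts on \<open>f\<close>: composition is
  then equivariant on \<open>{M, N} \<otimes> {N, P}\<close>.\<close>

lemma hcomp_act:
  assumes h: "h \<in> carrier H" and g: "g \<in> carrier (ho N P)" and f: "f \<in> carrier (ho M N)"
  shows "cosum sw (ho M P) (\<lambda>a b. hcomp M N P (act (ho N P) a g) (act (ho M N) b f)) h =
    act (ho M P) h (hcomp M N P g f)"
proof (rule ev_eqI[OF M P])
  note ga = ho_act_closed[OF N P _ g] and fa = ho_act_closed[OF M N _ f]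
  show "cosum sw (ho M P) (\<lambda>a b. hcomp M N P (act (ho N P) a g) (act (ho M N) b f)) h \<in> carrier (ho M P)"
    by (intro cosum_closed ho_module M P h hcomp_closed ga fa)
  show "act (ho M P) h (hcomp M N P g f) \<in> carrier (ho M P)"
    by (intro ho_act_closed M P h hcomp_closed g f)
  fix k m assume k: "k \<in> carrier H" and m: "m \<in> carrier M"
  note c = ev_closed[OF N P g] ev_closed[OF M N f] H.m_closed m k
  have "ev M (cosum sw (ho M P) (\<lambda>a b. hcomp M N P (act (ho N P) a g) (act (ho M N) b f)) h) k m =
    cosum sw P (\<lambda>a b. ev M (hcomp M N P (act (ho N P) a g) (act (ho M N) b f)) k m) h"
    by (rule lin_cosum[OF ev_lin[OF M P k m] h]) (intro hcomp_closed ga fa)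
  also have "\<dots> = cosum sw P (\<lambda>a b. cosum sw P (\<lambda>a' b'. ev N g (a' \<otimes>\<^bsub>H\<^esub> a) (ev M f (b' \<otimes>\<^bsub>H\<^esub> b) m)) k) h"
  proof (intro cosum_cong h)
    fix a b assume a: "a \<in> carrier H" and b: "b \<in> carrier H"
    show "ev M (hcomp M N P (act (ho N P) a g) (act (ho M N) b f)) k m =
      cosum sw P (\<lambda>a' b'. ev N g (a' \<otimes>\<^bsub>H\<^esub> a) (ev M f (b' \<otimes>\<^bsub>H\<^esub> b) m)) k"
      unfolding ev_hcomp[OF ga[OF a] fa[OF b] k m]
      by (intro cosum_cong k) (simp add: ev_act M N P g f a b c)
  qed
  also have "\<dots> = cosum sw P (\<lambda>a' b'. cosum sw P (\<lambda>a b. ev N g (a' \<otimes>\<^bsub>H\<^esub> a) (ev M f (b' \<otimes>\<^bsub>H\<^esub> b) m)) h) k"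
    by (intro cosum_exchange pmod_module P h c)
  also have "\<dots> = cosum sw P (\<lambda>a b. ev N g a (ev M f b m)) (k \<otimes>\<^bsub>H\<^esub> h)"
    by (rule comp_mult[OF M N P ev_bilin[OF M N f] ev_bilin[OF N P g] k h m, symmetric])
  also have "\<dots> = ev M (act (ho M P) h (hcomp M N P g f)) k m"
    by (simp add: ev_act M P hcomp_closed g f h k m ev_hcomp)
  finally show "ev M (cosum sw (ho M P) (\<lambda>a b. hcomp M N P (act (ho N P) a g) (act (ho M N) b f)) h) k m =
    ev M (act (ho M P) h (hcomp M N P g f)) k m" .
qed

end

text \<open>Both sides apply \<open>f\<close>, \<open>g\<close> and \<open>e\<close> in turn to the
  three legs of \<open>h\<close>; they differ only in how these legs are produced, which is
  coassociativity.\<close>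

lemma hcomp_assoc:
  assumes L: "pmod L" and M: "pmod M" and N: "pmod N" and P: "pmod P"
    and e: "e \<in> carrier (ho N P)" and g: "g \<in> carrier (ho M N)" and f: "f \<in> carrier (ho L M)"
  shows "hcomp L M P (hcomp M N P e g) f = hcomp L N P e (hcomp L M N g f)"
proof (rule ev_eqI[OF L P])
  note eg = hcomp_closed[OF M N P e g] and gf = hcomp_closed[OF L M N g f]
  show "hcomp L M P (hcomp M N P e g) f \<in> carrier (ho L P)" by (rule hcomp_closed[OF L M P eg f])
  show "hcomp L N P e (hcomp L M N g f) \<in> carrier (ho L P)" by (rule hcomp_closed[OF L N P e gf])
  fix h m assume h: "h \<in> carrier H" and m: "m \<in> carrier L"
  note c = ev_closed[OF L M f] ev_closed[OF M N g] m
  have t: "trilin R H H H P (\<lambda>a b d. ev N e a (ev M g b (ev L f d m)))"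
    by (intro trilinI hopf_module pmod_module P bilin_left_lin[OF ev_bilin[OF N P e]]
        bilin_right[OF ev_bilin[OF N P e]] bilin_left_lin[OF ev_bilin[OF M N g]] bilin_right[OF ev_bilin[OF M N g]]
        bilin_left_lin[OF ev_bilin[OF L M f]] c)
  have "ev L (hcomp L M P (hcomp M N P e g) f) h m =
    cosum sw P (\<lambda>a b. cosum sw P (\<lambda>a' a''. ev N e a' (ev M g a'' (ev L f b m))) a) h"
    unfolding ev_hcomp[OF L M P eg f h m]
    by (intro cosum_cong h) (simp add: ev_hcomp[OF M N P e g] c)
  also have "\<dots> = cosum sw P (\<lambda>a b. cosum sw P (\<lambda>b' b''. ev N e a (ev M g b' (ev L f b'' m))) b) h"
    by (rule cosum_coassoc[OF t h])
  also have "\<dots> = cosum sw P (\<lambda>a b. ev N e a (ev L (hcomp L M N g f) b m)) h"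
  proof (intro cosum_cong h)
    fix a b assume a: "a \<in> carrier H" and b: "b \<in> carrier H"
    show "cosum sw P (\<lambda>b' b''. ev N e a (ev M g b' (ev L f b'' m))) b = ev N e a (ev L (hcomp L M N g f) b m)"
      unfolding ev_hcomp[OF L M N g f b m]
      by (rule lin_cosum[OF bilin_right_lin[OF ev_bilin[OF N P e] a] b, symmetric]) (intro c)
  qed
  also have "\<dots> = ev L (hcomp L N P e (hcomp L M N g f)) h m"
    by (rule ev_hcomp[OF L N P e gf h m, symmetric])
  finally show "ev L (hcomp L M P (hcomp M N P e g) f) h m = ev L (hcomp L N P e (hcomp L M N g f)) h m" .
qed

section \<open>Unit laws and invariant elements\<close>

context
  fixes M N :: "('k, 'h, 'm) hmod"
  assumes M: "pmod M" and N: "pmod N"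
begin

interpretation N: module R N by (rule pmod_module[OF N])

lemma hcomp_hid_left:
  assumes f: "f \<in> carrier (ho M N)" shows "hcomp M N N (hid N) f = f"
proof (rule ev_eqI[OF M N hcomp_closed[OF M N N hid_closed[OF N] f] f])
  fix h m assume h: "h \<in> carrier H" and m: "m \<in> carrier M"
  have "ev M (hcomp M N N (hid N) f) h m = cosum sw N (\<lambda>a b. counit H a \<odot>\<^bsub>N\<^esub> ev M f b m) h"
    unfolding ev_hcomp[OF M N N hid_closed[OF N] f h m]
    by (intro cosum_cong h) (simp add: ev_hid N ev_closed[OF M N f] m)
  also have "\<dots> = ev M f h m"
    by (rule cosum_counit(1)[OF bilin_left_lin[OF ev_bilin[OF M N f] m] h])
  finally show "ev M (hcomp M N N (hid N) f) h m = ev M f h m" .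
qed

lemma hcomp_hid_right:
  assumes f: "f \<in> carrier (ho M N)" shows "hcomp M M N f (hid M) = f"
proof (rule ev_eqI[OF M N hcomp_closed[OF M M N f hid_closed[OF M]] f])
  fix h m assume h: "h \<in> carrier H" and m: "m \<in> carrier M"
  have "ev M (hcomp M M N f (hid M)) h m = cosum sw N (\<lambda>a b. counit H b \<odot>\<^bsub>N\<^esub> ev M f a m) h"
    unfolding ev_hcomp[OF M M N f hid_closed[OF M] h m]
    by (intro cosum_cong h)
      (simp add: ev_hid M m lin_smult[OF bilin_right_lin[OF ev_bilin[OF M N f]]] counit_closed)
  also have "\<dots> = ev M f h m"
    by (rule cosum_counit(2)[OF bilin_left_lin[OF ev_bilin[OF M N f] m] h])
  finally show "ev M (hcomp M M N f (hid M)) h m = ev M f h m" .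
qed

lemma ho_act_invariant:
  assumes u: "u \<in> carrier (ho M N)" and h: "h \<in> carrier H"
    and e: "\<And>k m. k \<in> carrier H \<Longrightarrow> m \<in> carrier M \<Longrightarrow> ev M u (k \<otimes>\<^bsub>H\<^esub> h) m = counit H h \<odot>\<^bsub>N\<^esub> ev M u k m"
  shows "act (ho M N) h u = counit H h \<odot>\<^bsub>ho M N\<^esub> u"
  by (rule ev_eqI[OF M N ho_act_closed[OF M N h u] module.smult_closed[OF ho_module[OF M N] counit_closed[OF h] u]])
    (simp add: ev_act M N h u e lin_smult[OF ev_lin[OF M N]] counit_closed)

text \<open>The value at \<open>h\<close> is the value at the unit of \<open>H\<close> after acting
  by \<open>h\<close>, and on an invariant \<open>h\<close> acts through the counit. So an invariant
  is determined by its underlying map.\<close>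

lemma invariant_ev:
  assumes u: "u \<in> invariants (ho M N)" and h: "h \<in> carrier H" and m: "m \<in> carrier M"
  shows "ev M u h m = counit H h \<odot>\<^bsub>N\<^esub> ev M u \<one>\<^bsub>H\<^esub> m"
proof -
  have uc: "u \<in> carrier (ho M N)" and ui: "act (ho M N) h u = counit H h \<odot>\<^bsub>ho M N\<^esub> u"
    using u h by (auto simp: invariants_def)
  have "ev M u h m = ev M (act (ho M N) h u) \<one>\<^bsub>H\<^esub> m"
    by (simp add: ev_act M N h uc m)
  also have "\<dots> = counit H h \<odot>\<^bsub>N\<^esub> ev M u \<one>\<^bsub>H\<^esub> m"
    unfolding ui by (rule lin_smult[OF ev_lin[OF M N H.one_closed m] counit_closed[OF h] uc])
  finally show ?thesis .
qed

lemma of_map_ev: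
  assumes f: "f \<in> gmaps M N" and h: "h \<in> carrier H" and m: "m \<in> carrier M"
  shows "ev M (of_pbilin M N (\<lambda>h m. counit H h \<odot>\<^bsub>N\<^esub> f m)) h m = counit H h \<odot>\<^bsub>N\<^esub> f m"
  by (rule ev_of_pbilin[OF M N pbilin_of_map[OF M N f] h m])

lemma of_map_invariant:
  assumes f: "f \<in> gmaps M N"
  shows "of_pbilin M N (\<lambda>h m. counit H h \<odot>\<^bsub>N\<^esub> f m) \<in> invariants (ho M N)" (is "?u \<in> _")
proof -
  have uc: "?u \<in> carrier (ho M N)" by (rule of_pbilin_closed[OF M N pbilin_of_map[OF M N f]])
  have "act (ho M N) h ?u = counit H h \<odot>\<^bsub>ho M N\<^esub> ?u" if h: "h \<in> carrier H" for h
  proof (rule ho_act_invariant[OF uc h])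
    fix k m assume k: "k \<in> carrier H" and m: "m \<in> carrier M"
    have "counit H (k \<otimes>\<^bsub>H\<^esub> h) = counit H h \<otimes>\<^bsub>R\<^esub> counit H k"
      by (simp add: counit_mult h k R.m_comm counit_closed)
    then show "ev M ?u (k \<otimes>\<^bsub>H\<^esub> h) m = counit H h \<odot>\<^bsub>N\<^esub> ev M ?u k m"
      using h k m by (simp add: of_map_ev[OF f] N.smult_assoc1 counit_closed module_maps_closed[OF f])
  qed
  then show ?thesis using uc by (simp add: invariants_def)
qed

text \<open>Acting by \<open>h\<close> on \<open>u (1 \<otimes> m)\<close> gives
  \<open>u (h\<^sub>1 \<otimes> h\<^sub>2m)\<close>; invariance turns \<open>h\<^sub>1\<close> into
  a scalar, which the counit law absorbs, leaving \<open>u (1 \<otimes> hm)\<close>.\<close>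

lemma underlying_map_maps:
  assumes u: "u \<in> invariants (ho M N)" shows "underlying_map M u \<in> gmaps M N"
  unfolding underlying_map_def
proof (rule module_mapsI[OF lin_restrict restrict_extensional])
  have uc: "u \<in> carrier (ho M N)" using u by (simp add: invariants_def)
  note b = ev_bilin[OF M N uc]
  show "lin R M N (ev M u \<one>\<^bsub>H\<^esub>)" by (rule bilin_right_lin[OF b H.one_closed])
  fix h m assume h: "h \<in> carrier H" and m: "m \<in> carrier M"
  have "act N h (ev M u \<one>\<^bsub>H\<^esub> m) = cosum sw N (\<lambda>a b. ev M u (a \<otimes>\<^bsub>H\<^esub> \<one>\<^bsub>H\<^esub>) (act M b m)) h"
    using ev_pbilin[OF M N uc] h m by (simp add: pbilin_def)
  also have "\<dots> = cosum sw N (\<lambda>a b. counit H a \<odot>\<^bsub>N\<^esub> ev M u \<one>\<^bsub>H\<^esub> (act M b m)) h"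
    by (intro cosum_cong h) (simp add: invariant_ev[OF u, symmetric] pact_closed M m)
  also have "\<dots> = ev M u \<one>\<^bsub>H\<^esub> (act M h m)"
    by (intro cosum_counit(1)[OF bilin_right[OF b H.one_closed] h] bilin_left_lin[OF pact_bilin[OF M] m])
  finally show "restrict (ev M u \<one>\<^bsub>H\<^esub>) (carrier M) (act M h m) = act N h (restrict (ev M u \<one>\<^bsub>H\<^esub>) (carrier M) m)"
    using h m by (simp add: pact_closed M)
qed

lemma underlying_map_bij: "bij_betw (underlying_map M) (invariants (ho M N)) (gmaps M N)"
proof (intro bij_betw_imageI inj_onI equalityI subsetI)
  fix u v assume u: "u \<in> invariants (ho M N)" and v: "v \<in> invariants (ho M N)" and e: "underlying_map M u = underlying_map M v"
  show "u = v"
  proof (rule ev_eqI[OF M N])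
    fix h m assume h: "h \<in> carrier H" and m: "m \<in> carrier M"
    have "ev M u \<one>\<^bsub>H\<^esub> m = ev M v \<one>\<^bsub>H\<^esub> m" using fun_cong[OF e, of m] m by (simp add: underlying_map_def)
    then show "ev M u h m = ev M v h m" by (simp add: invariant_ev[OF u h m] invariant_ev[OF v h m])
  qed (use u v in \<open>simp_all add: invariants_def\<close>)
next
  show "f \<in> gmaps M N" if "f \<in> underlying_map M ` invariants (ho M N)" for f
    using that underlying_map_maps by auto
next
  fix f assume f: "f \<in> gmaps M N"
  have "f = underlying_map M (of_pbilin M N (\<lambda>h m. counit H h \<odot>\<^bsub>N\<^esub> f m))"
    unfolding underlying_map_def
    by (rule extensionalityI[OF module_maps_extensional[OF f] restrict_extensional])
      (simp add: of_map_ev[OF f] counit_one module_maps_closed[OF f])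
  then show "f \<in> underlying_map M ` invariants (ho M N)" using of_map_invariant[OF f] by (rule image_eqI)
qed

end

lemma hid_act: "pmod M \<Longrightarrow> h \<in> carrier H \<Longrightarrow> act (ho M M) h (hid M) = counit H h \<odot>\<^bsub>ho M M\<^esub> hid M"
  using of_map_invariant[OF _ _ pmaps_id] by (simp add: invariants_def hid_def)

lemma underlying_map_hid: "pmod M \<Longrightarrow> underlying_map M (hid M) = (\<lambda>x\<in>carrier M. x)"
  unfolding underlying_map_def
  by (rule restrict_ext) (simp add: ev_hid counit_one module.smult_one[OF pmod_module])

text \<open>The comultiplication is unital, so at the unit of \<open>H\<close> the Sweedler sum has
  the single term in which both legs are the unit.\<close>

lemma underlying_map_hcomp:
  assumes M: "pmod M" and N: "pmod N" and P: "pmod P" and g: "g \<in> carrier (ho N P)" and f: "f \<in> carrier (ho M N)"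
  shows "underlying_map M (hcomp M N P g f) = compose (carrier M) (underlying_map N g) (underlying_map M f)"
proof (rule extensionalityI[of _ "carrier M"])
  fix m assume m: "m \<in> carrier M"
  have "cosum sw P (\<lambda>a b. ev N g a (ev M f b m)) \<one>\<^bsub>H\<^esub> = ev N g \<one>\<^bsub>H\<^esub> (ev M f \<one>\<^bsub>H\<^esub> m)"
    by (rule cosum_one[OF comp_summand_bilin[OF M N P ev_bilin[OF M N f] ev_bilin[OF N P g] m]])
  then show "underlying_map M (hcomp M N P g f) m = compose (carrier M) (underlying_map N g) (underlying_map M f) m"
    using m by (simp add: underlying_map_def compose_eq ev_hcomp[OF M N P g f] ev_closed[OF M N f])
qed (auto simp: underlying_map_def compose_def)

section \<open>The two enrichments and their underlying categories\<close>

lemma underlying_cat_simps: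
  "objects (underlying_cat V E) = vobjects E" "arrows (underlying_cat V E) = (\<lambda>X Y. arrows V (unit_ob V) (vhom E X Y))"
  "identity (underlying_cat V E) = videntity E"
  by (simp_all add: underlying_cat_def Let_def)

lemma enriched_over_HMod:
  assumes sw: "\<not> sw"
  shows "enriched_over (PMod R H :: (('k, 'h, 'm) hmod, 'm \<Rightarrow> 'm) cat) hmod_cat ho"
proof -
  define E where "E = \<lparr>vobjects = {M. pmod M}, vhom = ho,
    vcomposition = (\<lambda>X Y Z. \<lambda>t\<in>carrier (ho Y Z \<odot>\<odot> ho X Y). tsum (ho X Z) (hcomp X Y Z) (unformal t)),
    videntity = (\<lambda>X. \<lambda>x\<in>carrier gunit. unscalar x \<odot>\<^bsub>ho X X\<^esub> hid X)\<rparr>"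
  have act: "cosum False (ho M P) (\<lambda>a b. hcomp M N P (act (ho N P) a g) (act (ho M N) b f)) h =
      act (ho M P) h (hcomp M N P g f)"
    if "pmod M" "pmod N" "pmod P" "h \<in> carrier H" "g \<in> carrier (ho N P)" "f \<in> carrier (ho M N)" for M N P h g f
    using hcomp_act[OF that] sw by simp
  have E: "enriched_category hmod_cat E"
    "\<And>X Y Z g f. pmod X \<Longrightarrow> pmod Y \<Longrightarrow> pmod Z \<Longrightarrow> g \<in> carrier (ho Y Z) \<Longrightarrow> f \<in> carrier (ho X Y) \<Longrightarrow>
      vcomposition E X Y Z (upure R (ho Y Z) (ho X Y) g f) = hcomp X Y Z g f"
    "\<And>X. pmod X \<Longrightarrow> videntity E X uone = hid X"
    unfolding E_def
    by (rule HMod_enriched[of "{M. pmod M}" ho hcomp hid];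
        (simp add: ho_gmod hcomp_bilin act hid_closed hid_act hcomp_hid_left hcomp_hid_right; fail)?;
        (simp add: hcomp_assoc; fail)?)+
  interpret enriched_category hmod_cat E by (rule E(1))
  have Es: "vobjects E = {M. pmod M}" "vhom E = ho" by (simp_all add: E_def)
  let ?U = "underlying_cat hmod_cat E"
  have "same_category ?U (PMod R H :: (('k, 'h, 'm) hmod, 'm \<Rightarrow> 'm) cat)"
  proof (rule same_category_invariants[where ho = ho and F = "\<lambda>M N. underlying_map M"];
      unfold underlying_cat_simps Es PMod_simps HMod_simps mem_Collect_eq)
    fix X Y Z and f g :: "('k, 't \<Rightarrow> 'm) univ \<Rightarrow> ('k, 't \<Rightarrow> 'm) univ"
    assume o: "pmod X" "pmod Y" "pmod Z" and f: "f \<in> gmaps gunit (ho X Y)" and g: "g \<in> gmaps gunit (ho Y Z)"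
    note fg = module_maps_closed[OF f gunit_one] module_maps_closed[OF g gunit_one]
    \<comment> \<open>The inverse unitor sends \<open>uone\<close> to the pure tensor of
      \<open>uone\<close> with itself, on which the enriched composition is known.\<close>
    have "inverse_arrow hmod_cat (gunit \<odot>\<odot> gunit) gunit (glun gunit :: ('k, 't \<Rightarrow> 'm) univ \<Rightarrow> _) =
      (\<lambda>x\<in>carrier gunit. upure R gunit gunit uone x)"
      by (rule inverse_arrow_eq[OF _ _ glun_inverse[OF gunit_gmod]]) (simp_all add: HMod_simps gten_gmod gunit_gmod)
    then have "composition ?U X Y Z g f uone = hcomp X Y Z (g uone) (f uone)"
      by (simp add: underlying_cat_def Let_def HMod_simps Es compose_eq gunit_one upure_closed gunit_gmod
          gtar_pure[OF gunit_gmod ho_gmod[OF o(2,3)] gunit_gmod ho_gmod[OF o(1,2)] g f] E(2) o fg)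
    then show "underlying_map X (composition ?U X Y Z g f uone) =
      compose (carrier X) (underlying_map Y (g uone)) (underlying_map X (f uone))"
      by (simp add: underlying_map_hcomp o fg)
  qed (simp_all add: ho_gmod underlying_map_bij E(3) underlying_map_hid)
  then show ?thesis
    unfolding enriched_over_def using E(1) Es by (auto simp: PMod_category PMod_simps)
qed

lemma enriched_over_HMod_reverse:
  assumes sw: "sw"
  shows "enriched_over (PMod R H :: (('k, 'h, 'm) hmod, 'm \<Rightarrow> 'm) cat) (reverse_moncat hmod_cat) ho"
proof -
  \<comment> \<open>The opposite category: Hom-objects with exchanged arguments, and composition
    with its two factors exchanged.\<close>
  define E where "E = \<lparr>vobjects = {M. pmod M}, vhom = (\<lambda>X Y. ho Y X),
    vcomposition = (\<lambda>X Y Z. \<lambda>t\<in>carrier (ho Z Y \<odot>\<odot> ho Y X). tsum (ho Z X) (\<lambda>g f. hcomp Z Y X f g) (unformal t)),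
    videntity = (\<lambda>X. \<lambda>x\<in>carrier gunit. unscalar x \<odot>\<^bsub>ho X X\<^esub> hid X)\<rparr>"
  have act: "cosum False (ho M P) (\<lambda>a b. hcomp M N P (act (ho N P) b g) (act (ho M N) a f)) h =
      act (ho M P) h (hcomp M N P g f)"
    if "pmod M" "pmod N" "pmod P" "h \<in> carrier H" "g \<in> carrier (ho N P)" "f \<in> carrier (ho M N)" for M N P h g f
    \<comment> \<open>\<open>hcomp_act\<close> gives the second leg to \<open>g\<close>; as the
      factors of the tensor product are exchanged too, this is the ordinary diagonal action.\<close>
    using hcomp_act[OF that] sw
      cosum_swap_args[of False "ho M P" "\<lambda>a b. hcomp M N P (act (ho N P) a g) (act (ho M N) b f)" h] by simp
  have E: "enriched_category hmod_cat E"
    "\<And>X Y Z g f. pmod X \<Longrightarrow> pmod Y \<Longrightarrow> pmod Z \<Longrightarrow> g \<in> carrier (ho Z Y) \<Longrightarrow> f \<in> carrier (ho Y X) \<Longrightarrow>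
      vcomposition E X Y Z (upure R (ho Z Y) (ho Y X) g f) = hcomp Z Y X f g"
    "\<And>X. pmod X \<Longrightarrow> videntity E X uone = hid X"
    unfolding E_def
    by (rule HMod_enriched[of "{M. pmod M}" "\<lambda>X Y. ho Y X" "\<lambda>X Y Z g f. hcomp Z Y X f g" hid];
        (simp add: ho_gmod bilin_swap[OF hcomp_bilin] act hid_closed hid_act hcomp_hid_left hcomp_hid_right; fail)?;
        (simp add: hcomp_assoc; fail)?)+
  let ?V = "reverse_moncat hmod_cat" and ?E = "opposite_vcat E"
  have E': "enriched_category ?V ?E" by (rule opposite_enriched[OF E(1)])
  interpret enriched_category hmod_cat E by (rule E(1))
  have Es: "vobjects ?E = {M. pmod M}" "vhom ?E = ho" "vhom E = (\<lambda>X Y. ho Y X)" by (simp_all add: E_def opposite_vcat_simps)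
  let ?U = "underlying_cat ?V ?E"
  have "same_category ?U (PMod R H :: (('k, 'h, 'm) hmod, 'm \<Rightarrow> 'm) cat)"
  proof (rule same_category_invariants[where ho = ho and F = "\<lambda>M N. underlying_map M"];
      unfold underlying_cat_simps Es PMod_simps reverse_moncat_simps HMod_simps mem_Collect_eq)
    fix X Y Z and f g :: "('k, 't \<Rightarrow> 'm) univ \<Rightarrow> ('k, 't \<Rightarrow> 'm) univ"
    assume o: "pmod X" "pmod Y" "pmod Z" and f: "f \<in> gmaps gunit (ho X Y)" and g: "g \<in> gmaps gunit (ho Y Z)"
    note fg = module_maps_closed[OF f gunit_one] module_maps_closed[OF g gunit_one]
    \<comment> \<open>The left unitor of the reversed category is the right unitor of the original
      one.\<close>
    have "inverse_arrow hmod_cat (gunit \<odot>\<odot> gunit) gunit (grun gunit :: ('k, 't \<Rightarrow> 'm) univ \<Rightarrow> _) =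
      (\<lambda>x\<in>carrier gunit. upure R gunit gunit x uone)"
      by (rule inverse_arrow_eq[OF _ _ grun_inverse[OF gunit_gmod]]) (simp_all add: HMod_simps gten_gmod gunit_gmod)
    then have "composition ?U X Y Z g f uone = hcomp X Y Z (g uone) (f uone)"
      by (simp add: underlying_cat_def Let_def reverse_moncat_simps reverse_inverse_arrow HMod_simps Es compose_eq
          gunit_one upure_closed gunit_gmod opposite_vcat_simps
          gtar_pure[OF gunit_gmod ho_gmod[OF o(1,2)] gunit_gmod ho_gmod[OF o(2,3)] f g] E(2) o fg)
    then show "underlying_map X (composition ?U X Y Z g f uone) =
      compose (carrier X) (underlying_map Y (g uone)) (underlying_map X (f uone))"
      by (simp add: underlying_map_hcomp o fg)
  qed (simp_all add: ho_gmod underlying_map_bij E(3) underlying_map_hid opposite_vcat_simps)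
  then show ?thesis
    unfolding enriched_over_def using E' Es by (auto simp: PMod_category PMod_simps)
qed

end

section \<open>The two kinds of Hom-object as instances\<close>

lemma lin_of_with_action: "module R V \<Longrightarrow> lin R (with_action V \<pi>) W f \<Longrightarrow> lin R V W f"
  by (simp add: lin_def linear_maps_def)

context hopf_algebra
begin

interpretation H: ring H
  using algebra by (simp add: k_algebra_def)

lemma left_hom_side:
  "hom_side R H False (left_tensor R H) (pure_tensor R H)
    (\<lambda>M h t. tsum (left_tensor R H M) (\<lambda>l m. pure_tensor R H M (l \<otimes>\<^bsub>H\<^esub> h) m) t)
    (left_hom R H :: ('k, 'h, 'm) hmod \<Rightarrow> ('k, 'h, 'm) hmod \<Rightarrow> ('k, 'h, ('h \<times> 'm) list \<Rightarrow> 'm) umod)"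
proof (intro hom_side.intro hopf_algebra_axioms hom_side_axioms.intro)
  fix M :: "('k, 'h, 'm) hmod" assume M: "pmod M"
  interpret T: tensor_product R H M by (intro tensor_product.intro hopf_module pmod_module M)
  let ?T = "left_tensor R H M" and ?p = "pure_tensor R H M"
  have car: "carrier ?T = carrier T.T" and ts: "tsum ?T = tsum T.T" by (simp_all add: left_tensor_def Let_def)
  have act: "act ?T h = (\<lambda>t\<in>carrier T.T. tsum T.T (\<lambda>l m. cosum False T.T (\<lambda>a b. ?p (a \<otimes>\<^bsub>H\<^esub> l) (act M b m)) h) t)" for h
    by (simp add: left_tensor_def Let_def tsum_def cosum_def)
  \<comment> \<open>Naming the action abstractly lets linearity be transferred between
    \<open>T.T\<close> and \<open>?T\<close> without unfolding the Sweedler sum in it.\<close>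
  obtain \<pi> where T: "?T = with_action T.T \<pi>" by (simp add: left_tensor_def Let_def)
  note to_T = lin_to_with_action[where W = T.T and \<pi> = \<pi>, folded T]
    and from_T = lin_from_with_action[where V = T.T and \<pi> = \<pi>, folded T]
    and of_T = lin_of_with_action[where V = T.T and \<pi> = \<pi>, folded T, OF T.tensor_module]
  show "bilin R H M ?T ?p"
    by (rule bilin_comp[OF to_T[OF lin_id[OF T.tensor_module]] T.pure_bilin])
  show "\<exists>\<phi>. lin R ?T N \<phi> \<and> (\<forall>h\<in>carrier H. \<forall>m\<in>carrier M. \<phi> (?p h m) = F h m)"
    if "bilin R H M N F" for N :: "('k, 'h, 'm) hmod" and F
    using from_T[OF T.lift_lin[OF that]] T.tsum_pure[OF that] by blast
  show "\<phi> t = \<psi> t" if "lin R ?T N \<phi>" "lin R ?T N \<psi>" "t \<in> carrier ?T"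
    "\<And>h m. h \<in> carrier H \<Longrightarrow> m \<in> carrier M \<Longrightarrow> \<phi> (?p h m) = \<psi> (?p h m)" for N :: "('k, 'h, 'm) hmod" and \<phi> \<psi> t
    using that(3) by (intro T.tensor_ext[OF of_T[OF that(1)] of_T[OF that(2)] _ that(4)]) (simp_all add: car)
  fix h assume h: "h \<in> carrier H"
  have b: "bilin R H M T.T (\<lambda>l m. cosum False T.T (\<lambda>a b. ?p (a \<otimes>\<^bsub>H\<^esub> l) (act M b m)) h)"
    by (intro bilinI hopf_module pmod_module M T.tensor_module cosum_linI h bilin_left[OF T.pure_bilin]
        bilin_right[OF T.pure_bilin] mult_right_lin pact_closed bilin_right_lin[OF pact_bilin] H.m_closed)
  show "lin R ?T ?T (act ?T h)"
    unfolding act by (intro to_T from_T lin_restrict T.lift_lin b)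
  have c: "bilin R H M T.T (\<lambda>l m. ?p (l \<otimes>\<^bsub>H\<^esub> h) m)"
    by (intro bilinI hopf_module pmod_module M T.tensor_module bilin_right_lin[OF T.pure_bilin]
        bilin_left[OF T.pure_bilin] mult_left_lin h H.m_closed)
  show "lin R ?T ?T (\<lambda>t. tsum ?T (\<lambda>l m. ?p (l \<otimes>\<^bsub>H\<^esub> h) m) t)"
    unfolding ts by (intro to_T from_T T.lift_lin c)
  fix l m assume l: "l \<in> carrier H" and m: "m \<in> carrier M"
  show "act ?T h (?p l m) = cosum False ?T (\<lambda>a b. ?p (a \<otimes>\<^bsub>H\<^esub> l) (act M b m)) h"
    using l m by (simp add: act T.pure_closed T.tsum_pure[OF b]) (simp add: cosum_def ts)
  show "tsum ?T (\<lambda>l m. ?p (l \<otimes>\<^bsub>H\<^esub> h) m) (?p l m) = ?p (l \<otimes>\<^bsub>H\<^esub> h) m"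
    unfolding ts by (rule T.tsum_pure[OF c l m])
qed (simp add: left_hom_def Let_def tsum_def)

text \<open>The locale lists the argument from \<open>H\<close> first and the vector second, against
  the order of the tensor factors. With the flag set, the first leg thereby acts on the vector and
  the second multiplies the factor in \<open>H\<close>, as the action on
  \<open>M \<otimes> H\<close> demands.\<close>

lemma right_hom_side:
  "hom_side R H True (right_tensor R H) (\<lambda>M h m. pure_tensor R M H m h)
    (\<lambda>M h t. tsum (right_tensor R H M) (\<lambda>m l. pure_tensor R M H m (l \<otimes>\<^bsub>H\<^esub> h)) t)
    (right_hom R H :: ('k, 'h, 'm) hmod \<Rightarrow> ('k, 'h, 'm) hmod \<Rightarrow> ('k, 'h, ('m \<times> 'h) list \<Rightarrow> 'm) umod)"
proof (intro hom_side.intro hopf_algebra_axioms hom_side_axioms.intro)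
  fix M :: "('k, 'h, 'm) hmod" assume M: "pmod M"
  interpret T: tensor_product R M H by (intro tensor_product.intro hopf_module pmod_module M)
  let ?T = "right_tensor R H M" and ?p = "pure_tensor R M H"
  have car: "carrier ?T = carrier T.T" and ts: "tsum ?T = tsum T.T" by (simp_all add: right_tensor_def Let_def)
  have act: "act ?T h = (\<lambda>t\<in>carrier T.T. tsum T.T (\<lambda>m l. cosum False T.T (\<lambda>a b. ?p (act M a m) (b \<otimes>\<^bsub>H\<^esub> l)) h) t)" for h
    by (simp add: right_tensor_def Let_def tsum_def cosum_def)
  obtain \<pi> where T: "?T = with_action T.T \<pi>" by (simp add: right_tensor_def Let_def)
  note to_T = lin_to_with_action[where W = T.T and \<pi> = \<pi>, folded T]
    and from_T = lin_from_with_action[where V = T.T and \<pi> = \<pi>, folded T]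
    and of_T = lin_of_with_action[where V = T.T and \<pi> = \<pi>, folded T, OF T.tensor_module]
  show "bilin R H M ?T (\<lambda>h m. ?p m h)"
    by (rule bilin_comp[OF to_T[OF lin_id[OF T.tensor_module]] bilin_swap[OF T.pure_bilin]])
  show "\<exists>\<phi>. lin R ?T N \<phi> \<and> (\<forall>h\<in>carrier H. \<forall>m\<in>carrier M. \<phi> (?p m h) = F h m)"
    if "bilin R H M N F" for N :: "('k, 'h, 'm) hmod" and F
    using from_T[OF T.lift_lin[OF bilin_swap[OF that]]] T.tsum_pure[OF bilin_swap[OF that]] by blast
  show "\<phi> t = \<psi> t" if "lin R ?T N \<phi>" "lin R ?T N \<psi>" "t \<in> carrier ?T"
    "\<And>h m. h \<in> carrier H \<Longrightarrow> m \<in> carrier M \<Longrightarrow> \<phi> (?p m h) = \<psi> (?p m h)" for N :: "('k, 'h, 'm) hmod" and \<phi> \<psi> t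
    using that(3) by (intro T.tensor_ext[OF of_T[OF that(1)] of_T[OF that(2)] _ that(4)]) (simp_all add: car)
  fix h assume h: "h \<in> carrier H"
  have b: "bilin R M H T.T (\<lambda>m l. cosum False T.T (\<lambda>a b. ?p (act M a m) (b \<otimes>\<^bsub>H\<^esub> l)) h)"
    by (intro bilinI hopf_module pmod_module M T.tensor_module cosum_linI h bilin_left[OF T.pure_bilin]
        bilin_right[OF T.pure_bilin] mult_right_lin pact_closed bilin_right_lin[OF pact_bilin] H.m_closed)
  show "lin R ?T ?T (act ?T h)"
    unfolding act by (intro to_T from_T lin_restrict T.lift_lin b)
  have c: "bilin R M H T.T (\<lambda>m l. ?p m (l \<otimes>\<^bsub>H\<^esub> h))"
    by (intro bilinI hopf_module pmod_module M T.tensor_module bilin_left_lin[OF T.pure_bilin]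
        bilin_right[OF T.pure_bilin] mult_left_lin h H.m_closed)
  show "lin R ?T ?T (\<lambda>t. tsum ?T (\<lambda>m l. ?p m (l \<otimes>\<^bsub>H\<^esub> h)) t)"
    unfolding ts by (intro to_T from_T T.lift_lin c)
  fix l m assume l: "l \<in> carrier H" and m: "m \<in> carrier M"
  show "act ?T h (?p m l) = cosum True ?T (\<lambda>a b. ?p (act M b m) (a \<otimes>\<^bsub>H\<^esub> l)) h"
    using l m by (simp add: act T.pure_closed T.tsum_pure[OF b]) (simp add: cosum_def ts)
  show "tsum ?T (\<lambda>m l. ?p m (l \<otimes>\<^bsub>H\<^esub> h)) (?p m l) = ?p m (l \<otimes>\<^bsub>H\<^esub> h)"
    unfolding ts by (rule T.tsum_pure[OF c m l])
qed (simp add: right_hom_def Let_def tsum_def)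

end

theorem theorem3p4:
  fixes R :: "('k, 'r) ring_scheme"
    and H :: "('k, 'h, 'z) hopf_scheme"
  assumes "hopf_algebra R H"
    and "bij_betw (antipode H) (carrier H) (carrier H)"
  shows "enriched_over (PMod R H :: (('k, 'h, 'm) hmod, 'm \<Rightarrow> 'm) cat)
           (HMod R H) (left_hom R H) \<and>
         enriched_over (PMod R H :: (('k, 'h, 'm) hmod, 'm \<Rightarrow> 'm) cat)
           (reverse_moncat (HMod R H)) (right_hom R H)"
proof
  interpret hopf_algebra R H by (rule assms(1))
  show "enriched_over (PMod R H :: (('k, 'h, 'm) hmod, 'm \<Rightarrow> 'm) cat) (HMod R H) (left_hom R H)"
    by (rule hom_side.enriched_over_HMod[OF left_hom_side]) simp
  show "enriched_over (PMod R H :: (('k, 'h, 'm) hmod, 'm \<Rightarrow> 'm) cat) (reverse_moncat (HMod R H)) (right_hom R H)"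
    by (rule hom_side.enriched_over_HMod_reverse[OF right_hom_side]) simp
qed

end
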